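(* Let $p$ be an odd prime, $N$ a prime with $N\equiv1\pmod p$, $K=\mathbb{Q}(\zeta_p)$ and $L=K(N^{1/p})$. Then $N\equiv1\pmod{p^2}$ if and only if $\zeta_p\in\operatorname{Norm}_{L/K}(L^\times)$. *)

theory Defs
  imports
    Complex_Main
    "HOL-Number_Theory.Cong"
    "HOL-Algebra.Generated_Fields"
    "HOL-Algebra.Embedded_Algebras"
    "HOL-Algebra.Algebraic_Closure_Type"
    "Jordan_Normal_Form.Determinant"
begin

definition primitive_root_of_unity :: "nat \<Rightarrow> 'a::field \<Rightarrow> bool" where
  "primitive_root_of_unity n z \<longleftrightarrow> 0 < n \<and> z ^ n = 1 \<and> (\<forall>k. 0 < k \<and> k < n \<longrightarrow> z ^ k \<noteq> 1)"

text \<open>The ground field is omitted: a subfield of a field of characteristic 0 contains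
  the rationals, so that the subfield generated by \<open>S\<close> is \<open>\<rat>(S)\<close>.\<close>

definition gen_field :: "'a::field set \<Rightarrow> 'a set" where
  "gen_field S = generate_field ring_of_type_algebra S"

definition is_basis :: "'a::field set \<Rightarrow> 'a set \<Rightarrow> 'a list \<Rightarrow> bool" where
  "is_basis K L bs \<longleftrightarrow>
     ring.independent ring_of_type_algebra K bs \<and> ring.Span ring_of_type_algebra K bs = L"

definition is_mult_matrix :: "'a::field set \<Rightarrow> 'a list \<Rightarrow> 'a \<Rightarrow> 'a mat \<Rightarrow> bool" where
  "is_mult_matrix K bs x A \<longleftrightarrow>
     A \<in> carrier_mat (length bs) (length bs) \<and> elements_mat A \<subseteq> K \<and>
     (\<forall>j<length bs. x * bs ! j = (\<Sum>i<length bs. A $$ (i, j) * bs ! i))"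

text \<open>The norm of \<open>x\<close> is the determinant of the \<open>K\<close>-linear map \<open>y \<mapsto> x y\<close> on \<open>L\<close>. The
  description is proper only if \<open>K \<subseteq> L\<close> are fields, \<open>L\<close> is finite over \<open>K\<close> and \<open>x \<in> L\<close>;
  see \<open>field_norm_eq_det\<close> and \<open>ex_mult_matrix\<close>.\<close>

definition field_norm :: "'a::field set \<Rightarrow> 'a set \<Rightarrow> 'a \<Rightarrow> 'a" where
  "field_norm K L x =
     (THE d. \<exists>bs A. is_basis K L bs \<and> is_mult_matrix K bs x A \<and> d = det A)"

lemma ring_of_type_algebra_sel:
  "carrier (ring_of_type_algebra :: 'a::field ring) = UNIV"
  "\<zero>\<^bsub>ring_of_type_algebra :: 'a ring\<^esub> = 0"
  "\<one>\<^bsub>ring_of_type_algebra :: 'a ring\<^esub> = 1"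
  "(x::'a) \<oplus>\<^bsub>ring_of_type_algebra\<^esub> y = x + y"
  "(x::'a) \<otimes>\<^bsub>ring_of_type_algebra\<^esub> y = x * y"
  by (simp_all add: ring_of_type_algebra_def)

lemma sum_basis_unfold:
  fixes Ks :: "'a::field list"
  assumes "length Ks = length bs"
  shows "ring.combine ring_of_type_algebra Ks bs = (\<Sum>i<length bs. Ks ! i * bs ! i)"
proof -
  interpret F: ring "ring_of_type_algebra :: 'a ring" by (rule ring_from_type_algebra)
  show ?thesis
    using assms
    by (induction Ks bs rule: list_induct2)
       (simp_all add: ring_of_type_algebra_sel sum.lessThan_Suc_shift del: sum.lessThan_Suc)
qed

lemma is_basis_span:
  fixes K :: "'a::field set"
  assumes K: "subfield K ring_of_type_algebra" and bs: "is_basis K L bs"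
  shows "y \<in> L \<longleftrightarrow> (\<exists>c. (\<forall>i<length bs. c i \<in> K) \<and> y = (\<Sum>i<length bs. c i * bs ! i))"
proof -
  interpret F: ring "ring_of_type_algebra :: 'a ring" by (rule ring_from_type_algebra)
  have "y \<in> L \<longleftrightarrow> (\<exists>Ks. length Ks = length bs \<and> set Ks \<subseteq> K \<and> y = F.combine Ks bs)"
    using bs F.Span_eq_combine_set_length_version[OF K, of bs]
    by (auto simp: is_basis_def ring_of_type_algebra_def)
  also have "\<dots> \<longleftrightarrow> (\<exists>c. (\<forall>i<length bs. c i \<in> K) \<and> y = (\<Sum>i<length bs. c i * bs ! i))"
  proof
    assume "\<exists>Ks. length Ks = length bs \<and> set Ks \<subseteq> K \<and> y = F.combine Ks bs"
    then obtain Ks where "length Ks = length bs" "set Ks \<subseteq> K" "y = F.combine Ks bs" by blast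
    then show "\<exists>c. (\<forall>i<length bs. c i \<in> K) \<and> y = (\<Sum>i<length bs. c i * bs ! i)"
      by (intro exI[of _ "\<lambda>i. Ks ! i"]) (auto simp: sum_basis_unfold)
  next
    assume "\<exists>c. (\<forall>i<length bs. c i \<in> K) \<and> y = (\<Sum>i<length bs. c i * bs ! i)"
    then obtain c where c: "\<forall>i<length bs. c i \<in> K" "y = (\<Sum>i<length bs. c i * bs ! i)" by blast
    then show "\<exists>Ks. length Ks = length bs \<and> set Ks \<subseteq> K \<and> y = F.combine Ks bs"
      by (intro exI[of _ "map c [0..<length bs]"]) (auto simp: sum_basis_unfold)
  qed
  finally show ?thesis .
qed

lemma is_basis_independent:
  fixes K :: "'a::field set"
  assumes K: "subfield K ring_of_type_algebra" and bs: "is_basis K L bs"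
    and c: "\<forall>i<length bs. c i \<in> K" "(\<Sum>i<length bs. c i * bs ! i) = 0" and i: "i < length bs"
  shows "c i = 0"
proof -
  interpret F: ring "ring_of_type_algebra :: 'a ring" by (rule ring_from_type_algebra)
  have "set (take (length bs) (map c [0..<length bs])) \<subseteq> {\<zero>\<^bsub>ring_of_type_algebra\<^esub>}"
  proof (rule F.independent_imp_trivial_combine[OF K])
    show "F.independent K bs" using bs by (simp add: is_basis_def)
    show "set (map c [0..<length bs]) \<subseteq> K" using c by auto
    show "F.combine (map c [0..<length bs]) bs = \<zero>\<^bsub>ring_of_type_algebra\<^esub>"
      using c(2) by (simp add: sum_basis_unfold) (simp add: ring_of_type_algebra_def)
  qed
  then have "c i \<in> {0}" using i by (fastforce simp: ring_of_type_algebra_sel)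
  then show ?thesis by simp
qed

lemma subfield_props:
  fixes K :: "'a::field set"
  assumes K: "subfield K ring_of_type_algebra"
  shows "0 \<in> K" "1 \<in> K" "a \<in> K \<Longrightarrow> b \<in> K \<Longrightarrow> a + b \<in> K" "a \<in> K \<Longrightarrow> b \<in> K \<Longrightarrow> a * b \<in> K"
    "a \<in> K \<Longrightarrow> - a \<in> K"
proof -
  interpret F: ring "ring_of_type_algebra :: 'a ring" by (rule ring_from_type_algebra)
  note sr = subfieldE(1)[OF K]
  show "0 \<in> K" "1 \<in> K" "a \<in> K \<Longrightarrow> b \<in> K \<Longrightarrow> a + b \<in> K" "a \<in> K \<Longrightarrow> b \<in> K \<Longrightarrow> a * b \<in> K"
    using subringE(2,3,6,7)[OF sr] by (simp_all add: ring_of_type_algebra_def)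
  assume a: "a \<in> K"
  have "\<ominus>\<^bsub>ring_of_type_algebra\<^esub> a = - a"
    by (rule F.minus_equality) (simp_all add: ring_of_type_algebra_def)
  then show "- a \<in> K" using subringE(5)[OF sr a] by simp
qed

lemma subfield_sum:
  fixes K :: "'a::field set"
  assumes K: "subfield K ring_of_type_algebra" and "\<And>i. i \<in> I \<Longrightarrow> f i \<in> K"
  shows "sum f I \<in> K"
  using assms(2) by (induction I rule: infinite_finite_induct) (auto simp: subfield_props[OF K])

lemma elements_mat_subset_iff:
  "elements_mat A \<subseteq> K \<longleftrightarrow> (\<forall>i<dim_row A. \<forall>j<dim_col A. A $$ (i, j) \<in> K)"
  unfolding elements_mat_def by fastforce

definition list_row :: "'a::field list \<Rightarrow> 'a mat" where
  "list_row bs = mat 1 (length bs) (\<lambda>(_, i). bs ! i)"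

lemma list_row_carrier [simp]: "list_row bs \<in> carrier_mat 1 (length bs)"
  by (simp add: list_row_def)

lemma list_row_mult:
  assumes "A \<in> carrier_mat (length bs) m" "j < m"
  shows "(list_row bs * A) $$ (0, j) = (\<Sum>i<length bs. A $$ (i, j) * bs ! i)"
  using assms
  by (auto simp: list_row_def scalar_prod_def mult.commute lessThan_atLeast0 intro!: sum.cong)

lemma list_row_cancel:
  fixes K :: "'a::field set"
  assumes K: "subfield K ring_of_type_algebra" and bs: "is_basis K L bs"
    and A: "A \<in> carrier_mat (length bs) m" "elements_mat A \<subseteq> K"
    and B: "B \<in> carrier_mat (length bs) m" "elements_mat B \<subseteq> K"
    and eq: "list_row bs * A = list_row bs * B"
  shows "A = B"
proof (rule eq_matI)
  show "dim_row A = dim_row B" "dim_col A = dim_col B" using A B by auto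
  fix i j assume ij: "i < dim_row B" "j < dim_col B"
  have "(\<Sum>i<length bs. (A $$ (i, j) - B $$ (i, j)) * bs ! i) = 0"
    using arg_cong[OF eq, of "\<lambda>M. M $$ (0, j)"] ij A B
    by (simp add: list_row_mult left_diff_distrib sum_subtractf)
  moreover have "\<forall>i<length bs. A $$ (i, j) - B $$ (i, j) \<in> K"
    using A B ij subfield_props(3,5)[OF K]
    by (auto simp: elements_mat_subset_iff) (metis add_uminus_conv_diff)
  ultimately have "A $$ (i, j) - B $$ (i, j) = 0"
    using is_basis_independent[OF K bs, of "\<lambda>i. A $$ (i, j) - B $$ (i, j)" i] ij B by auto
  then show "A $$ (i, j) = B $$ (i, j)" by simp
qed

lemma list_row_represent:
  fixes K :: "'a::field set"
  assumes K: "subfield K ring_of_type_algebra" and bs: "is_basis K L bs" and cs: "set cs \<subseteq> L"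
  shows "\<exists>P. P \<in> carrier_mat (length bs) (length cs) \<and> elements_mat P \<subseteq> K \<and>
    list_row cs = list_row bs * P"
proof -
  have "\<forall>j. \<exists>c. j < length cs \<longrightarrow>
      (\<forall>i<length bs. c i \<in> K) \<and> cs ! j = (\<Sum>i<length bs. c i * bs ! i)"
    using is_basis_span[OF K bs] cs by (metis nth_mem subsetD)
  then obtain c where c: "\<And>j. j < length cs \<Longrightarrow>
      (\<forall>i<length bs. c j i \<in> K) \<and> cs ! j = (\<Sum>i<length bs. c j i * bs ! i)" by metis
  let ?P = "mat (length bs) (length cs) (\<lambda>(i, j). c j i)"
  have "list_row cs = list_row bs * ?P"
  proof (rule eq_matI)
    fix i j assume ij: "i < dim_row (list_row bs * ?P)" "j < dim_col (list_row bs * ?P)"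
    then have "i = 0" "j < length cs" by (auto simp: list_row_def)
    then show "list_row cs $$ (i, j) = (list_row bs * ?P) $$ (i, j)"
      using c[of j] by (subst \<open>i = 0\<close>, subst list_row_mult) (auto simp: list_row_def)
  qed (auto simp: list_row_def)
  moreover have "elements_mat ?P \<subseteq> K" using c by (auto simp: elements_mat_subset_iff)
  ultimately show ?thesis by (intro exI[of _ ?P]) auto
qed

lemma is_mult_matrix_iff:
  "is_mult_matrix K bs x A \<longleftrightarrow> A \<in> carrier_mat (length bs) (length bs) \<and> elements_mat A \<subseteq> K \<and>
     x \<cdot>\<^sub>m list_row bs = list_row bs * A"
proof -
  have "x \<cdot>\<^sub>m list_row bs = list_row bs * A \<longleftrightarrow>
      (\<forall>j<length bs. x * bs ! j = (\<Sum>i<length bs. A $$ (i, j) * bs ! i))"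
    if A: "A \<in> carrier_mat (length bs) (length bs)"
  proof -
    have "x \<cdot>\<^sub>m list_row bs = list_row bs * A \<longleftrightarrow>
        (\<forall>j<length bs. (x \<cdot>\<^sub>m list_row bs) $$ (0, j) = (list_row bs * A) $$ (0, j))"
      using A by (subst mat_eq_iff) (auto simp: list_row_def)
    also have "\<dots> \<longleftrightarrow> (\<forall>j<length bs. x * bs ! j = (list_row bs * A) $$ (0, j))"
      by (simp add: list_row_def)
    also have "\<dots> \<longleftrightarrow> (\<forall>j<length bs. x * bs ! j = (\<Sum>i<length bs. A $$ (i, j) * bs ! i))"
      using list_row_mult[OF A] by metis
    finally show ?thesis .
  qed
  then show ?thesis unfolding is_mult_matrix_def by blast
qed

lemma elements_mat_mult_closed:
  fixes K :: "'a::field set"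
  assumes K: "subfield K ring_of_type_algebra"
    and A: "A \<in> carrier_mat n m" "elements_mat A \<subseteq> K"
    and B: "B \<in> carrier_mat m k" "elements_mat B \<subseteq> K"
  shows "elements_mat (A * B) \<subseteq> K"
  unfolding elements_mat_subset_iff
proof (intro allI impI)
  fix i j assume "i < dim_row (A * B)" "j < dim_col (A * B)"
  then have ij: "i < n" "j < k" using A(1) B(1) by auto
  have "(A * B) $$ (i, j) = (\<Sum>l<m. A $$ (i, l) * B $$ (l, j))"
    using A(1) B(1) ij by (simp add: scalar_prod_def lessThan_atLeast0)
  also have "\<dots> \<in> K"
    using A B ij unfolding elements_mat_subset_iff
    by (intro subfield_sum[OF K] subfield_props(4)[OF K]) auto
  finally show "(A * B) $$ (i, j) \<in> K" .
qed

lemma is_basis_length_eq: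
  fixes K :: "'a::field set"
  assumes K: "subfield K ring_of_type_algebra" and "is_basis K L bs" "is_basis K L cs"
  shows "length bs = length cs"
proof -
  interpret F: ring "ring_of_type_algebra :: 'a ring" by (rule ring_from_type_algebra)
  show ?thesis
    by (rule F.dimension_is_inj[OF K, of _ L])
       (use F.dimension_independent[of K bs] F.dimension_independent[of K cs] assms(2,3) in
         \<open>simp_all only: is_basis_def\<close>)
qed

lemma is_basis_subset:
  fixes K :: "'a::field set"
  assumes K: "subfield K ring_of_type_algebra" and "is_basis K L bs"
  shows "set bs \<subseteq> L"
proof -
  interpret F: ring "ring_of_type_algebra :: 'a ring" by (rule ring_from_type_algebra)
  show ?thesis
    using F.Span_base_incl[OF K, of bs] assms(2)
    by (auto simp: is_basis_def ring_of_type_algebra_def)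
qed

lemma ex_mult_matrix:
  fixes K L :: "'a::field set"
  assumes K: "subfield K ring_of_type_algebra" and L: "subfield L ring_of_type_algebra"
    and bs: "is_basis K L bs" and x: "x \<in> L"
  shows "\<exists>A. is_mult_matrix K bs x A"
proof -
  have "set (map ((*) x) bs) \<subseteq> L"
    using is_basis_subset[OF K bs] subfield_props(4)[OF L x] by auto
  from list_row_represent[OF K bs this] obtain A where
    A: "A \<in> carrier_mat (length bs) (length bs)" "elements_mat A \<subseteq> K"
      "list_row (map ((*) x) bs) = list_row bs * A" by auto
  have "list_row (map ((*) x) bs) = x \<cdot>\<^sub>m list_row bs"
    by (auto simp: list_row_def intro!: eq_matI)
  then show ?thesis using A by (auto simp: is_mult_matrix_iff)
qed

lemma det_mult_matrix_unique:
  fixes K :: "'a::field set"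
  assumes K: "subfield K ring_of_type_algebra"
    and bs: "is_basis K L bs" and cs: "is_basis K L cs"
    and A: "is_mult_matrix K bs x A" and B: "is_mult_matrix K cs x B"
  shows "det A = det B"
proof -
  define n where "n = length bs"
  have n: "length bs = n" "length cs = n"
    using is_basis_length_eq[OF K bs cs] by (simp_all add: n_def)
  obtain P where P: "P \<in> carrier_mat n n" "elements_mat P \<subseteq> K" "list_row cs = list_row bs * P"
    using list_row_represent[OF K bs is_basis_subset[OF K cs]] n by auto
  obtain Q where Q: "Q \<in> carrier_mat n n" "elements_mat Q \<subseteq> K" "list_row bs = list_row cs * Q"
    using list_row_represent[OF K cs is_basis_subset[OF K bs]] n by auto
  have A': "A \<in> carrier_mat n n" "elements_mat A \<subseteq> K" "x \<cdot>\<^sub>m list_row bs = list_row bs * A"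
    using A n by (auto simp: is_mult_matrix_iff)
  have B': "B \<in> carrier_mat n n" "elements_mat B \<subseteq> K" "x \<cdot>\<^sub>m list_row cs = list_row cs * B"
    using B n by (auto simp: is_mult_matrix_iff)
  have bc [simp]: "list_row bs \<in> carrier_mat 1 n" "list_row cs \<in> carrier_mat 1 n"
    using list_row_carrier[of bs] list_row_carrier[of cs] n by simp_all
  have one: "elements_mat (1\<^sub>m n :: 'a mat) \<subseteq> K"
    by (auto simp: elements_mat_subset_iff one_mat_def subfield_props[OF K])
  have "list_row bs * (P * Q) = list_row bs * 1\<^sub>m n"
    unfolding assoc_mult_mat[OF bc(1) P(1) Q(1), symmetric] P(3)[symmetric] Q(3)[symmetric]
      right_mult_one_mat[OF bc(1)] ..
  then have PQ: "P * Q = 1\<^sub>m n"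
    by (intro list_row_cancel[OF K bs _ elements_mat_mult_closed[OF K P(1,2) Q(1,2)] _ one])
       (auto simp only: n intro: mult_carrier_mat[OF P(1) Q(1)] one_carrier_mat)
  have "list_row bs * (A * P) = (list_row bs * A) * P"
    by (rule assoc_mult_mat[OF bc(1) A'(1) P(1), symmetric])
  also have "\<dots> = x \<cdot>\<^sub>m list_row cs"
    unfolding A'(3)[symmetric] P(3) by (rule mult_smult_assoc_mat[OF bc(1) P(1)])
  also have "\<dots> = (list_row bs * P) * B"
    unfolding P(3)[symmetric] by (rule B'(3))
  also have "\<dots> = list_row bs * (P * B)"
    by (rule assoc_mult_mat[OF bc(1) P(1) B'(1)])
  finally have eq: "list_row bs * (A * P) = list_row bs * (P * B)" .
  have "A * P = P * B"
    by (rule list_row_cancel[OF K bs _ elements_mat_mult_closed[OF K A'(1,2) P(1,2)]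
          _ elements_mat_mult_closed[OF K P(1,2) B'(1,2)] eq])
       (auto simp only: n intro: mult_carrier_mat[OF A'(1) P(1)] mult_carrier_mat[OF P(1) B'(1)])
  then have "det A * det P = det P * det B"
    by (metis det_mult[OF A'(1) P(1)] det_mult[OF P(1) B'(1)])
  moreover have "det P \<noteq> 0"
    using det_mult[OF P(1) Q(1)] unfolding PQ det_one by force
  ultimately show ?thesis by simp
qed

lemma field_norm_eq_det:
  fixes K :: "'a::field set"
  assumes K: "subfield K ring_of_type_algebra"
    and bs: "is_basis K L bs" and A: "is_mult_matrix K bs x A"
  shows "field_norm K L x = det A"
  unfolding field_norm_def
proof (rule the_equality)
  show "\<exists>cs B. is_basis K L cs \<and> is_mult_matrix K cs x B \<and> det A = det B"
    using bs A by blast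
  show "d = det A" if "\<exists>cs B. is_basis K L cs \<and> is_mult_matrix K cs x B \<and> d = det B" for d
    using that det_mult_matrix_unique[OF K _ bs _ A] by metis
qed

end

theory Submission
  imports Defs
    "Jordan_Normal_Form.Char_Poly"
    "HOL-Number_Theory.Residue_Primitive_Roots"
    "HOL-Computational_Algebra.Fundamental_Theorem_Algebra"
begin

text \<open>
Let \<open>F = K(\<xi>)\<close> with \<open>\<xi>\<^sup>p = \<zeta>\<close>; this is the field of \<open>p\<^sup>2\<close>-th roots of unity.

If \<open>\<zeta>\<close> is a norm from \<open>L\<close>, consider a prime of \<open>K\<close> above \<open>N\<close>: it has degree one and is totally and
tamely ramified in \<open>L\<close>, so that the norm of an integral \<open>a\<^sub>0 + a\<^sub>1 \<alpha> + \<dots>\<close> is congruent to \<open>a\<^sub>0\<^sup>p\<close>.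
Hence \<open>\<zeta>\<close> is a \<open>p\<close>-th power modulo \<open>N\<close>, and \<open>\<int>/N\<close> contains a unit of order \<open>p\<^sup>2\<close>.

Conversely, \<open>\<zeta> = \<xi>\<^sup>p\<close> is a norm from \<open>K(\<alpha>)\<close> if and only if \<open>N = \<alpha>\<^sup>p\<close> is a norm from \<open>K(\<xi>)\<close>, and for
this it is enough that \<open>N\<close> is a norm to \<open>\<rat>\<close> from the subfield of \<open>F\<close> of degree \<open>p\<close>. If \<open>N \<equiv> 1\<close>
modulo \<open>p\<^sup>2\<close> then \<open>N\<close> splits completely in \<open>F\<close>. As only \<open>p\<close> ramifies in that subfield, and totally,
genus theory shows that its class number is prime to \<open>p\<close>; some power of a prime above \<open>N\<close>, with
exponent prime to \<open>p\<close>, is therefore principal, and \<open>N\<close> is a norm because \<open>N\<^sup>p\<close> is one. In place of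
class groups the argument below uses \<open>{p, N}\<close>-units: if \<open>p\<close> divided the \<open>N\<close>-adic valuation of the
norm of each of them, then genus theory would allow their divisors to be divided by \<open>\<sigma> - 1\<close> again and
again, up to Galois invariant divisors and factors prime to \<open>p\<close>, so that all these divisors would be
Galois invariant; the box principle produces one that is not.
\<close>

text \<open>Passing from \<open>K(\<alpha>)\<close> to \<open>K(\<xi>)\<close> is possible because
  being a norm is a symmetric relation between \<open>\<zeta>\<close> and \<open>N\<close>: either
  statement says that the same cyclic algebra splits. In \<open>K(\<xi>)\<close> the element to be
  represented is rational, so norms down to \<rat> can be used. Divisibility of the valuation of a
  norm by \<open>p\<close> is what feeds the descent: a power of \<open>N\<close> can then be split
  off, the norm becomes 1, and Hilbert 90 applies. Each step costs a factor
  \<open>2 * (p - 1)\<close>: the 2 because norms of units are known only up to sign, the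
  \<open>p - 1\<close> because \<open>N\<close> has norm \<open>N ^ (p * (p - 1))\<close>. Both are
  prime to \<open>p\<close>, whereas every \<open>p\<close> steps gain a factor \<open>p\<close>;
  the valuations of one fixed element cannot support this indefinitely unless they are constant. The
  obstacle is to do this without ideals. Elements are integer polynomials evaluated at a root of
  unity, a prime above \<open>N\<close> is evaluation at an integer modulo \<open>N\<close>, and
  statements about divisors become statements about units of \<open>\<int>[z]\<close> with
  \<open>p\<close> and \<open>N\<close> inverted.\<close>

hide_const (open) up_ring.coeff up_ring.monom Divisibility.prime

section \<open>Irreducibility of the cyclotomic polynomial of prime power order\<close>

text \<open>Since \<open>p * p\<close> does not divide the constant term of \<open>f\<close>, one
  factor \<open>b\<close> has constant term prime to \<open>p\<close>. Then the lowest coefficient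
  prime to \<open>p\<close> of the other factor \<open>a\<close>, in position \<open>i\<close>,
  makes \<open>coeff f i\<close> prime to \<open>p\<close>. Hence
  \<open>degree f \<le> i \<le> degree a\<close>, and \<open>b\<close> is constant.\<close>

lemma eisenstein_factor:
  fixes f g h :: "int poly" and p :: int
  assumes p: "prime p" and f: "f = g * h"
    and low: "\<And>i. i < degree f \<Longrightarrow> p dvd coeff f i"
    and lead: "\<not> p dvd lead_coeff f" and p2: "\<not> p * p dvd coeff f 0"
  shows "degree g = 0 \<or> degree h = 0"
proof -
  have key: "degree b = 0"
    if fab: "f = a * b" and b0: "\<not> p dvd coeff b 0" for a b :: "int poly"
  proof -
    have "f \<noteq> 0" using lead by auto
    then have ab: "a \<noteq> 0" "b \<noteq> 0" using fab by auto
    have "lead_coeff f = lead_coeff a * lead_coeff b" by (simp add: fab lead_coeff_mult)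
    then have "\<not> p dvd coeff a (degree a)" using lead by auto
    define i where "i = (LEAST i. \<not> p dvd coeff a i)"
    have i: "\<not> p dvd coeff a i" unfolding i_def by (rule LeastI) fact
    have less: "p dvd coeff a j" if "j < i" for j using not_less_Least that unfolding i_def by blast
    have le: "i \<le> degree a" unfolding i_def by (rule Least_le) fact
    have "coeff f i = (\<Sum>j\<le>i. coeff a j * coeff b (i - j))" by (simp add: fab coeff_mult)
    also have "\<dots> = (\<Sum>j<i. coeff a j * coeff b (i - j)) + coeff a i * coeff b 0"
      by (simp add: lessThan_Suc_atMost[symmetric])
    finally have eq: "coeff f i = (\<Sum>j<i. coeff a j * coeff b (i - j)) + coeff a i * coeff b 0" .
    have "p dvd (\<Sum>j<i. coeff a j * coeff b (i - j))" by (intro dvd_sum dvd_mult2) (auto intro: less)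
    moreover have "\<not> p dvd coeff a i * coeff b 0" using i b0 p by (simp add: prime_dvd_mult_iff)
    ultimately have "\<not> p dvd coeff f i" unfolding eq by (simp add: dvd_add_right_iff)
    then have "degree f \<le> i" using low leI by blast
    moreover have "degree f = degree a + degree b" using ab by (simp add: fab degree_mult_eq)
    ultimately show ?thesis using le by simp
  qed
  have "\<not> (p dvd coeff g 0 \<and> p dvd coeff h 0)"
    using p2 by (auto simp: f coeff_mult intro: mult_dvd_mono)
  then show ?thesis using key[of g h] key[of h g] f by (auto simp: mult.commute)
qed

lemma prime_dvd_binomial_diff:
  fixes a b :: "'a::comm_ring_1"
  assumes p: "prime p"
  shows "of_nat p dvd (a + b) ^ p - (a ^ p + b ^ p)"
proof -
  have p0: "0 < p" using p by (simp add: prime_gt_0_nat)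
  let ?t = "\<lambda>k. of_nat (p choose k) * a ^ k * b ^ (p - k)"
  have "{..p} = insert 0 (insert p {0<..<p})" using p0 by auto
  then have "(a + b) ^ p = ?t 0 + (?t p + (\<Sum>k\<in>{0<..<p}. ?t k))"
    using p0 by (simp add: binomial_ring)
  then have "(a + b) ^ p - (a ^ p + b ^ p) = (\<Sum>k\<in>{0<..<p}. ?t k)" by simp
  also have "of_nat p dvd \<dots>"
  proof (intro dvd_sum dvd_mult2)
    fix k assume "k \<in> {0<..<p}"
    then have "p dvd p choose k" using p by (intro dvd_choose_prime) auto
    then show "(of_nat p :: 'a) dvd of_nat (p choose k)" by (metis dvd_def of_nat_mult)
  qed
  finally show ?thesis .
qed

lemma prime_power_dvd_binomial_diff:
  fixes a b :: "'a::comm_ring_1"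
  assumes p: "prime p"
  shows "of_nat p dvd (a + b) ^ (p ^ k) - (a ^ (p ^ k) + b ^ (p ^ k))"
proof (induction k)
  case (Suc k)
  let ?x = "(a + b) ^ (p ^ k)" and ?y = "a ^ (p ^ k) + b ^ (p ^ k)"
  have "?x - ?y dvd ?x ^ p - ?y ^ p" by (simp add: power_diff_sumr2)
  then have "of_nat p dvd ?x ^ p - ?y ^ p" using Suc.IH dvd_trans by blast
  moreover have "of_nat p dvd ?y ^ p - ((a ^ (p ^ k)) ^ p + (b ^ (p ^ k)) ^ p)"
    by (rule prime_dvd_binomial_diff[OF p])
  ultimately have "of_nat p dvd (?x ^ p - ?y ^ p) + (?y ^ p - ((a ^ (p ^ k)) ^ p + (b ^ (p ^ k)) ^ p))"
    by (rule dvd_add)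
  then show ?case by (simp add: power_mult[symmetric] mult.commute algebra_simps)
qed simp

text \<open>The cyclotomic polynomial of order \<open>p ^ r\<close>, as
  \<open>1 + Y + \<dots> + Y ^ (p - 1)\<close> with \<open>Y = X ^ (p ^ (r - 1))\<close>.\<close>

definition cyc_poly :: "nat \<Rightarrow> nat \<Rightarrow> int poly" where
  "cyc_poly p r = (\<Sum>i<p. monom 1 (i * p ^ (r - 1)))"

lemma poly_cyc_poly:
  fixes w :: "'a::comm_ring_1"
  assumes "0 < r"
  shows "poly (of_int_poly (cyc_poly p r)) w * (w ^ (p ^ (r - 1)) - 1) = w ^ (p ^ r) - 1"
proof -
  let ?P = "p ^ (r - 1)"
  have "poly (of_int_poly (cyc_poly p r)) w = (\<Sum>i<p. (w ^ ?P) ^ i)"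
    by (simp add: cyc_poly_def hom_distribs poly_sum poly_monom power_mult[symmetric] mult.commute)
  moreover have "(w ^ ?P) ^ p - 1 = (w ^ ?P - 1) * (\<Sum>i<p. (w ^ ?P) ^ i)"
    using power_diff_1_eq[of "w ^ ?P" p] by simp
  moreover have "(w ^ ?P) ^ p = w ^ (p ^ r)"
    using assms by (simp add: power_mult[symmetric] power_Suc2[symmetric] del: power_Suc)
  ultimately show ?thesis by (simp add: mult.commute)
qed

lemma poly_cyc_poly_int:
  "0 < r \<Longrightarrow> poly (cyc_poly p r) w * (w ^ (p ^ (r - 1)) - 1) = w ^ (p ^ r) - 1"
  using poly_cyc_poly[of r p w] by simp


lemma cyc_poly_lead:
  assumes p: "prime p" and r: "0 < r"
  shows "degree (cyc_poly p r) = totient (p ^ r)" "lead_coeff (cyc_poly p r) = 1"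
proof -
  have P: "0 < p ^ (r - 1)" using p by (simp add: prime_gt_0_nat)
  have p1: "1 < p" by (rule prime_gt_1_nat[OF p])
  define n where "n = (p - 1) * p ^ (r - 1)"
  have tot: "totient (p ^ r) = n" unfolding n_def totient_prime_power[OF p r] by (rule mult.commute)
  have split: "cyc_poly p r = (\<Sum>i<p-1. monom 1 (i * p ^ (r - 1))) + monom 1 n"
    unfolding cyc_poly_def n_def using p1 by (cases p) auto
  have deg: "degree (\<Sum>i<p-1. monom (1::int) (i * p ^ (r - 1))) < n"
    unfolding n_def
  proof (rule degree_sum_less)
    show "degree (monom (1::int) (i * p ^ (r - 1))) < (p - 1) * p ^ (r - 1)" if "i \<in> {..<p-1}" for i
      using that P by (simp add: degree_monom_eq)
    show "0 < (p - 1) * p ^ (r - 1)" using p1 P by simp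
  qed
  then show d: "degree (cyc_poly p r) = totient (p ^ r)"
    unfolding split tot
    by (simp add: degree_add_eq_right degree_monom_eq)
  show "lead_coeff (cyc_poly p r) = 1"
    unfolding d unfolding tot split
    using coeff_eq_0[OF deg] by simp
qed


text \<open>Eisenstein after the shift \<open>X \<mapsto> X + 1\<close>: modulo \<open>p\<close> the
  Frobenius turns \<open>(X + 1) ^ (p ^ k) - 1\<close> into \<open>X ^ (p ^ k)\<close>, so the
  shifted polynomial becomes a power of \<open>X\<close>. Its constant term is the value of
  \<open>cyc_poly p r\<close> at 1, that is \<open>p\<close>.\<close>

lemma cyc_poly_factor:
  assumes p: "prime p" and r: "0 < r" and eq: "cyc_poly p r = g * h"
  shows "degree g = 0 \<or> degree h = 0"
proof -
  let ?X = "[:1, 1:] :: int poly" and ?P = "p ^ (r - 1)" and ?n = "totient (p ^ r)"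
  let ?f = "cyc_poly p r \<circ>\<^sub>p ?X"
  have n: "?n + ?P = p ^ r"
    using p r prime_gt_0_nat[OF p] unfolding totient_prime_power[OF p r]
    by (metis Suc_diff_1 add.commute mult_Suc power_minus_mult mult.commute)
  have 1: "?f * (?X ^ ?P - 1) = ?X ^ (p ^ r) - 1"
  proof -
    have "cyc_poly p r * (monom 1 1 ^ ?P - 1) = (monom 1 1 ^ (p ^ r) - 1 :: int poly)"
      using poly_cyc_poly_int[OF r] by (intro poly_ext) (simp add: poly_monom)
    then have "(cyc_poly p r * (monom 1 1 ^ ?P - 1)) \<circ>\<^sub>p ?X = (monom 1 1 ^ (p ^ r) - 1) \<circ>\<^sub>p ?X" by simp
    then show ?thesis
      by (simp add: pcompose_mult pcompose_diff pcompose_1 pcompose_hom.hom_power)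
        (simp add: monom_altdef pcompose_mult pcompose_pCons)
  qed
  have fr: "[:int p:] dvd ?X ^ (p ^ k) - 1 - monom 1 (p ^ k)" for k
  proof -
    have "[:1, 1:] = monom 1 1 + (1 :: int poly)" by (simp add: monom_altdef one_pCons)
    moreover have "[:int p:] = of_nat p" by (simp add: of_nat_poly)
    ultimately show ?thesis
      using prime_power_dvd_binomial_diff[OF p, of "monom 1 1" "1 :: int poly" k]
      by (simp add: monom_power algebra_simps)
  qed
  have "[:int p:] dvd ?f * (?X ^ ?P - 1 - monom 1 ?P)" using fr by simp
  with fr[of r] have "[:int p:] dvd (?X ^ (p ^ r) - 1 - monom 1 (p ^ r)) - ?f * (?X ^ ?P - 1 - monom 1 ?P)"
    by (rule dvd_diff)
  also have "\<dots> = ?f * monom 1 ?P - monom 1 (p ^ r)"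
    unfolding right_diff_distrib 1[unfolded right_diff_distrib] using 1 by (simp add: algebra_simps)
  finally have dv: "[:int p:] dvd ?f * monom 1 ?P - monom 1 (p ^ r)" .
  have low: "int p dvd coeff ?f i" if "i < ?n" for i
  proof -
    have "int p dvd coeff (?f * monom 1 ?P - monom 1 (p ^ r)) (i + ?P)"
      using dv by (simp add: const_poly_dvd_iff)
    moreover have "i + ?P \<noteq> p ^ r" using n that by simp
    ultimately show ?thesis by (simp add: coeff_monom_mult mult.commute[of ?f])
  qed
  have degX: "degree ?X = 1" by simp
  have deg: "degree ?f = ?n" using cyc_poly_lead(1)[OF p r] by (simp add: degree_pcompose)
  have lead: "lead_coeff ?f = 1"
    using cyc_poly_lead(2)[OF p r] lead_coeff_comp[of ?X "cyc_poly p r"] by simp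
  have "coeff ?f 0 = poly (cyc_poly p r) 1" by (simp add: poly_0_coeff_0[symmetric] poly_pcompose)
  also have "\<dots> = int p" by (simp add: cyc_poly_def poly_sum poly_monom)
  finally have c0: "coeff ?f 0 = int p" .
  have "degree (g \<circ>\<^sub>p ?X) = 0 \<or> degree (h \<circ>\<^sub>p ?X) = 0"
  proof (rule eisenstein_factor)
    show "prime (int p)" using p by simp
    show "?f = (g \<circ>\<^sub>p ?X) * (h \<circ>\<^sub>p ?X)" by (simp add: eq pcompose_mult)
    show "int p dvd coeff ?f i" if "i < degree ?f" for i using low that unfolding deg by blast
    show "\<not> int p dvd lead_coeff ?f" unfolding lead using prime_gt_1_nat[OF p] by simp
    show "\<not> int p * int p dvd coeff ?f 0" unfolding c0 using prime_gt_1_nat[OF p] by simp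
  qed
  then show ?thesis by (simp add: degree_pcompose)
qed

text \<open>Gauss's lemma: contents are multiplicative, so the content of \<open>q\<close> absorbs
  the factor \<open>c\<close>.\<close>

lemma primitive_dvd_smult:
  fixes h f q :: "int poly"
  assumes "content h = 1" "smult c f = h * q" "c \<noteq> 0"
  shows "h dvd f"
proof -
  have "content (smult c f) = content q" using assms by (simp add: content_mult)
  then have "c dvd content q" by (metis content_smult dvd_mult2 dvd_normalize_iff dvd_refl normalize_dvd_iff dvd_triv_left)
  then have "[:c:] dvd q" by (simp add: const_poly_dvd_iff_dvd_content)
  then obtain q' where "q = smult c q'" by (auto simp: dvd_def)
  then have "smult c f = smult c (h * q')" using assms by simp
  then have "f = h * q'" using assms(3) by (metis smult_cancel)
  then show ?thesis by simp
qed

text \<open>A nonzero integer polynomial of least degree vanishing at \<open>w\<close>, made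
  primitive, divides all the others by pseudo-division and Gauss's lemma. In particular it divides
  \<open>cyc_poly p r\<close>, whose irreducibility makes the two equal up to sign.\<close>

theorem cyc_poly_dvd:
  fixes w :: "'a::field_char_0"
  assumes p: "prime p" and r: "0 < r"
    and w: "w ^ (p ^ r) = 1" "w ^ (p ^ (r - 1)) \<noteq> 1" and f: "poly (of_int_poly f) w = 0"
  shows "cyc_poly p r dvd f"
proof -
  let ?Q = "\<lambda>h. h \<noteq> 0 \<and> poly (of_int_poly h) w = 0"
  have root: "poly (of_int_poly (cyc_poly p r)) w = 0"
    using poly_cyc_poly[OF r, of p w] w by simp
  then have "?Q (cyc_poly p r)" using cyc_poly_lead(2)[OF p r] by (metis leading_coeff_0_iff zero_neq_one)
  then obtain h0 where h0: "?Q h0" and min: "\<And>h. ?Q h \<Longrightarrow> degree h0 \<le> degree h"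
    using ex_has_least_nat[of ?Q _ degree] by blast
  define h where "h = primitive_part h0"
  have h0h: "h0 = smult (content h0) h" by (simp add: h_def)
  have h1: "content h = 1" using h0 by (simp add: h_def)
  have hd: "degree h = degree h0" by (simp add: h_def)
  have hw: "poly (of_int_poly h) w = 0"
  proof -
    have "poly (of_int_poly h0) w = of_int (content h0) * poly (of_int_poly h) w"
      by (subst h0h) (simp add: of_int_hom.map_poly_hom_smult)
    then show ?thesis using h0 by simp
  qed
  have hnz: "h \<noteq> 0" using h1 by auto
  have all: "h dvd k" if k: "poly (of_int_poly k) w = 0" for k
  proof -
    obtain c a b where c: "c \<noteq> 0" and eq: "smult c k = h * a + b" and b: "b = 0 \<or> degree b < degree h"
      using pseudo_divmod[OF hnz, of k] hnz
      by (metis surj_pair leading_coeff_0_iff power_not_zero)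
    have "poly (of_int_poly (smult c k)) w = poly (of_int_poly (h * a + b)) w" using eq by simp
    then have "poly (of_int_poly b) w = 0" using k hw
      by (simp add: of_int_hom.map_poly_hom_smult of_int_poly_hom.hom_add of_int_poly_hom.hom_mult)
    then have "b = 0" using min[of b] b hd by linarith
    then show ?thesis using eq primitive_dvd_smult[OF h1 _ c, of k a] by simp
  qed
  from all[OF root] obtain k where k: "cyc_poly p r = h * k" by (auto simp: dvd_def)
  have "degree h \<noteq> 0"
  proof
    assume "degree h = 0"
    then obtain c where "h = [:c:]" by (metis degree_eq_zeroE)
    then show False using hw hnz by simp
  qed
  then have "degree k = 0" using cyc_poly_factor[OF p r k] by simp
  then obtain c where c: "k = [:c:]" by (metis degree_eq_zeroE)
  have "lead_coeff h * c = 1" using cyc_poly_lead(2)[OF p r] unfolding k c lead_coeff_mult by simp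
  then have "c dvd 1" by (metis dvd_triv_right)
  then have "c = 1 \<or> c = - 1" by auto
  then have "smult c h dvd h" by auto
  then have "cyc_poly p r dvd h" unfolding k c by simp
  then show ?thesis using all[OF f] dvd_trans by blast
qed

section \<open>Cyclotomic fields of prime power conductor\<close>

abbreviation ipoly :: "int poly \<Rightarrow> complex \<Rightarrow> complex" where
  "ipoly f x \<equiv> poly (of_int_poly f) x"

lemma ipoly_simps [simp]:
  "ipoly 0 x = 0" "ipoly 1 x = 1" "ipoly [:c:] x = of_int c" "ipoly (monom c k) x = of_int c * x ^ k"
  "ipoly (f + h) x = ipoly f x + ipoly h x" "ipoly (f - h) x = ipoly f x - ipoly h x"
  "ipoly (- f) x = - ipoly f x" "ipoly (f * h) x = ipoly f x * ipoly h x"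
  "ipoly (smult c f) x = of_int c * ipoly f x" "ipoly (pCons c f) x = of_int c + x * ipoly f x"
  by (simp_all add: hom_distribs poly_monom)

lemma sum_coeff_bound:
  fixes f :: "'a::comm_ring_1 poly" and Y :: "nat \<Rightarrow> 'a"
  assumes "\<forall>i\<ge>m. coeff f i = 0"
  shows "(\<Sum>i\<le>degree f. coeff f i * Y i) = (\<Sum>i<m. coeff f i * Y i)"
proof -
  have "(\<Sum>i\<le>degree f. coeff f i * Y i) = (\<Sum>i<m + Suc (degree f). coeff f i * Y i)"
    by (rule sum.mono_neutral_left) (auto simp: coeff_eq_0)
  also have "\<dots> = (\<Sum>i<m. coeff f i * Y i)"
    by (rule sum.mono_neutral_right) (auto simp: assms)
  finally show ?thesis .
qed

lemma poly_altdef_bound: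
  fixes f :: "'a::comm_ring_1 poly"
  shows "\<forall>i\<ge>m. coeff f i = 0 \<Longrightarrow> poly f x = (\<Sum>i<m. coeff f i * x ^ i)"
  unfolding poly_altdef by (rule sum_coeff_bound)

lemma ipoly_altdef:
  "\<forall>i\<ge>m. coeff f i = 0 \<Longrightarrow> ipoly f x = (\<Sum>i<m. of_int (coeff f i) * x ^ i)"
  using poly_altdef_bound[of m "of_int_poly f" x] by simp

lemma power_mod_root_of_unity:
  fixes z :: "'a::monoid_mult"
  assumes "z ^ m = 1" shows "z ^ (k mod m) = z ^ k"
proof -
  have "z ^ k = z ^ (m * (k div m) + k mod m)" by simp
  also have "\<dots> = (z ^ m) ^ (k div m) * z ^ (k mod m)" by (simp only: power_add power_mult)
  finally show ?thesis by (simp add: assms)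
qed

lemma primitive_root_power_iff:
  fixes z :: "'a::field"
  assumes "primitive_root_of_unity m z"
  shows "z ^ k = 1 \<longleftrightarrow> m dvd k"
proof
  assume k: "z ^ k = 1"
  have "z ^ (k mod m) = 1"
    using assms k by (simp add: power_mod_root_of_unity primitive_root_of_unity_def)
  moreover have "k mod m < m" using assms by (simp add: primitive_root_of_unity_def)
  ultimately have "k mod m = 0" using assms by (auto simp: primitive_root_of_unity_def)
  then show "m dvd k" by auto
qed (use assms in \<open>auto simp: primitive_root_of_unity_def power_mult dvd_def\<close>)

lemma sum_powers_root_of_unity:
  fixes w :: "'a::field"
  assumes "w ^ m = 1"
  shows "(\<Sum>j<m. w ^ j) = (if w = 1 then of_nat m else 0)"
  using assms power_diff_1_eq[of w m] by auto

text \<open>One interface for all the rings in use: \<open>Zz\<close>, \<open>FF\<close>,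
  \<open>Ov\<close>, \<open>AA\<close> and \<open>LL b\<close> are sets of complex numbers, and a
  subfield is such a set that is closed under \<open>inverse\<close> as well.\<close>

locale number_ring =
  fixes S :: "complex set"
  assumes one [simp]: "1 \<in> S" and diff: "x \<in> S \<Longrightarrow> y \<in> S \<Longrightarrow> x - y \<in> S"
    and mult: "x \<in> S \<Longrightarrow> y \<in> S \<Longrightarrow> x * y \<in> S"
begin

lemma zero [simp]: "0 \<in> S" using diff[OF one one] by simp
lemma minus: "x \<in> S \<Longrightarrow> - x \<in> S" using diff[OF zero, of x] by simp
lemma add: "x \<in> S \<Longrightarrow> y \<in> S \<Longrightarrow> x + y \<in> S" using diff[of x "- y"] minus by simp
lemma sum: "(\<And>i. i \<in> I \<Longrightarrow> f i \<in> S) \<Longrightarrow> sum f I \<in> S"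
  by (induction I rule: infinite_finite_induct) (auto simp: zero add)
lemma prod: "(\<And>i. i \<in> I \<Longrightarrow> f i \<in> S) \<Longrightarrow> prod f I \<in> S"
  by (induction I rule: infinite_finite_induct) (auto simp: one mult)
lemma power: "x \<in> S \<Longrightarrow> x ^ k \<in> S" by (induction k) (auto simp: one mult)
lemma of_nat [simp]: "of_nat k \<in> S" by (induction k) (auto simp: zero one add)
lemma of_int [simp]: "of_int k \<in> S" by (cases k rule: int_diff_cases) (simp add: of_nat diff)

definition cin :: "complex poly \<Rightarrow> bool" where "cin f \<longleftrightarrow> (\<forall>i. coeff f i \<in> S)"

lemma cin_0: "cin 0" by (simp add: cin_def zero)
lemma cin_pCons: "c \<in> S \<Longrightarrow> cin f \<Longrightarrow> cin (pCons c f)"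
  by (auto simp: cin_def coeff_pCons split: nat.split)
lemma cin_1: "cin 1" by (simp add: one_pCons cin_pCons cin_0 one)
lemma cin_monom: "c \<in> S \<Longrightarrow> cin (monom c k)" by (simp add: cin_def zero)
lemma cin_add: "cin f \<Longrightarrow> cin h \<Longrightarrow> cin (f + h)" by (simp add: cin_def add)
lemma cin_diff: "cin f \<Longrightarrow> cin h \<Longrightarrow> cin (f - h)" by (simp add: cin_def diff)
lemma cin_mult: "cin f \<Longrightarrow> cin h \<Longrightarrow> cin (f * h)" by (simp add: cin_def coeff_mult sum mult)
lemma cin_smult: "c \<in> S \<Longrightarrow> cin f \<Longrightarrow> cin (smult c f)" by (simp add: cin_def mult)
lemma cin_sum: "(\<And>i. i \<in> I \<Longrightarrow> cin (f i)) \<Longrightarrow> cin (sum f I)"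
  by (induction I rule: infinite_finite_induct) (auto simp: cin_0 cin_add)
lemma cin_prod: "(\<And>i. i \<in> I \<Longrightarrow> cin (f i)) \<Longrightarrow> cin (prod f I)"
  by (induction I rule: infinite_finite_induct) (auto simp: cin_1 cin_mult)
lemma cin_scale: "c \<in> S \<Longrightarrow> cin f \<Longrightarrow> cin (f \<circ>\<^sub>p [:0, c:])"
  by (simp add: cin_def coeff_pcompose_linear mult power)

lemma division:
  assumes f: "cin f" "lead_coeff f = 1" and h: "cin h"
  shows "\<exists>a b. cin a \<and> cin b \<and> h = f * a + b \<and> (b = 0 \<or> degree b < degree f)"
  using h
proof (induction "degree h" arbitrary: h rule: less_induct)
  case less
  show ?case
  proof (cases "h = 0 \<or> degree h < degree f")
    case True
    then show ?thesis using less.prems by (intro exI[of _ 0] exI[of _ h]) (auto simp: cin_0)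
  next
    case False
    define m where "m = monom (lead_coeff h) (degree h - degree f)"
    have m: "cin m" using less.prems by (auto simp: m_def cin_def intro: zero)
    define h' where "h' = h - f * m"
    have h': "cin h'" using less.prems f m by (simp add: h'_def cin_diff cin_mult)
    have f0: "f \<noteq> 0" using f by auto
    have lc: "lead_coeff h \<noteq> 0" using False by simp
    have "degree (f * m) = degree h"
      using False f f0 lc by (simp add: m_def degree_mult_eq monom_eq_0_iff degree_monom_eq)
    moreover have "lead_coeff (f * m) = lead_coeff h"
      unfolding lead_coeff_mult using f lc by (simp add: m_def degree_monom_eq)
    ultimately have dm: "degree (f * m) = degree h" "lead_coeff (f * m) = lead_coeff h" by blast+
    have "h' = 0 \<or> degree h' < degree h"
    proof -
      have "degree h' \<le> degree h" using dm(1) unfolding h'_def by (metis degree_diff_le order_refl)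
      moreover have "coeff h' (degree h) = 0" using dm by (simp add: h'_def)
      ultimately show ?thesis by (metis leading_coeff_0_iff le_neq_implies_less)
    qed
    then obtain a b where ab: "cin a" "cin b" "h' = f * a + b" "b = 0 \<or> degree b < degree f"
    proof
      assume "h' = 0" then show ?thesis using that[of 0 0] by (simp add: cin_0)
    next
      assume "degree h' < degree h" then show ?thesis using less.hyps[of h'] h' that by blast
    qed
    then have "h = f * (a + m) + b" by (simp add: h'_def algebra_simps)
    then show ?thesis using ab m by (metis cin_add)
  qed
qed

end

text \<open>Everything takes place inside the complex numbers: \<open>Zz\<close> is \<open>\<int>[z]\<close>, its fraction field \<open>FF\<close> is
  described by integral denominators, and \<open>sig\<close> is the generator \<open>z \<mapsto> z\<^sup>g\<close> of the Galois group. The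
  value of \<open>sig\<close> is meaningful on \<open>FF\<close> only.\<close>

locale cyclotomic =
  fixes p r g :: nat and z :: complex
  assumes p: "prime p" and r: "0 < r"
    and z: "primitive_root_of_unity (p ^ r) z" and g: "residue_primroot (p ^ r) g"
begin

abbreviation q :: nat where "q \<equiv> p ^ r"

definition n :: nat where "n = totient q"

definition Zz :: "complex set" where "Zz = range (\<lambda>f. ipoly f z)"

definition FF :: "complex set" where "FF = {x. \<exists>d::int. d \<noteq> 0 \<and> of_int d * x \<in> Zz}"

definition sig :: "complex \<Rightarrow> complex" where
  "sig x = (THE y. \<exists>f d. d \<noteq> 0 \<and> of_int d * x = ipoly f z \<and> of_int d * y = ipoly f (z ^ g))"

lemma p_gt_1: "1 < p" by (rule prime_gt_1_nat[OF p])

lemma p_pos [simp]: "0 < p" "p \<noteq> 0" using p_gt_1 by simp_all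

lemma q_gt_1: "1 < q" using one_less_power[OF p_gt_1 r] .

lemma n_eq: "n = (p - 1) * p ^ (r - 1)" unfolding n_def totient_prime_power[OF p r] by (rule mult.commute)

lemma n_pos: "0 < n" using p_gt_1 by (simp add: n_eq)

lemma z_pow_q: "z ^ q = 1" using z by (simp add: primitive_root_of_unity_def)

lemma z_nz [simp]: "z \<noteq> 0" using z_pow_q p_gt_1 by (auto simp: power_0_left)

lemma z_pow_eq_1_iff: "z ^ k = 1 \<longleftrightarrow> q dvd k" by (rule primitive_root_power_iff[OF z])

lemma z_pow_cong: "[a = b] (mod q) \<Longrightarrow> z ^ a = z ^ b"
  by (metis cong_def power_mod_root_of_unity z_pow_q)

lemma coprime_g: "coprime p g" using g r by (simp add: residue_primroot_def)

lemma conj_primitive: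
  assumes "coprime p a"
  shows "(z ^ a) ^ q = 1" "(z ^ a) ^ (p ^ (r - 1)) \<noteq> 1"
proof -
  show "(z ^ a) ^ q = 1" by (simp add: power_mult[symmetric] z_pow_eq_1_iff)
  have "\<not> p * p ^ (r - 1) dvd a * p ^ (r - 1)"
    using assms p_gt_1 coprime_absorb_left by fastforce
  moreover have "p * p ^ (r - 1) = q" using r by (metis power_minus_mult mult.commute)
  ultimately show "(z ^ a) ^ (p ^ (r - 1)) \<noteq> 1"
    unfolding power_mult[symmetric] z_pow_eq_1_iff by metis
qed

text \<open>Irreducibility enters here: the polynomials vanishing at \<open>z ^ a\<close> are the
  same for all \<open>a\<close> prime to \<open>p\<close>, which makes
  \<open>z \<mapsto> z ^ a\<close> well defined on polynomial expressions in
  \<open>z\<close>.\<close>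

lemma ipoly_conj_eq_0_iff:
  assumes a: "coprime p a"
  shows "ipoly f (z ^ a) = 0 \<longleftrightarrow> cyc_poly p r dvd f"
proof
  show "cyc_poly p r dvd f" if "ipoly f (z ^ a) = 0"
    using cyc_poly_dvd[OF p r conj_primitive[OF a] that] .
  have "ipoly (cyc_poly p r) (z ^ a) = 0"
    using poly_cyc_poly[OF r, of p "z ^ a"] conj_primitive[OF a] by simp
  then show "ipoly f (z ^ a) = 0" if "cyc_poly p r dvd f" using that by (auto simp: dvd_def)
qed

lemma ipoly_eq_0_iff: "ipoly f z = 0 \<longleftrightarrow> cyc_poly p r dvd f"
  using ipoly_conj_eq_0_iff[of 1 f] by simp

lemma ipoly_conj_cong:
  assumes "coprime p a" "ipoly f z = ipoly h z"
  shows "ipoly f (z ^ a) = ipoly h (z ^ a)"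
proof -
  have "ipoly (f - h) z = 0" using assms by simp
  then have "ipoly (f - h) (z ^ a) = 0"
    using ipoly_conj_eq_0_iff[OF assms(1), of "f - h"] ipoly_eq_0_iff[of "f - h"] by blast
  then show ?thesis by simp
qed

lemma ZzI: "ipoly f z \<in> Zz" by (simp add: Zz_def)

lemma ZzE: assumes "x \<in> Zz" obtains f where "x = ipoly f z" using assms by (auto simp: Zz_def)

lemma Zz_diff: "x \<in> Zz \<Longrightarrow> y \<in> Zz \<Longrightarrow> x - y \<in> Zz" by (metis ZzI ZzE ipoly_simps(6))
lemma Zz_mult: "x \<in> Zz \<Longrightarrow> y \<in> Zz \<Longrightarrow> x * y \<in> Zz" by (metis ZzI ZzE ipoly_simps(8))

sublocale Zz: number_ring Zz
  using ZzI[of 1] by unfold_locales (auto intro: Zz_diff Zz_mult)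

lemma Zz_z [simp]: "z \<in> Zz" using ZzI[of "[:0, 1:]"] by simp

lemma FFI: "d \<noteq> 0 \<Longrightarrow> of_int d * x \<in> Zz \<Longrightarrow> x \<in> FF" by (auto simp: FF_def)

lemma FFE:
  assumes "x \<in> FF" obtains d f where "d \<noteq> 0" "of_int d * x = ipoly f z"
  using assms by (auto simp: FF_def elim: ZzE)

lemma Zz_FF: "x \<in> Zz \<Longrightarrow> x \<in> FF" by (rule FFI[of 1]) simp_all

lemma sig_eqI:
  assumes d: "d \<noteq> 0" and x: "of_int d * x = ipoly f z"
  shows "of_int d * sig x = ipoly f (z ^ g)"
proof -
  let ?y = "ipoly f (z ^ g) / of_int d"
  have "sig x = ?y"
    unfolding sig_def
  proof (rule the_equality)
    show "\<exists>f d. d \<noteq> 0 \<and> of_int d * x = ipoly f z \<and> of_int d * ?y = ipoly f (z ^ g)"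
      using assms by (intro exI[of _ f] exI[of _ d]) simp
    fix y assume "\<exists>f d. d \<noteq> 0 \<and> of_int d * x = ipoly f z \<and> of_int d * y = ipoly f (z ^ g)"
    then obtain f' d' where 1: "d' \<noteq> 0" "of_int d' * x = ipoly f' z" "of_int d' * y = ipoly f' (z ^ g)"
      by blast
    have "ipoly (smult d' f) z = ipoly (smult d f') z"
      using 1(2) x by (simp add: algebra_simps flip: 1(2) x)
    then have "of_int d' * ipoly f (z ^ g) = of_int d * (of_int d' * y)"
      using ipoly_conj_cong[OF coprime_g, of "smult d' f" "smult d f'"] 1(3) by simp
    then show "y = ?y" using 1(1) d by (simp add: field_simps)
  qed
  then show ?thesis using d by simp
qed

lemma sig_ipoly: "sig (ipoly f z) = ipoly f (z ^ g)"
  using sig_eqI[of 1 "ipoly f z" f] by simp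

lemma sig_z: "sig z = z ^ g" using sig_ipoly[of "[:0, 1:]"] by simp

lemma sig_of_int [simp]: "sig (of_int k) = of_int k" using sig_ipoly[of "[:k:]"] by simp
lemma sig_of_nat [simp]: "sig (of_nat k) = of_nat k" using sig_of_int[of "int k"] by simp
lemma sig_0 [simp]: "sig 0 = 0" and sig_1 [simp]: "sig 1 = 1"
  using sig_of_int[of 0] sig_of_int[of 1] by simp_all

lemma ipoly_pow_g: "ipoly f (z ^ g) \<in> Zz"
  using ZzI[of "f \<circ>\<^sub>p monom 1 g"] by (simp add: of_int_hom.map_poly_pcompose poly_pcompose poly_monom)

lemma sig_Zz: "x \<in> Zz \<Longrightarrow> sig x \<in> Zz"
  by (auto elim!: ZzE simp: sig_ipoly ipoly_pow_g)

lemma sig_FF: "x \<in> FF \<Longrightarrow> sig x \<in> FF"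
  by (erule FFE) (metis FFI ipoly_pow_g sig_eqI)

lemma FF_add: assumes "x \<in> FF" "y \<in> FF"
  shows "x + y \<in> FF" and sig_add: "sig (x + y) = sig x + sig y"
proof -
  obtain d f where 1: "d \<noteq> 0" "of_int d * x = ipoly f z" using assms by (auto elim: FFE)
  obtain d' f' where 2: "d' \<noteq> 0" "of_int d' * y = ipoly f' z" using assms by (auto elim: FFE)
  have 3: "of_int (d * d') * (x + y) = ipoly (smult d' f + smult d f') z"
    by (simp add: algebra_simps flip: 1(2) 2(2))
  then show "x + y \<in> FF" using 1 2 by (intro FFI[of "d * d'"]) (auto simp: ZzI Zz.add Zz_mult simp del: of_int_mult)
  have "of_int (d * d') * sig (x + y) = of_int (d * d') * (sig x + sig y)"
    using sig_eqI[OF _ 3] sig_eqI[OF 1] sig_eqI[OF 2] 1 2 by (simp add: algebra_simps)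
  then show "sig (x + y) = sig x + sig y" using 1 2 by simp
qed

lemma FF_mult: assumes "x \<in> FF" "y \<in> FF"
  shows "x * y \<in> FF" and sig_mult: "sig (x * y) = sig x * sig y"
proof -
  obtain d f where 1: "d \<noteq> 0" "of_int d * x = ipoly f z" using assms by (auto elim: FFE)
  obtain d' f' where 2: "d' \<noteq> 0" "of_int d' * y = ipoly f' z" using assms by (auto elim: FFE)
  have 3: "of_int (d * d') * (x * y) = ipoly (f * f') z"
    by (simp add: algebra_simps flip: 1(2) 2(2))
  then show "x * y \<in> FF" using 1 2 by (intro FFI[of "d * d'"]) (auto simp: ZzI Zz_mult simp del: of_int_mult)
  have "of_int (d * d') * sig (x * y) = of_int (d * d') * (sig x * sig y)"
    using sig_eqI[OF _ 3] sig_eqI[OF 1] sig_eqI[OF 2] 1 2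
    by (simp add: algebra_simps) (metis mult.assoc mult.commute)
  then show "sig (x * y) = sig x * sig y" using 1 2 by simp
qed

lemma FF_diff: "x \<in> FF \<Longrightarrow> y \<in> FF \<Longrightarrow> x - y \<in> FF"
  using FF_add(1)[of x "of_int (- 1) * y"] FF_mult(1)[OF Zz_FF[OF Zz.of_int], of y "- 1"] by simp

sublocale FF: number_ring FF
  by unfold_locales (auto intro: FF_diff FF_mult Zz_FF)

lemma FF_z [simp]: "z \<in> FF" by (simp add: Zz_FF)

lemma sig_sum: "(\<And>i. i \<in> I \<Longrightarrow> f i \<in> FF) \<Longrightarrow> sig (sum f I) = (\<Sum>i\<in>I. sig (f i))"
  by (induction I rule: infinite_finite_induct) (auto simp: sig_add FF.sum)
lemma sig_prod: "(\<And>i. i \<in> I \<Longrightarrow> f i \<in> FF) \<Longrightarrow> sig (prod f I) = (\<Prod>i\<in>I. sig (f i))"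
  by (induction I rule: infinite_finite_induct) (auto simp: sig_mult FF.prod)
lemma sig_power: "x \<in> FF \<Longrightarrow> sig (x ^ k) = sig x ^ k"
  by (induction k) (auto simp: sig_mult FF.power)

lemma sigk_Zz: "x \<in> Zz \<Longrightarrow> (sig ^^ k) x \<in> Zz" by (induction k) (auto simp: sig_Zz)
lemma sigk_FF: "x \<in> FF \<Longrightarrow> (sig ^^ k) x \<in> FF" by (induction k) (auto simp: sig_FF)
lemma sigk_mult: "x \<in> FF \<Longrightarrow> y \<in> FF \<Longrightarrow> (sig ^^ k) (x * y) = (sig ^^ k) x * (sig ^^ k) y"
  by (induction k) (auto simp: sig_mult sigk_FF)
lemma sigk_add: "x \<in> FF \<Longrightarrow> y \<in> FF \<Longrightarrow> (sig ^^ k) (x + y) = (sig ^^ k) x + (sig ^^ k) y"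
  by (induction k) (auto simp: sig_add sigk_FF)
lemma sigk_of_int [simp]: "(sig ^^ k) (of_int m) = of_int m" by (induction k) auto
lemma sigk_of_nat [simp]: "(sig ^^ k) (of_nat m) = of_nat m" by (induction k) auto
lemma sigk_0 [simp]: "(sig ^^ k) 0 = 0" and sigk_1 [simp]: "(sig ^^ k) 1 = 1" by (induction k) auto
lemma sigk_power: "x \<in> FF \<Longrightarrow> (sig ^^ k) (x ^ m) = (sig ^^ k) x ^ m"
  by (induction k) (auto simp: sig_power sigk_FF)
lemma sigk_prod: "(\<And>i. i \<in> I \<Longrightarrow> f i \<in> FF) \<Longrightarrow> (sig ^^ k) (prod f I) = (\<Prod>i\<in>I. (sig ^^ k) (f i))"
  by (induction k) (auto simp: sig_prod sigk_FF)

lemma sigk_z: "(sig ^^ k) z = z ^ (g ^ k)"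
  by (induction k) (auto simp: sig_power sig_z power_mult[symmetric] mult.commute)

lemma sigk_ipoly: "(sig ^^ k) (ipoly f z) = ipoly f (z ^ (g ^ k))"
proof (induction f)
  case (pCons c f)
  have "ipoly f z \<in> FF" by (intro Zz_FF ZzI)
  then show ?case using pCons(2) by (simp add: sigk_add sigk_mult FF_mult sigk_z)
qed simp

lemma ord_g: "ord q g = n" using g by (simp add: residue_primroot_def n_def)

lemma z_pow_g_pow_n: "z ^ (g ^ n) = z"
  using z_pow_cong[of "g ^ n" 1] ord_divides[of g n q] ord_g by simp

lemma z_pow_g_neq:
  assumes "0 < i" "i < n" shows "z ^ (g ^ i) \<noteq> z"
proof
  assume eq: "z ^ (g ^ i) = z"
  have "0 < g ^ i" using coprime_g p_gt_1 by (cases "g = 0") auto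
  then have "z ^ (g ^ i) = z ^ (g ^ i - 1) * z" by (metis power_minus_mult)
  with eq have "z ^ (g ^ i - 1) = 1" by simp
  then have "q dvd g ^ i - 1" by (simp add: z_pow_eq_1_iff)
  then have "[g ^ i = 1] (mod q)" using \<open>0 < g ^ i\<close> by (subst cong_altdef_nat) auto
  then have "n dvd i" using ord_divides[of g i q] ord_g by simp
  then show False using assms by auto
qed

lemma sig_n: assumes "x \<in> FF" shows "(sig ^^ n) x = x"
proof -
  obtain d f where d: "d \<noteq> 0" "of_int d * x = ipoly f z" using assms by (rule FFE)
  have "of_int d * (sig ^^ n) x = (sig ^^ n) (of_int d * x)" using assms by (subst sigk_mult) auto
  also have "\<dots> = of_int d * x" unfolding d(2) sigk_ipoly z_pow_g_pow_n ..
  finally show ?thesis using d(1) by simp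
qed

lemma sig_eq_0_iff: assumes "x \<in> FF" shows "sig x = 0 \<longleftrightarrow> x = 0"
proof
  assume 0: "sig x = 0"
  have "x = (sig ^^ Suc (n - 1)) x" using sig_n[OF assms] n_pos by simp
  also have "\<dots> = (sig ^^ (n - 1)) (sig x)" by (simp only: funpow_Suc_right comp_def)
  finally show "x = 0" using 0 by simp
qed simp

lemma sigk_eq_0_iff: "x \<in> FF \<Longrightarrow> (sig ^^ k) x = 0 \<longleftrightarrow> x = 0"
  by (induction k) (auto simp: sig_eq_0_iff sigk_FF)

lemma sigk_mod: assumes "x \<in> FF" shows "(sig ^^ (k mod n)) x = (sig ^^ k) x"
  by (rule funpow_mod_eq) (rule sig_n[OF assms])

section \<open>Trace, norm and Hilbert 90 for the cyclic group generated by
  \<open>sig\<close>\<close>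

definition Tr :: "complex \<Rightarrow> complex" where "Tr x = (\<Sum>i<n. (sig ^^ i) x)"
definition Nm :: "complex \<Rightarrow> complex" where "Nm x = (\<Prod>i<n. (sig ^^ i) x)"

lemma rotate_index:
  assumes "x \<in> FF"
  shows "bij_betw (\<lambda>i. Suc i mod n) {..<n} {..<n}" "(sig ^^ (Suc i mod n)) x = sig ((sig ^^ i) x)"
proof -
  show "bij_betw (\<lambda>i. Suc i mod n) {..<n} {..<n}"
  proof (rule bij_betw_imageI)
    show "inj_on (\<lambda>i. Suc i mod n) {..<n}"
      by (auto simp: inj_on_def mod_Suc split: if_splits)
    then show "(\<lambda>i. Suc i mod n) ` {..<n} = {..<n}"
      using n_pos by (intro endo_inj_surj) auto
  qed
  show "(sig ^^ (Suc i mod n)) x = sig ((sig ^^ i) x)" using sigk_mod[OF assms, of "Suc i"] by simp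
qed

lemma sig_Nm: assumes "x \<in> FF" shows "sig (Nm x) = Nm x"
proof -
  have "sig (Nm x) = (\<Prod>i<n. (sig ^^ (Suc i mod n)) x)"
    unfolding Nm_def using assms by (simp add: sig_prod sigk_FF rotate_index)
  also have "\<dots> = Nm x" unfolding Nm_def
    by (rule prod.reindex_bij_betw[OF rotate_index(1)[OF assms]])
  finally show ?thesis .
qed

lemma Nm_FF: "x \<in> FF \<Longrightarrow> Nm x \<in> FF" unfolding Nm_def by (intro FF.prod sigk_FF)
lemma Nm_Zz: "x \<in> Zz \<Longrightarrow> Nm x \<in> Zz" unfolding Nm_def by (intro Zz.prod sigk_Zz)
lemma Nm_eq_0_iff: "x \<in> FF \<Longrightarrow> Nm x = 0 \<longleftrightarrow> x = 0"
  unfolding Nm_def using n_pos by (auto simp: sigk_eq_0_iff)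
lemma Nm_mult: "x \<in> FF \<Longrightarrow> y \<in> FF \<Longrightarrow> Nm (x * y) = Nm x * Nm y"
  unfolding Nm_def by (simp add: sigk_mult prod.distrib)
lemma Nm_of_int [simp]: "Nm (of_int k) = of_int k ^ n" by (simp add: Nm_def)

lemma Nm_power: "x \<in> FF \<Longrightarrow> Nm (x ^ k) = Nm x ^ k"
  by (simp add: Nm_def sigk_power prod_power_distrib)

text \<open>The \<open>g ^ i\<close> run through the residues prime to \<open>p\<close>, so this is
  a sum over all residues modulo \<open>q\<close> minus one over the multiples of \<open>p\<close>.
  Both are geometric sums of roots of unity, hence integers.\<close>

lemma sum_conj_z: "(\<Sum>i<n. (z ^ (g ^ i)) ^ m) \<in> \<int>"
proof -
  have "(\<Sum>i<n. (z ^ (g ^ i)) ^ m) = (\<Sum>i<n. (z ^ m) ^ (g ^ i mod q))"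
  proof (rule sum.cong)
    fix i
    have "z ^ (m * g ^ i) = z ^ (m * (g ^ i mod q))"
      by (rule z_pow_cong) (simp add: cong_def mod_mult_right_eq)
    then show "(z ^ (g ^ i)) ^ m = (z ^ m) ^ (g ^ i mod q)"
      by (simp add: power_mult[symmetric] mult.commute)
  qed simp
  also have "\<dots> = (\<Sum>a\<in>totatives q. (z ^ m) ^ a)"
    unfolding n_def by (rule sum.reindex_bij_betw[OF residue_primroot_is_generator[OF q_gt_1 g]])
  also have "totatives q = {..<q} - (\<lambda>b. p * b) ` {..<p ^ (r - 1)}"
  proof -
    have "q = p * p ^ (r - 1)" using r by (metis power_minus_mult mult.commute)
    then have "{a. a < q \<and> p dvd a} = (\<lambda>b. p * b) ` {..<p ^ (r - 1)}"
      using p_gt_1 by (auto simp: dvd_def)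
    moreover have "totatives q = {a. a < q \<and> \<not> p dvd a}"
    proof -
      have "coprime a q \<longleftrightarrow> \<not> p dvd a" for a
        using p r by (simp add: coprime_commute[of a] prime_imp_coprime_nat coprime_absorb_left)
          (metis coprime_absorb_left not_prime_unit prime_imp_coprime_nat)
      moreover have "p dvd q" using r by simp
      ultimately show ?thesis
        by (auto simp: totatives_def le_less intro!: gr0I)
    qed
    ultimately show ?thesis by auto
  qed
  also have "(\<Sum>a\<in>{..<q} - (\<lambda>b. p * b) ` {..<p ^ (r - 1)}. (z ^ m) ^ a)
      = (\<Sum>a<q. (z ^ m) ^ a) - (\<Sum>a\<in>(\<lambda>b. p * b) ` {..<p ^ (r - 1)}. (z ^ m) ^ a)"
  proof (rule sum_diff)
    have "q = p * p ^ (r - 1)" using r by (metis power_minus_mult mult.commute)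
    then show "(\<lambda>b. p * b) ` {..<p ^ (r - 1)} \<subseteq> {..<q}" using p_gt_1 by auto
  qed simp
  also have "(\<Sum>a\<in>(\<lambda>b. p * b) ` {..<p ^ (r - 1)}. (z ^ m) ^ a) = (\<Sum>b<p ^ (r - 1). ((z ^ m) ^ p) ^ b)"
    using p_gt_1 by (subst sum.reindex) (auto simp: inj_on_def power_mult)
  also have "\<dots> = (if (z ^ m) ^ p = 1 then of_nat (p ^ (r - 1)) else 0)"
  proof (rule sum_powers_root_of_unity)
    have "m * (p * p ^ (r - 1)) = q * m" using r by (metis power_minus_mult mult.commute)
    then show "((z ^ m) ^ p) ^ p ^ (r - 1) = 1"
      unfolding power_mult[symmetric] z_pow_eq_1_iff mult.assoc by (metis dvd_triv_left)
  qed
  also have "(\<Sum>a<q. (z ^ m) ^ a) = (if z ^ m = 1 then of_nat q else 0)"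
    by (rule sum_powers_root_of_unity) (simp add: power_mult[symmetric] z_pow_eq_1_iff)
  finally show ?thesis by (simp split: if_splits)
qed

lemma Tr_Ints: assumes "x \<in> Zz" shows "Tr x \<in> \<int>"
proof -
  obtain f where f: "x = ipoly f z" using assms by (rule ZzE)
  have "Tr x = (\<Sum>i<n. \<Sum>m<Suc (degree f). of_int (coeff f m) * (z ^ (g ^ i)) ^ m)"
    unfolding Tr_def f sigk_ipoly
    by (intro sum.cong refl ipoly_altdef) (simp add: coeff_eq_0)
  also have "\<dots> = (\<Sum>m<Suc (degree f). of_int (coeff f m) * (\<Sum>i<n. (z ^ (g ^ i)) ^ m))"
    by (subst sum.swap) (simp add: sum_distrib_left del: sum.lessThan_Suc)
  also have "\<dots> \<in> \<int>" by (intro Ints_sum Ints_mult sum_conj_z) auto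
  finally show ?thesis .
qed

lemma inverse_z_Zz [simp]: "inverse z \<in> Zz"
proof -
  have "z ^ (q - 1) * z = 1" using q_gt_1 power_minus_mult[of q z] unfolding z_pow_q by linarith
  then have "inverse z = z ^ (q - 1)" by (simp add: field_simps)
  then show ?thesis by (simp add: Zz.power)
qed

lemma inverse_z_FF [simp]: "inverse z \<in> FF" by (simp add: Zz_FF)

lemma sigk_z_orthogonal:
  assumes "i < n"
  shows "(\<Sum>j<q. ((sig ^^ i) (inverse z) * z) ^ j) = (if i = 0 then of_nat q else 0)"
proof -
  let ?w = "(sig ^^ i) (inverse z) * z"
  have 1: "?w = 1 \<longleftrightarrow> i = 0"
  proof
    assume w: "?w = 1"
    have "(sig ^^ i) (inverse z) * (sig ^^ i) z = 1"
      by (subst sigk_mult[symmetric]) auto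
    with w have "(sig ^^ i) z = z" by (metis mult_cancel_left mult_zero_left zero_neq_one)
    then show "i = 0" using z_pow_g_neq[of i] assms by (auto simp: sigk_z)
  qed simp
  have "?w ^ q = 1"
    by (simp add: power_mult_distrib z_pow_q power_inverse flip: sigk_power)
  from sum_powers_root_of_unity[OF this] show ?thesis using 1 by simp
qed

text \<open>The \<open>q\<close> powers of \<open>z\<close> are linearly dependent, but taking all
  of them instead of a basis makes the dual family explicit: it consists of the inverse powers, up
  to the factor \<open>q\<close>. This factor is a power of \<open>p\<close> and becomes invertible
  in \<open>AA\<close>.\<close>

lemma trace_inversion:
  assumes "x \<in> FF"
  shows "(\<Sum>j<q. Tr (x * (inverse z) ^ j) * z ^ j) = of_nat q * x"
proof -
  have "(\<Sum>j<q. Tr (x * (inverse z) ^ j) * z ^ j)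
      = (\<Sum>j<q. \<Sum>i<n. (sig ^^ i) x * ((sig ^^ i) (inverse z) * z) ^ j)"
    unfolding Tr_def sum_distrib_right using assms
    by (intro sum.cong refl) (simp add: sigk_mult sigk_power FF.power power_mult_distrib)
  also have "\<dots> = (\<Sum>i<n. (sig ^^ i) x * (\<Sum>j<q. ((sig ^^ i) (inverse z) * z) ^ j))"
    by (subst sum.swap) (simp add: sum_distrib_left)
  also have "\<dots> = (\<Sum>i<n. if i = 0 then (sig ^^ i) x * of_nat q else 0)"
    by (intro sum.cong refl) (subst sigk_z_orthogonal, auto)
  also have "\<dots> = of_nat q * x" using n_pos by (simp add: sum.delta)
  finally show ?thesis .
qed

lemma deg_cyc: "degree (cyc_poly p r) = n" "lead_coeff (cyc_poly p r) = 1"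
  using cyc_poly_lead[OF p r] by (auto simp: n_def)

lemma ipoly_inj:
  assumes "\<And>i. n \<le> i \<Longrightarrow> coeff f i = 0" "ipoly f z = 0" shows "f = 0"
proof (rule ccontr)
  assume "f \<noteq> 0"
  have "cyc_poly p r dvd f" using assms(2) by (simp add: ipoly_eq_0_iff)
  then have "n \<le> degree f" using \<open>f \<noteq> 0\<close> dvd_imp_degree_le deg_cyc by metis
  then show False using assms(1)[of "degree f"] \<open>f \<noteq> 0\<close> by simp
qed

lemma ZzE_reduced:
  assumes "x \<in> Zz" obtains f where "\<forall>i\<ge>n. coeff f i = 0" "x = ipoly f z"
proof -
  obtain f where f: "x = ipoly f z" using assms by (rule ZzE)
  let ?c = "cyc_poly p r"
  have c: "?c \<noteq> 0" using deg_cyc(2) by auto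
  obtain a b where ab: "pseudo_divmod f ?c = (a, b)" by (cases "pseudo_divmod f ?c")
  have eq: "f = ?c * a + b" and b: "b = 0 \<or> degree b < degree ?c"
    using pseudo_divmod[OF c ab] deg_cyc(2) by simp_all
  have "ipoly ?c z = 0" by (simp add: ipoly_eq_0_iff)
  then have 1: "x = ipoly b z" using eq f by simp
  have 2: "\<forall>i\<ge>n. coeff b i = 0"
    using b deg_cyc(1) by (metis coeff_0 coeff_eq_0 order_less_le_trans)
  show ?thesis using that[OF 2 1] by blast
qed

text \<open>Takes the place of integral closedness of \<int>: reduced expressions are unique, so
  \<open>d\<close> times that of \<open>x\<close> is the constant \<open>m\<close>.\<close>

lemma Zz_Rats_Ints:
  assumes "x \<in> Zz" "d \<noteq> 0" "of_int d * x = of_int m" shows "x \<in> \<int>"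
proof -
  obtain f where f: "\<forall>i\<ge>n. coeff f i = 0" "x = ipoly f z" using assms(1) by (rule ZzE_reduced)
  have "smult d f - [:m:] = 0"
  proof (rule ipoly_inj)
    show "coeff (smult d f - [:m:]) i = 0" if "n \<le> i" for i
      using that n_pos f(1) by (auto simp: coeff_pCons split: nat.split)
    show "ipoly (smult d f - [:m:]) z = 0" using assms f by simp
  qed
  then have "degree (smult d f) = 0" by (metis degree_pCons_0 eq_iff_diff_eq_0)
  then have "degree f = 0" using assms(2) by simp
  then obtain c where "f = [:c:]" by (metis degree_eq_zeroE)
  then show ?thesis using f by simp
qed

lemma fixed_rational:
  assumes "x \<in> FF" "sig x = x" obtains d m where "d \<noteq> 0" "of_int d * x = of_int m"
proof -
  obtain d f where d: "d \<noteq> 0" "of_int d * x = ipoly f z" using assms by (auto elim: FFE)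
  have "(sig ^^ i) x = x" for i by (induction i) (auto simp: assms)
  then have "(sig ^^ i) (of_int d * x) = of_int d * x" for i using assms by (subst sigk_mult) auto
  then have "Tr (of_int d * x) = of_int (int n * d) * x" by (simp add: Tr_def)
  moreover have "Tr (of_int d * x) \<in> \<int>" unfolding d(2) by (intro Tr_Ints ZzI)
  ultimately obtain m where "of_int (int n * d) * x = of_int m" by (auto elim: Ints_cases)
  then show ?thesis using that[of "int n * d" m] d n_pos by simp
qed

lemma fixed_integral: assumes "x \<in> Zz" "sig x = x" shows "x \<in> \<int>"
  using fixed_rational[OF Zz_FF assms(2)] Zz_Rats_Ints assms by metis

lemma Nm_Ints: "x \<in> Zz \<Longrightarrow> Nm x \<in> \<int>"
  by (intro fixed_integral Nm_Zz sig_Nm Zz_FF)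

lemma Nm_cofactor: assumes "x \<in> Zz" shows "\<exists>y\<in>Zz. Nm x = x * y"
proof
  show "Nm x = x * (\<Prod>i\<in>{..<n} - {0}. (sig ^^ i) x)"
    unfolding Nm_def using n_pos by (subst prod.remove[of _ 0]) auto
  show "(\<Prod>i\<in>{..<n} - {0}. (sig ^^ i) x) \<in> Zz" using assms by (intro Zz.prod sigk_Zz)
qed

lemma Zz_cofactor:
  assumes "x \<in> Zz" "x \<noteq> 0"
  obtains y d where "y \<in> Zz" "d \<noteq> 0" "x * y = of_int d"
  using Nm_cofactor[OF assms(1)] Nm_Ints[OF assms(1)] Nm_eq_0_iff[OF Zz_FF[OF assms(1)]] assms(2)
  by (metis Ints_cases of_int_0)

lemma FF_inverse: assumes "x \<in> FF" shows "inverse x \<in> FF"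
proof (cases "x = 0")
  case False
  obtain d f where d: "d \<noteq> 0" "of_int d * x = ipoly f z" using assms by (rule FFE)
  then have "ipoly f z \<noteq> 0" using False by (metis mult_eq_0_iff of_int_eq_0_iff)
  then obtain y e where y: "y \<in> Zz" "e \<noteq> 0" "ipoly f z * y = of_int e" by (metis Zz_cofactor ZzI)
  have "x * (of_int d * y) = of_int e" using y(3) unfolding d(2)[symmetric] by (simp add: algebra_simps)
  then have "of_int e * inverse x = of_int d * y" using False by (simp add: field_simps)
  then show ?thesis using y by (intro FFI[of e]) (auto intro: Zz_mult)
qed simp

lemma FF_divide: "x \<in> FF \<Longrightarrow> y \<in> FF \<Longrightarrow> x / y \<in> FF"
  by (simp add: divide_inverse FF_mult FF_inverse)

lemma sig_inverse: assumes "x \<in> FF" shows "sig (inverse x) = inverse (sig x)"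
proof (cases "x = 0")
  case False
  then have "sig x * sig (inverse x) = 1" by (simp add: assms FF_inverse flip: sig_mult)
  then show ?thesis by (metis inverse_unique)
qed simp

lemma sigk_inverse: "x \<in> FF \<Longrightarrow> (sig ^^ k) (inverse x) = inverse ((sig ^^ k) x)"
  by (induction k) (auto simp: sig_inverse sigk_FF)

text \<open>The partial products \<open>b i\<close> of the conjugates of \<open>c\<close> form a
  cocycle, and \<open>D t\<close> is its Lagrange resolvent, with
  \<open>c * sig (D t) = D t\<close>; the solution is the inverse of a nonzero value. Orthogonality
  replaces the independence of characters: the sum of the \<open>D (inverse z ^ j) * z ^ j\<close>
  is \<open>q\<close>, so some value is nonzero.\<close>

lemma hilbert90:
  assumes c: "c \<in> FF" "Nm c = 1"
  obtains e where "e \<in> FF" "e \<noteq> 0" "sig e = c * e"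
proof -
  define b where "b i = (\<Prod>j<i. (sig ^^ j) c)" for i
  have b_FF: "b i \<in> FF" for i unfolding b_def using c by (intro FF.prod sigk_FF)
  have b0: "b 0 = 1" and bn: "b n = 1" using c by (simp_all add: b_def Nm_def)
  have b_Suc: "c * sig (b i) = b (Suc i)" for i
    unfolding b_def using c by (simp add: sig_prod sigk_FF prod.lessThan_Suc_shift del: prod.lessThan_Suc)
  define D where "D t = (\<Sum>i<n. b i * (sig ^^ i) t)" for t
  have D_FF: "D t \<in> FF" if "t \<in> FF" for t unfolding D_def using that by (intro FF.sum FF_mult b_FF sigk_FF)
  have D_sig: "c * sig (D t) = D t" if t: "t \<in> FF" for t
  proof -
    have "c * sig (D t) = (\<Sum>i<n. b (Suc i) * (sig ^^ Suc i) t)"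
      unfolding D_def using t
      by (simp add: sig_sum sig_mult FF_mult b_FF sigk_FF sum_distrib_left flip: b_Suc mult.assoc)
    also have "\<dots> = D t"
    proof -
      have "(\<Sum>i<Suc n. b i * (sig ^^ i) t) = b 0 * (sig ^^ 0) t + (\<Sum>i<n. b (Suc i) * (sig ^^ Suc i) t)"
        by (rule sum.lessThan_Suc_shift)
      then show ?thesis using sig_n[OF t] by (simp add: D_def b0 bn)
    qed
    finally show ?thesis .
  qed
  have "(\<Sum>j<q. D ((inverse z) ^ j) * z ^ j)
      = (\<Sum>j<q. \<Sum>i<n. b i * ((sig ^^ i) (inverse z) * z) ^ j)"
    unfolding D_def sum_distrib_right
    by (intro sum.cong refl) (simp add: sigk_power FF.power power_mult_distrib)
  also have "\<dots> = (\<Sum>i<n. b i * (\<Sum>j<q. ((sig ^^ i) (inverse z) * z) ^ j))"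
    by (subst sum.swap) (simp add: sum_distrib_left)
  also have "\<dots> = (\<Sum>i<n. if i = 0 then b i * of_nat q else 0)"
    by (intro sum.cong refl) (subst sigk_z_orthogonal, auto)
  also have "\<dots> = of_nat q" using n_pos by (simp add: sum.delta b0)
  finally have "(\<Sum>j<q. D ((inverse z) ^ j) * z ^ j) \<noteq> 0" using p_gt_1 by simp
  then obtain j where j: "D ((inverse z) ^ j) \<noteq> 0"
    by (metis (no_types, lifting) mult_zero_left sum.neutral)
  define e where "e = D ((inverse z) ^ j)"
  have e: "e \<in> FF" "e \<noteq> 0" "c * sig e = e"
    using j unfolding e_def by (simp_all add: D_FF D_sig FF.power)
  show ?thesis
  proof
    show "inverse e \<in> FF" "inverse e \<noteq> 0" using e FF_inverse by auto
    have "c \<noteq> 0" "sig e \<noteq> 0" using e by auto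
    then show "sig (inverse e) = c * inverse e" using e(1) arg_cong[OF e(3), of inverse]
      using e(2) by (simp add: sig_inverse) (simp add: field_simps)
  qed
qed

end

section \<open>The valuation at a split prime\<close>

text \<open>Evaluation at \<open>w\<close>, a \<open>q\<close>-th root of unity of exact order \<open>q\<close> modulo \<open>N\<close>, defines a prime ideal \<open>PP\<close>
  of \<open>\<int>[z]\<close> of degree one above \<open>N\<close>, with local ring \<open>Ov\<close>, unit group \<open>Ou\<close> and valuation \<open>vv\<close>
  (a junk value outside the nonzero elements of \<open>FF\<close>).\<close>

locale cyclotomic_prime = cyclotomic +
  fixes N :: nat and w :: int
  assumes N: "prime N" and N_neq_p: "N \<noteq> p"
    and w: "int N dvd w ^ (p ^ r) - 1" "\<not> int N dvd w ^ (p ^ (r - 1)) - 1"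
begin

lemma prime_int_N: "prime (int N)" using N by simp

lemma N_gt_1: "1 < N" by (rule prime_gt_1_nat[OF N])

lemma N_nz [simp]: "complex_of_nat N \<noteq> 0" "N \<noteq> 0" using N_gt_1 by auto

lemma N_powi_add: "complex_of_nat N powi a * of_nat N powi b = of_nat N powi (a + b)"
  by (simp add: power_int_add)

definition PP :: "complex set" where "PP = {ipoly f z | f. int N dvd poly f w}"

lemma N_dvd_cyc: "int N dvd poly (cyc_poly p r) w"
proof -
  have "int N dvd poly (cyc_poly p r) w * (w ^ (p ^ (r - 1)) - 1)"
    unfolding poly_cyc_poly_int[OF r] by (rule w)
  then show ?thesis using w(2) prime_int_N by (simp add: prime_dvd_mult_iff)
qed

text \<open>Membership does not depend on the polynomial chosen, because \<open>N\<close> divides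
  the cyclotomic polynomial at \<open>w\<close>.\<close>

lemma ipoly_PP_iff: "ipoly f z \<in> PP \<longleftrightarrow> int N dvd poly f w"
proof
  assume "ipoly f z \<in> PP"
  then obtain h where h: "ipoly f z = ipoly h z" "int N dvd poly h w" by (auto simp: PP_def)
  then have "ipoly (f - h) z = 0" by simp
  then obtain k where "f - h = cyc_poly p r * k" unfolding ipoly_eq_0_iff by (auto simp: dvd_def)
  then have "poly f w = poly h w + poly (cyc_poly p r) w * poly k w"
    by (metis poly_mult poly_diff add_diff_cancel_left' diff_add_cancel add.commute)
  then show "int N dvd poly f w" using h N_dvd_cyc by (simp add: dvd_add dvd_mult2)
qed (auto simp: PP_def)

lemma PP_Zz: "x \<in> PP \<Longrightarrow> x \<in> Zz" by (auto simp: PP_def ZzI)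

lemma PP_mult_iff: "x \<in> Zz \<Longrightarrow> y \<in> Zz \<Longrightarrow> x * y \<in> PP \<longleftrightarrow> x \<in> PP \<or> y \<in> PP"
  using prime_int_N
  by (auto elim!: ZzE simp: ipoly_PP_iff prime_dvd_mult_iff simp flip: ipoly_simps(8))


lemma PP_add: "x \<in> PP \<Longrightarrow> y \<in> PP \<Longrightarrow> x + y \<in> PP"
proof -
  assume "x \<in> PP" "y \<in> PP"
  then obtain f h where "x = ipoly f z" "y = ipoly h z" "int N dvd poly f w" "int N dvd poly h w"
    by (auto simp: PP_def)
  then show ?thesis using ipoly_PP_iff[of "f + h"] by simp
qed

lemma PP_of_int_iff: "of_int k \<in> PP \<longleftrightarrow> int N dvd k" using ipoly_PP_iff[of "[:k:]"] by simp

lemma PP_N_mult: "x \<in> Zz \<Longrightarrow> of_nat N * x \<in> PP"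
  using PP_of_int_iff[of "int N"] by (simp add: PP_mult_iff)

lemma PP_residue: assumes "x \<in> Zz" obtains t where "x - of_int t \<in> PP"
proof -
  obtain f where "x = ipoly f z" using assms by (rule ZzE)
  then show ?thesis using that[of "poly f w"] ipoly_PP_iff[of "f - [:poly f w:]"] by simp
qed

lemma z_residue: "z - of_int w \<in> PP" using ipoly_PP_iff[of "[:- w, 1:]"] by simp

text \<open>The polynomial \<open>(X\<^sup>q - w\<^sup>q) / (X - w)\<close> does not vanish at \<open>w\<close> modulo \<open>N\<close>, so that
  \<open>z - w\<close> is a multiple of \<open>N\<close> up to an element outside \<open>PP\<close>: no passage to the \<open>N\<close>-adic
  numbers is needed.\<close>

lemma PP_local_generator:
  obtains s where "s \<in> Zz" "s \<notin> PP" "\<And>x. x \<in> PP \<Longrightarrow> \<exists>y\<in>Zz. x * s = of_nat N * y"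
proof
  let ?S = "\<Sum>i<q. monom (w ^ (q - Suc i)) i :: int poly"
  let ?s = "ipoly ?S z"
  show "?s \<in> Zz" by (rule ZzI)
  have "poly ?S w = (\<Sum>i<q. w ^ (q - 1))"
    by (auto simp: poly_sum poly_monom power_add[symmetric] intro!: sum.cong)
  then have Sw: "poly ?S w = int q * w ^ (q - 1)" by simp
  have "\<not> int N dvd w"
  proof
    assume "int N dvd w"
    then have "int N dvd w ^ q"
      by (rule dvd_trans) (rule dvd_power, use q_gt_1 in linarith)
    with w(1) have "int N dvd w ^ q - (w ^ q - 1)" by (rule dvd_diff[rotated])
    then show False using N_gt_1 by simp
  qed
  moreover have "\<not> int N dvd int q"
    using N N_neq_p p by (metis of_nat_dvd_iff prime_dvd_power primes_dvd_imp_eq)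
  ultimately show "?s \<notin> PP" unfolding ipoly_PP_iff Sw
    using prime_int_N prime_dvd_power[of "int N" w "q - 1"] by (simp only: prime_dvd_mult_iff) blast
  obtain t where t: "w ^ q - 1 = int N * t" using w(1) by (auto simp: dvd_def)
  have "z ^ q - of_int w ^ q = (z - of_int w) * ?s"
    by (simp add: power_diff_sumr2 hom_distribs poly_sum poly_monom)
  moreover have "of_int w ^ q - 1 = complex_of_nat N * of_int t"
    using arg_cong[OF t, of complex_of_int] by simp
  ultimately have zw: "(z - of_int w) * ?s = - (of_nat N * of_int t)"
    by (simp add: z_pow_q algebra_simps)
  show "\<exists>y\<in>Zz. x * ?s = of_nat N * y" if x: "x \<in> PP" for x
  proof -
    obtain f where f: "x = ipoly f z" "int N dvd poly f w" using x by (auto simp: PP_def)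
    obtain u where u: "poly f w = int N * u" using f by (auto simp: dvd_def)
    have "poly (f - [:poly f w:]) w = 0" by simp
    then obtain h where "f - [:poly f w:] = [:- w, 1:] * h" by (metis dvdE poly_eq_0_iff_dvd)
    then have "ipoly (f - [:poly f w:]) z = ipoly ([:- w, 1:] * h) z" by simp
    then have "x = of_int (int N * u) + (z - of_int w) * ipoly h z" by (simp add: f u algebra_simps)
    then have "x * ?s = (of_int (int N * u) + (z - of_int w) * ipoly h z) * ?s" by (rule arg_cong)
    also have "\<dots> = of_nat N * of_int u * ?s + ((z - of_int w) * ?s) * ipoly h z"
      by (simp only: of_int_mult of_int_of_nat_eq ring_distribs mult_ac)
    also have "\<dots> = of_nat N * (of_int u * ?s - of_int t * ipoly h z)"
      unfolding zw by (simp add: algebra_simps)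
    finally show ?thesis by (intro bexI[OF _ Zz_diff]) (auto intro!: Zz_mult ZzI)
  qed
qed

section \<open>The local ring at \<open>PP\<close> and its valuation\<close>

definition Ov :: "complex set" where "Ov = {a / b | a b. a \<in> Zz \<and> b \<in> Zz \<and> b \<notin> PP}"
definition Ou :: "complex set" where "Ou = {a / b | a b. a \<in> Zz \<and> a \<notin> PP \<and> b \<in> Zz \<and> b \<notin> PP}"

lemma nz_not_PP: "b \<notin> PP \<Longrightarrow> b \<noteq> 0" using PP_of_int_iff[of 0] by auto

lemma one_not_PP: "1 \<notin> PP" using PP_of_int_iff[of 1] N_gt_1 by auto

lemma Zz_Ov: "x \<in> Zz \<Longrightarrow> x \<in> Ov" unfolding Ov_def using one_not_PP Zz.one by (metis (mono_tags, lifting) div_by_1 mem_Collect_eq)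
lemma Zz_Ou: "x \<in> Zz \<Longrightarrow> x \<notin> PP \<Longrightarrow> x \<in> Ou" unfolding Ou_def using one_not_PP Zz.one by (metis (mono_tags, lifting) div_by_1 mem_Collect_eq)
lemma Ou_Ov: "x \<in> Ou \<Longrightarrow> x \<in> Ov" by (auto simp: Ou_def Ov_def)
lemma Ov_FF: "x \<in> Ov \<Longrightarrow> x \<in> FF" by (auto simp: Ov_def intro!: FF_divide intro: Zz_FF)
lemma Ov_mult: assumes "x \<in> Ov" "y \<in> Ov" shows "x * y \<in> Ov"
proof -
  obtain a b c d where "x = a / b" "y = c / d" "a \<in> Zz" "b \<in> Zz" "b \<notin> PP" "c \<in> Zz" "d \<in> Zz" "d \<notin> PP"
    using assms by (auto simp: Ov_def)
  then have "x * y = (a * c) / (b * d)" "a * c \<in> Zz" "b * d \<in> Zz" "b * d \<notin> PP"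
    by (auto simp: PP_mult_iff Zz_mult)
  then show ?thesis by (auto simp: Ov_def)
qed

lemma Ov_add: assumes "x \<in> Ov" "y \<in> Ov" shows "x + y \<in> Ov"
proof -
  obtain a b c d where 1: "x = a / b" "y = c / d" "a \<in> Zz" "b \<in> Zz" "b \<notin> PP" "c \<in> Zz" "d \<in> Zz" "d \<notin> PP"
    using assms by (auto simp: Ov_def)
  then have "x + y = (a * d + c * b) / (b * d)" using nz_not_PP by (simp add: field_simps)
  moreover have "a * d + c * b \<in> Zz" "b * d \<in> Zz" "b * d \<notin> PP"
    using 1 by (auto simp: PP_mult_iff Zz_mult Zz.add)
  ultimately show ?thesis by (auto simp: Ov_def)
qed

lemma Ov_diff: "x \<in> Ov \<Longrightarrow> y \<in> Ov \<Longrightarrow> x - y \<in> Ov"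
  using Ov_add[of x "of_int (- 1) * y"] Ov_mult[OF Zz_Ov[OF Zz.of_int], of y "- 1"] by simp

sublocale Ov: number_ring Ov
  by unfold_locales (auto intro: Ov_diff Ov_mult Zz_Ov)

lemma Ou_mult: assumes "x \<in> Ou" "y \<in> Ou" shows "x * y \<in> Ou"
proof -
  obtain a b c d where "x = a / b" "y = c / d" "a \<in> Zz" "a \<notin> PP" "b \<in> Zz" "b \<notin> PP"
    "c \<in> Zz" "c \<notin> PP" "d \<in> Zz" "d \<notin> PP"
    using assms by (auto simp: Ou_def)
  then have "x * y = (a * c) / (b * d)" "a * c \<in> Zz" "a * c \<notin> PP" "b * d \<in> Zz" "b * d \<notin> PP"
    by (auto simp: PP_mult_iff Zz_mult)
  then show ?thesis unfolding Ou_def by blast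
qed

lemma Ou_inverse: "x \<in> Ou \<Longrightarrow> inverse x \<in> Ou"
proof -
  assume "x \<in> Ou"
  then obtain a b where "x = a / b" "a \<in> Zz" "a \<notin> PP" "b \<in> Zz" "b \<notin> PP" by (auto simp: Ou_def)
  then have "inverse x = b / a" by simp
  then show ?thesis using \<open>a \<in> Zz\<close> \<open>a \<notin> PP\<close> \<open>b \<in> Zz\<close> \<open>b \<notin> PP\<close> unfolding Ou_def by blast
qed

lemma Ou_nz: "x \<in> Ou \<Longrightarrow> x \<noteq> 0" using nz_not_PP by (auto simp: Ou_def)

lemma Ou_of_int_iff: "of_int k \<in> Ou \<longleftrightarrow> \<not> int N dvd k"
proof
  show "\<not> int N dvd k \<Longrightarrow> of_int k \<in> Ou" by (intro Zz_Ou) (auto simp: PP_of_int_iff)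
  assume "of_int k \<in> Ou"
  then obtain a b where ab: "of_int k = a / b" "a \<in> Zz" "a \<notin> PP" "b \<in> Zz" "b \<notin> PP" by (auto simp: Ou_def)
  then have "of_int k * b = a" using nz_not_PP[of b] by (simp add: field_simps)
  then have "of_int k * b \<notin> PP" using ab by simp
  then show "\<not> int N dvd k" using PP_mult_iff[of "of_int k" b] PP_of_int_iff[of k] ab(4) Zz.of_int by blast
qed

text \<open>\<open>PP\<close> is unramified: by \<open>PP_local_generator\<close> it is generated
  locally by \<open>N\<close>, which therefore serves as uniformiser.\<close>

lemma Ov_cases: assumes "x \<in> Ov" shows "x \<in> Ou \<or> x / of_nat N \<in> Ov"
proof -
  obtain s where s: "s \<in> Zz" "s \<notin> PP" "\<And>x. x \<in> PP \<Longrightarrow> \<exists>y\<in>Zz. x * s = of_nat N * y"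
    using PP_local_generator by blast
  obtain a b where ab: "x = a / b" "a \<in> Zz" "b \<in> Zz" "b \<notin> PP" using assms by (auto simp: Ov_def)
  show ?thesis
  proof (cases "a \<in> PP")
    case True
    then obtain y where y: "y \<in> Zz" "a * s = of_nat N * y" using s(3) by blast
    have "x / of_nat N = y / (b * s)"
      using y(2) ab(1) nz_not_PP[OF ab(4)] nz_not_PP[OF s(2)]
      by (simp add: field_simps) (metis mult.assoc mult.commute)
    moreover have "b * s \<in> Zz" "b * s \<notin> PP" using ab s by (auto simp: PP_mult_iff Zz_mult)
    ultimately show ?thesis using y by (auto simp: Ov_def)
  qed (use ab in \<open>auto simp: Ou_def\<close>)
qed

lemma Ou_not_N: assumes "x \<in> Ou" shows "x / of_nat N \<notin> Ov"
proof
  assume "x / of_nat N \<in> Ov"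
  then obtain c d where cd: "x / of_nat N = c / d" "c \<in> Zz" "d \<in> Zz" "d \<notin> PP" by (auto simp: Ov_def)
  obtain a b where ab: "x = a / b" "a \<in> Zz" "a \<notin> PP" "b \<in> Zz" "b \<notin> PP" using assms by (auto simp: Ou_def)
  have "a * d = of_nat N * (c * b)"
    using ab(1) cd(1) nz_not_PP[OF ab(5)] nz_not_PP[OF cd(4)]
    by (simp add: field_simps) (metis mult.assoc mult.commute)
  then have "a * d \<in> PP" using PP_N_mult cd ab by (simp add: Zz_mult)
  then show False using ab cd by (simp add: PP_mult_iff)
qed

text \<open>The residue field is \<open>\<int>/N\<close>: numerator and denominator are replaced by
  integers, and the denominator is inverted modulo \<open>N\<close>.\<close>

lemma Ov_residue: assumes "x \<in> Ov" obtains t :: int where "(x - of_int t) / of_nat N \<in> Ov"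
proof -
  obtain a b where ab: "x = a / b" "a \<in> Zz" "b \<in> Zz" "b \<notin> PP" using assms by (auto simp: Ov_def)
  obtain i where i: "a - of_int i \<in> PP" using PP_residue ab by blast
  obtain j where j: "b - of_int j \<in> PP" using PP_residue ab by blast
  have "\<not> int N dvd j" using PP_add[OF j, of "of_int j"] ab by (auto simp: PP_of_int_iff)
  then have "coprime j (int N)" using prime_int_N by (metis coprime_commute prime_imp_coprime)
  then obtain j' where j': "[j * j' = 1] (mod int N)" using cong_solve_coprime_int by blast
  let ?t = "i * j'"
  have "[i - ?t * j = 0] (mod int N)"
    using cong_mult[OF cong_refl[of i] j'] by (simp add: cong_iff_dvd_diff algebra_simps dvd_diff_commute)
  then have "int N dvd i - ?t * j" by (simp add: cong_0_iff)
  then have 1: "of_int (i - ?t * j) \<in> PP" by (simp only: PP_of_int_iff)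
  have 2: "of_int (- ?t) * (b - of_int j) \<in> PP"
    using j PP_mult_iff[OF Zz.of_int PP_Zz[OF j]] by blast
  have "a - of_int ?t * b \<in> PP"
    using PP_add[OF PP_add[OF i 1] 2] by (simp add: algebra_simps)
  moreover have "x - of_int ?t = (a - of_int ?t * b) / b" using ab nz_not_PP by (simp add: field_simps)
  ultimately have "x - of_int ?t \<notin> Ou"
  proof -
    assume *: "a - of_int ?t * b \<in> PP" "x - of_int ?t = (a - of_int ?t * b) / b"
    show ?thesis
    proof
      assume "x - of_int ?t \<in> Ou"
      then obtain c d where cd: "x - of_int ?t = c / d" "c \<in> Zz" "c \<notin> PP" "d \<in> Zz" "d \<notin> PP" by (auto simp: Ou_def)
      then have "c * b = (a - of_int ?t * b) * d" using * nz_not_PP ab by (simp add: field_simps)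
      then show False using * cd ab PP_Zz by (metis PP_mult_iff)
    qed
  qed
  then have "(x - of_int ?t) / of_nat N \<in> Ov" using Ov_cases[OF Ov_diff[OF assms Ov.of_int]] by blast
  then show ?thesis by (rule that)
qed

text \<open>Residue degree one, used repeatedly. The number of classes modulo \<open>N ^ j\<close>
  obtained in this way is what the box principle needs.\<close>

lemma Ov_residue_power:
  assumes "x \<in> Ov" shows "\<exists>t :: nat. t < N ^ j \<and> (x - of_nat t) / of_nat N ^ j \<in> Ov"
proof -
  have "\<exists>t :: int. (x - of_int t) / of_nat N ^ j \<in> Ov"
  proof (induction j)
    case 0
    then show ?case using assms by (intro exI[of _ 0]) simp
  next
    case (Suc j)
    then obtain t where t: "(x - of_int t) / of_nat N ^ j \<in> Ov" by blast
    then obtain u where "((x - of_int t) / of_nat N ^ j - of_int u) / of_nat N \<in> Ov" by (rule Ov_residue)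
    moreover have "((x - of_int t) / of_nat N ^ j - of_int u) / of_nat N
        = (x - of_int (t + u * int N ^ j)) / of_nat N ^ Suc j" by (simp add: field_simps)
    ultimately show ?case by metis
  qed
  then obtain t where t: "(x - of_int t) / of_nat N ^ j \<in> Ov" by blast
  let ?u = "nat (t mod int N ^ j)"
  have pos: "0 < int N ^ j" using N_gt_1 by simp
  have u: "int ?u = t mod int N ^ j" using pos by simp
  have "(x - of_nat ?u) / of_nat N ^ j = (x - of_int t) / of_nat N ^ j + of_int (t div int N ^ j)"
  proof -
    have "complex_of_int t = of_int (t div int N ^ j * int N ^ j + int ?u)"
      unfolding u by (simp only: div_mult_mod_eq)
    then have "complex_of_int t = of_int (t div int N ^ j) * of_nat N ^ j + of_nat ?u"
      by (simp only: of_int_add of_int_mult of_int_of_nat_eq of_int_power)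
    then show ?thesis by (simp add: field_simps del: of_nat_nat)
  qed
  also have "\<dots> \<in> Ov" using t by (intro Ov_add) auto
  finally have "(x - of_nat ?u) / of_nat N ^ j \<in> Ov" .
  moreover have "?u < N ^ j" using pos u by (simp add: nat_less_iff)
  ultimately show ?thesis by blast
qed

definition vv :: "complex \<Rightarrow> int" where
  "vv x = (THE e. x * of_nat N powi (- e) \<in> Ou)"

lemma vv_eqI: assumes "x = of_nat N powi e * u" "u \<in> Ou" shows "vv x = e"
  unfolding vv_def
proof (rule the_equality)
  show "x * of_nat N powi (- e) \<in> Ou" using assms by (simp add: power_int_minus field_simps)
  fix e' assume "x * of_nat N powi (- e') \<in> Ou"
  then have u': "of_nat N powi (e - e') * u \<in> Ou"
    using assms by (simp add: power_int_diff power_int_minus field_simps)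
  have aux: False if d: "0 < d" and uu: "u1 \<in> Ou" "of_nat N powi d * u1 \<in> Ou" for d u1
  proof -
    have "of_nat N powi d * u1 / of_nat N = of_nat N ^ nat (d - 1) * u1"
      using d power_int_diff[of "complex_of_nat N" d 1] by (simp add: power_int_def nat_diff_distrib split: if_splits)
    also have "\<dots> \<in> Ov" using Ou_Ov[OF uu(1)] by (intro Ov_mult Ov.power) auto
    finally show False using Ou_not_N uu by blast
  qed
  show "e' = e"
  proof (rule ccontr)
    assume "e' \<noteq> e"
    then consider "0 < e - e'" | "0 < e' - e" by linarith
    then show False
    proof cases
      case 1 then show False using aux[OF _ assms(2) u'] by simp
    next
      case 2
      have "complex_of_nat N powi (e' - e) * of_nat N powi (e - e') = 1"
        unfolding N_powi_add by simp
      then have "of_nat N powi (e' - e) * (of_nat N powi (e - e') * u) = u"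
        by (simp only: mult.assoc[symmetric]) simp
      then have "of_nat N powi (e' - e) * (of_nat N powi (e - e') * u) \<in> Ou" using assms(2) by (simp only:)
      then show False by (rule aux[OF 2 u'])
    qed
  qed
qed

text \<open>Otherwise \<open>x\<close> would be divisible by every power of \<open>N\<close> in
  \<open>Ov\<close>, and so would the nonzero integer \<open>d = x * y\<close>, against
  \<open>Ou_not_N\<close>.\<close>

lemma vv_exists_Zz: assumes "x \<in> Zz" "x \<noteq> 0" shows "\<exists>k u. u \<in> Ou \<and> x = of_nat N ^ k * u"
proof (rule ccontr)
  assume no: "\<nexists>k u. u \<in> Ou \<and> x = of_nat N ^ k * u"
  have all: "x / of_nat N ^ k \<in> Ov" for k
  proof (induction k)
    case 0 then show ?case using assms by (simp add: Zz_Ov)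
  next
    case (Suc k)
    have "x = of_nat N ^ k * (x / of_nat N ^ k)" by simp
    then have "x / of_nat N ^ k \<notin> Ou" using no by blast
    then show ?case using Ov_cases[OF Suc] by (simp add: mult.commute)
  qed
  obtain y d where y: "y \<in> Zz" "d \<noteq> 0" "x * y = of_int d" using Zz_cofactor assms by blast
  define m where "m = multiplicity (int N) d"
  obtain d' where d': "d = int N ^ m * d'" "\<not> int N dvd d'"
    using multiplicity_decompose'[of d "int N"] y(2) N_gt_1 unfolding m_def by auto
  have "of_int d' / of_nat N = x / of_nat N ^ Suc m * y"
  proof -
    have "x * y = of_nat N ^ m * of_int d'" using y d' by simp
    then show ?thesis by (simp add: field_simps)
  qed
  also have "\<dots> \<in> Ov" using all[of "Suc m"] y(1) by (intro Ov_mult) (auto intro: Zz_Ov)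
  finally show False using Ou_not_N d'(2) Ou_of_int_iff by blast
qed

lemma vv_exists: assumes "x \<in> FF" "x \<noteq> 0" shows "\<exists>e u. u \<in> Ou \<and> x = of_nat N powi e * u"
proof -
  obtain d f where d: "d \<noteq> 0" "of_int d * x = ipoly f z" using assms by (auto elim: FFE)
  obtain k u where 1: "u \<in> Ou" "of_int d * x = of_nat N ^ k * u"
    using vv_exists_Zz[of "of_int d * x"] d assms(2) by (metis ZzI mult_eq_0_iff of_int_eq_0_iff)
  obtain k' u' where 2: "u' \<in> Ou" "of_int d = of_nat N ^ k' * u'"
    using vv_exists_Zz[of "of_int d"] d(1) by auto
  have "x = of_nat N powi (int k - int k') * (u * inverse u')"
    using 1 2 Ou_nz[OF 2(1)] by (simp add: power_int_diff field_simps)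
  moreover have "u * inverse u' \<in> Ou" using 1 2 by (intro Ou_mult Ou_inverse)
  ultimately show ?thesis by blast
qed

lemma vv_unit: assumes "x \<in> FF" "x \<noteq> 0" obtains u where "u \<in> Ou" "x = of_nat N powi (vv x) * u"
  using vv_exists[OF assms] vv_eqI by metis

lemma vv_Ou: "u \<in> Ou \<Longrightarrow> vv u = 0" using vv_eqI[of u 0 u] by simp

lemma vv_N: "vv (of_nat N) = 1"
  using vv_eqI[of "of_nat N" 1 1] Ou_of_int_iff[of 1] N_gt_1 by simp

lemma vv_mult: assumes "x \<in> FF" "x \<noteq> 0" "y \<in> FF" "y \<noteq> 0" shows "vv (x * y) = vv x + vv y"
proof -
  obtain u where u: "u \<in> Ou" "x = of_nat N powi (vv x) * u" using vv_unit assms by blast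
  obtain u' where u': "u' \<in> Ou" "y = of_nat N powi (vv y) * u'" using vv_unit assms by blast
  show ?thesis
  proof (rule vv_eqI)
    show "x * y = of_nat N powi (vv x + vv y) * (u * u')"
      by (subst u(2), subst u'(2)) (simp add: power_int_add)
  qed (intro Ou_mult u u')
qed

lemma vv_inverse: assumes "x \<in> FF" "x \<noteq> 0" shows "vv (inverse x) = - vv x"
  using vv_mult[OF assms FF_inverse[OF assms(1)]] assms vv_Ou[of 1] Ou_of_int_iff[of 1] N_gt_1 by simp

lemma vv_1 [simp]: "vv 1 = 0" using vv_Ou[of 1] Ou_of_int_iff[of 1] N_gt_1 by simp

lemma vv_power: assumes "x \<in> FF" "x \<noteq> 0" shows "vv (x ^ k) = int k * vv x"
  using assms by (induction k) (simp_all add: vv_mult FF.power algebra_simps)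

lemma vv_prod:
  assumes "\<And>i. i \<in> I \<Longrightarrow> f i \<in> FF \<and> f i \<noteq> 0"
  shows "vv (prod f I) = (\<Sum>i\<in>I. vv (f i))"
  using assms by (induction I rule: infinite_finite_induct) (simp_all add: vv_mult FF.prod)

lemma vv_ge_iff: assumes "x \<in> FF" "x \<noteq> 0" shows "int k \<le> vv x \<longleftrightarrow> x / of_nat N ^ k \<in> Ov"
proof -
  obtain u where u: "u \<in> Ou" "x = of_nat N powi (vv x) * u" using vv_unit assms by blast
  have eq: "x / of_nat N ^ k = of_nat N powi (vv x - int k) * u"
    by (subst u(2)) (simp add: power_int_diff)
  show ?thesis
  proof
    assume "int k \<le> vv x"
    then have "x / of_nat N ^ k = of_nat N ^ nat (vv x - int k) * u"
      unfolding eq by (simp add: power_int_def)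
    also have "\<dots> \<in> Ov" using Ou_Ov[OF u(1)] by (intro Ov_mult Ov.power) auto
    finally show "x / of_nat N ^ k \<in> Ov" .
  next
    assume O: "x / of_nat N ^ k \<in> Ov"
    show "int k \<le> vv x"
    proof (rule ccontr)
      assume "\<not> int k \<le> vv x"
      then have "1 \<le> int k - vv x" by simp
      then have "of_nat N ^ nat (int k - vv x - 1) = complex_of_nat N powi (int k - vv x - 1)"
        by (simp add: power_int_def)
      then have "of_nat N ^ nat (int k - vv x - 1) * (x / of_nat N ^ k)
          = (of_nat N powi (int k - vv x - 1) * of_nat N powi (vv x - int k)) * u"
        unfolding eq by simp
      also have "\<dots> = u / of_nat N" unfolding N_powi_add
        by (simp add: field_simps)
      finally have "u / of_nat N = of_nat N ^ nat (int k - vv x - 1) * (x / of_nat N ^ k)" ..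
      also have "\<dots> \<in> Ov" using O by (intro Ov_mult Ov.power) auto
      finally show False using Ou_not_N u by blast
    qed
  qed
qed

lemma vv_nonneg_iff: "x \<in> FF \<Longrightarrow> x \<noteq> 0 \<Longrightarrow> 0 \<le> vv x \<longleftrightarrow> x \<in> Ov"
  using vv_ge_iff[of x 0] by simp

lemma vv_Zz_nonneg: "x \<in> Zz \<Longrightarrow> x \<noteq> 0 \<Longrightarrow> 0 \<le> vv x"
  by (subst vv_nonneg_iff) (auto intro: Zz_FF Zz_Ov)

lemma vv_of_int: assumes "\<not> int N dvd k" shows "vv (of_int k) = 0"
  using assms by (intro vv_Ou) (simp add: Ou_of_int_iff)

lemma vv_of_int_eq: assumes "k \<noteq> 0" shows "vv (of_int k) = int (multiplicity (int N) k)"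
proof -
  obtain d' where d': "k = int N ^ multiplicity (int N) k * d'" "\<not> int N dvd d'"
    using multiplicity_decompose'[of k "int N"] assms N_gt_1 by auto
  show ?thesis
  proof (rule vv_eqI[where u = "of_int d'"])
    show "complex_of_int k = of_nat N powi int (multiplicity (int N) k) * of_int d'"
      using arg_cong[OF d'(1), of complex_of_int] by simp
    show "of_int d' \<in> Ou" using d' by (simp add: Ou_of_int_iff)
  qed
qed

text \<open>Crude, but enough: the bounded cofactors supplied by the box principle have bounded
  valuation.\<close>

lemma vv_le_of_int: assumes "k \<noteq> 0" shows "vv (of_int k) \<le> \<bar>k\<bar>"
proof -
  define l where "l = multiplicity (int N) k"
  have "vv (of_int k) = int l" unfolding l_def by (rule vv_of_int_eq[OF assms])
  also have "int l \<le> 2 ^ l" using less_exp[of l] by (metis less_imp_le of_nat_le_iff of_nat_numeral of_nat_power)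
  also have "\<dots> \<le> int N ^ l" using N_gt_1 by (intro power_mono) auto
  also have "\<dots> \<le> \<bar>k\<bar>"
  proof -
    have "int N ^ l dvd \<bar>k\<bar>" by (simp add: l_def multiplicity_dvd)
    then show ?thesis using assms by (intro zdvd_imp_le) auto
  qed
  finally show ?thesis .
qed

end

text \<open>If \<open>h\<close> is a primitive root modulo \<open>N\<close>, its power with exponent
  \<open>(N - 1) div p ^ r\<close> has exact order \<open>p ^ r\<close>. The case
  \<open>r = 2\<close> is the only place where the congruence modulo \<open>p ^ 2\<close> enters the
  converse direction.\<close>

lemma ex_root_of_unity_mod_prime:
  fixes p r N :: nat
  assumes p: "prime p" and r: "0 < r" and N: "prime N" and c: "[N = 1] (mod p ^ r)"
  obtains w :: int where "int N dvd w ^ (p ^ r) - 1" "\<not> int N dvd w ^ (p ^ (r - 1)) - 1" "N \<noteq> p"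
proof -
  have p1: "1 < p" by (rule prime_gt_1_nat[OF p])
  have N1: "1 < N" by (rule prime_gt_1_nat[OF N])
  have "p ^ r dvd N - 1" using c N1 by (subst (asm) cong_altdef_nat) auto
  then obtain m where m: "N - 1 = p ^ r * m" by (auto simp: dvd_def)
  have m0: "0 < m" using m N1 by (cases m) auto
  obtain h where h: "residue_primroot N h" using prime_primitive_root_exists[OF N1 N] by blast
  have ord: "ord N h = N - 1" using h N by (simp add: residue_primroot_def totient_prime)
  have dv: "int N dvd int (h ^ m) ^ k - 1 \<longleftrightarrow> p ^ r dvd k" for k
  proof -
    have "int N dvd int (h ^ m) ^ k - 1 \<longleftrightarrow> [int (h ^ (m * k)) = int 1] (mod int N)"
      by (simp add: cong_iff_dvd_diff power_mult)
    also have "\<dots> \<longleftrightarrow> [h ^ (m * k) = 1] (mod N)" by (simp only: cong_int_iff)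
    also have "\<dots> \<longleftrightarrow> p ^ r * m dvd k * m" unfolding ord_divides ord m by (simp add: mult.commute)
    also have "\<dots> \<longleftrightarrow> p ^ r dvd k" using m0 by simp
    finally show ?thesis .
  qed
  have "\<not> p ^ r dvd p ^ (r - 1)" using p1 r by (simp add: power_dvd_imp_le dvd_power_iff_le)
  moreover have "N \<noteq> p"
  proof
    assume "N = p"
    then have "[p = 1] (mod p)" using c r by (metis cong_modulus_mult_nat power_minus_mult mult.commute)
    then show False using p1 by (simp add: cong_def)
  qed
  ultimately show ?thesis using that[of "int (h ^ m)"] dv by simp
qed

section \<open>Units outside a finite set of primes and genus theory\<close>

definition fdiff :: "(nat \<Rightarrow> int) \<Rightarrow> nat \<Rightarrow> int" where "fdiff f i = f (Suc i) - f i"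

lemma fdiff_funpow: "(fdiff ^^ m) f i = (\<Sum>j\<le>m. (-1) ^ j * int (m choose j) * f (i + (m - j)))"
proof (induction m arbitrary: i)
  case (Suc m)
  let ?F = "\<lambda>j. f (i + (Suc m - j))" and ?c = "\<lambda>j. (-1) ^ j * int (m choose j)"
  have "(\<Sum>j\<le>Suc m. (-1) ^ j * int (Suc m choose j) * ?F j)
      = ?F 0 + (\<Sum>j\<le>m. (-1) ^ Suc j * int (Suc m choose Suc j) * ?F (Suc j))"
    by (subst sum.atMost_Suc_shift) simp
  also have "\<dots> = (?F 0 + (\<Sum>j\<le>m. ?c (Suc j) * ?F (Suc j))) - (\<Sum>j\<le>m. ?c j * ?F (Suc j))"
    by (simp add: algebra_simps sum.distrib sum_subtractf sum_negf)
  also have "?F 0 + (\<Sum>j\<le>m. ?c (Suc j) * ?F (Suc j)) = (\<Sum>j\<le>Suc m. ?c j * ?F j)"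
    using sum.atMost_Suc_shift[of "\<lambda>j. ?c j * ?F j" m] by simp
  also have "\<dots> = (\<Sum>j\<le>m. ?c j * f (Suc i + (m - j)))"
    by (simp add: Suc_diff_le)
  finally show ?case
    by (simp only: funpow.simps comp_apply fdiff_def[of "(fdiff ^^ m) f"] Suc.IH diff_Suc_Suc)
qed simp

lemma fdiff_funpow_periodic:
  assumes "\<And>i. f (i + m) = f i" shows "(fdiff ^^ k) f (i + m) = (fdiff ^^ k) f i"
proof -
  have "f (i + m + (k - j)) = f (i + (k - j))" for j
    using assms[of "i + (k - j)"] by (simp add: add_ac)
  then show ?thesis by (simp only: fdiff_funpow)
qed

lemma fdiff_funpow_smult: "(fdiff ^^ k) (\<lambda>i. c * f i) i = c * (fdiff ^^ k) f i"
  by (simp add: fdiff_funpow sum_distrib_left mult_ac)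

text \<open>With the shift \<open>T\<close>, the binomial theorem gives
  \<open>(T - 1) ^ p = T ^ p - 1\<close> modulo \<open>p\<close>, which kills sequences of period
  \<open>p\<close>; the last term has a minus sign because \<open>p\<close> is odd.\<close>

lemma fdiff_prime_dvd:
  assumes p: "prime p" "odd p" and per: "\<And>i. f (i + p) = f i"
  shows "int p dvd (fdiff ^^ p) f i"
proof -
  have p0: "0 < p" using p by (simp add: prime_gt_0_nat)
  let ?t = "\<lambda>j. (-1) ^ j * int (p choose j) * f (i + (p - j))"
  have "{..p} = insert 0 (insert p {0<..<p})" using p0 by auto
  then have "(fdiff ^^ p) f i = ?t 0 + (?t p + (\<Sum>j\<in>{0<..<p}. ?t j))"
    using p0 by (simp add: fdiff_funpow)
  also have "\<dots> = (\<Sum>j\<in>{0<..<p}. ?t j)" using p per by simp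
  also have "int p dvd \<dots>"
  proof (rule dvd_sum)
    fix k assume "k \<in> {0<..<p}"
    then have "int p dvd int (p choose k)" using p by (simp add: dvd_choose_prime)
    then show "int p dvd ?t k" by (intro dvd_mult2 dvd_mult)
  qed
  finally show ?thesis .
qed

text \<open>The \<open>p\<close>-fold differences divided by \<open>p\<close> are again periodic, so
  the previous argument can be repeated.\<close>

lemma fdiff_prime_power_dvd:
  assumes p: "prime p" "odd p" and per: "\<And>i. f (i + p) = f i"
  shows "int p ^ e dvd (fdiff ^^ (p * e)) f i"
  using per
proof (induction e arbitrary: f)
  case (Suc e)
  define h where "h i = (fdiff ^^ p) f i div int p" for i
  have eq: "(fdiff ^^ p) f = (\<lambda>i. int p * h i)"
    using fdiff_prime_dvd[OF p, of f] Suc.prems by (simp add: h_def)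
  have "h (i + p) = h i" for i unfolding h_def using fdiff_funpow_periodic[of f p p i] Suc.prems by simp
  then have "int p ^ e dvd (fdiff ^^ (p * e)) h i" by (rule Suc.IH)
  moreover have "(fdiff ^^ (p * Suc e)) f i = int p * (fdiff ^^ (p * e)) h i"
    using eq by (simp add: funpow_add add.commute[of p] fdiff_funpow_smult)
  ultimately show ?case by simp
qed simp

context cyclotomic
begin

lemma Nm_inverse: "x \<in> FF \<Longrightarrow> Nm (inverse x) = inverse (Nm x)"
  using prod_inversef[of "\<lambda>i. (sig ^^ i) x" "{..<n}"] by (simp add: Nm_def sigk_inverse comp_def)

lemma FF_powi: "x \<in> FF \<Longrightarrow> x powi e \<in> FF"
  by (simp add: power_int_def FF.power FF_inverse)
lemma sigk_powi: "x \<in> FF \<Longrightarrow> (sig ^^ k) (x powi e) = (sig ^^ k) x powi e"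
  by (simp add: power_int_def sigk_power sigk_inverse FF.power FF_inverse)
lemma Nm_powi: "x \<in> FF \<Longrightarrow> Nm (x powi e) = Nm x powi e"
  by (simp add: power_int_def Nm_power Nm_inverse FF.power FF_inverse)

lemma inj_conj_z: "inj_on (\<lambda>i. z ^ (g ^ i)) {..<n}"
proof -
  have *: "i = j" if "i \<le> j" "j < n" and eq: "z ^ (g ^ i) = z ^ (g ^ j)" for i j
  proof -
    have "(sig ^^ (n - i)) ((sig ^^ i) z) = (sig ^^ (n - i)) ((sig ^^ j) z)" using eq by (simp add: sigk_z)
    then have "(sig ^^ n) z = (sig ^^ (n + (j - i))) z"
      using that by (simp add: funpow_add[symmetric, unfolded comp_def fun_eq_iff, rule_format])
    then have "z = (sig ^^ (j - i)) ((sig ^^ n) z)"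
      by (metis FF_z add.commute comp_apply funpow_add sig_n)
    then have "z = (sig ^^ (j - i)) z" by (simp only: sig_n[OF FF_z])
    then have "z = z ^ (g ^ (j - i))" unfolding sigk_z .
    then show "i = j" using z_pow_g_neq[of "j - i"] that by (cases "i < j") (auto simp: less_imp_diff_less)
  qed
  show ?thesis
  proof (rule inj_onI)
    fix i j assume "i \<in> {..<n}" "j \<in> {..<n}" "z ^ (g ^ i) = z ^ (g ^ j)"
    then show "i = j" using *[of i j] *[of j i] by (cases "i \<le> j") auto
  qed
qed

text \<open>Both sides are monic of degree \<open>n\<close>; a nonzero difference would have smaller
  degree, yet all \<open>n\<close> conjugates of \<open>z\<close> as roots.\<close>

lemma cyc_poly_split: "of_int_poly (cyc_poly p r) = (\<Prod>i<n. [:- (z ^ (g ^ i)), 1:])"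
proof (rule ccontr)
  let ?c = "of_int_poly (cyc_poly p r) :: complex poly" and ?d = "\<Prod>i<n. [:- (z ^ (g ^ i)), 1:]"
  assume neq: "?c \<noteq> ?d"
  have dc: "degree ?c = n" "lead_coeff ?c = 1" using deg_cyc by simp_all
  have dd: "degree ?d = n" by (subst degree_prod_eq_sum_degree) auto
  have ld: "lead_coeff ?d = 1" by (simp add: lead_coeff_prod)
  have "coeff (?c - ?d) n = 0" using dc dd ld by simp
  moreover have "degree (?c - ?d) \<le> n" using degree_diff_le_max[of ?c ?d] dc dd by simp
  ultimately have deg: "degree (?c - ?d) < n"
    using neq by (metis leading_coeff_0_iff le_neq_implies_less right_minus_eq)
  have "(\<lambda>i. z ^ (g ^ i)) ` {..<n} \<subseteq> {x. poly (?c - ?d) x = 0}"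
  proof clarify
    fix i assume i: "i < n"
    have "ipoly (cyc_poly p r) (z ^ (g ^ i)) = 0"
      using coprime_g by (subst ipoly_conj_eq_0_iff) auto
    moreover have "poly ?d (z ^ (g ^ i)) = 0" using i by (auto simp: poly_prod)
    ultimately show "poly (?c - ?d) (z ^ (g ^ i)) = 0" by simp
  qed
  then have "card ((\<lambda>i. z ^ (g ^ i)) ` {..<n}) \<le> card {x. poly (?c - ?d) x = 0}"
    using neq by (intro card_mono poly_roots_finite) auto
  also have "\<dots> \<le> degree (?c - ?d)" using neq by (intro card_poly_roots_bound) auto
  finally show False using deg by (simp add: card_image inj_conj_z)
qed

text \<open>The norm is the cyclotomic polynomial at 1. Powers of \<open>1 - z\<close> will remove
  powers of \<open>p\<close> from norms without changing valuations above \<open>N\<close>.\<close>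

lemma Nm_one_minus_z: "Nm (1 - z) = of_nat p"
proof -
  have "(sig ^^ i) (1 - z) = 1 - z ^ (g ^ i)" for i
    using sigk_ipoly[of i "[:1, -1:]"] by simp
  then have "Nm (1 - z) = poly (\<Prod>i<n. [:- (z ^ (g ^ i)), 1:]) 1" by (simp add: Nm_def poly_prod)
  also have "\<dots> = of_int (poly (cyc_poly p r) 1)" by (simp flip: cyc_poly_split)
  also have "poly (cyc_poly p r) 1 = int p" by (simp add: cyc_poly_def poly_sum poly_monom)
  finally show ?thesis by simp
qed

end

context cyclotomic_prime
begin

lemma p_nz [simp]: "complex_of_nat p \<noteq> 0" by simp

lemma vv_powi: assumes "x \<in> FF" "x \<noteq> 0" shows "vv (x powi e) = e * vv x"
  using assms by (simp add: power_int_def vv_power vv_inverse FF_inverse)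

lemma vv_p: "vv (of_nat p) = 0"
  using vv_of_int[of "int p"] N N_neq_p p by (simp add: primes_dvd_imp_eq) (metis primes_dvd_imp_eq)

text \<open>The ring \<open>\<int>[z]\<close> with \<open>p\<close> and \<open>N\<close> inverted;
  \<open>UU\<close> is its unit group. Inverting \<open>N\<close> leaves the valuations above
  \<open>N\<close> free, and inverting \<open>p\<close> makes \<open>1 - z\<close> and
  \<open>q\<close> units, so that the ramified prime is no obstruction in
  \<open>genus\<close>.\<close>

definition AA :: "complex set" where "AA = {x. \<exists>k. of_nat (p * N) ^ k * x \<in> Zz}"
definition UU :: "complex set" where "UU = {x. x \<noteq> 0 \<and> x \<in> AA \<and> inverse x \<in> AA}"

lemma AAI: "of_nat (p * N) ^ k * x \<in> Zz \<Longrightarrow> x \<in> AA" by (auto simp: AA_def)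

lemma Zz_AA: "x \<in> Zz \<Longrightarrow> x \<in> AA" using AAI[of 0] by simp

lemma AA_FF: "x \<in> AA \<Longrightarrow> x \<in> FF"
  using N_gt_1 p_gt_1 by (auto simp: AA_def intro!: FFI[of "int (p * N) ^ _"])

lemma AA_mult: assumes "x \<in> AA" "y \<in> AA" shows "x * y \<in> AA"
proof -
  obtain k l where "of_nat (p * N) ^ k * x \<in> Zz" "of_nat (p * N) ^ l * y \<in> Zz" using assms by (auto simp: AA_def)
  then have "(of_nat (p * N) ^ k * x) * (of_nat (p * N) ^ l * y) \<in> Zz" by (rule Zz_mult)
  then show ?thesis by (intro AAI[of "k + l"]) (simp add: power_add mult_ac)
qed

lemma AA_add: assumes "x \<in> AA" "y \<in> AA" shows "x + y \<in> AA"
proof -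
  obtain k l where kl: "of_nat (p * N) ^ k * x \<in> Zz" "of_nat (p * N) ^ l * y \<in> Zz"
    using assms by (auto simp: AA_def)
  have "of_nat (p * N) ^ l * (of_nat (p * N) ^ k * x) + of_nat (p * N) ^ k * (of_nat (p * N) ^ l * y) \<in> Zz"
    by (intro Zz.add Zz_mult[OF Zz.power[OF Zz.of_nat]] kl)
  then show ?thesis by (intro AAI[of "k + l"]) (simp add: power_add algebra_simps)
qed

lemma AA_diff: "x \<in> AA \<Longrightarrow> y \<in> AA \<Longrightarrow> x - y \<in> AA"
  using AA_add[of x "of_int (- 1) * y"] AA_mult[OF Zz_AA[OF Zz.of_int], of y "- 1"] by simp

sublocale AA: number_ring AA
  by unfold_locales (auto intro: AA_diff AA_mult Zz_AA)

lemma AA_sig: assumes "x \<in> AA" shows "sig x \<in> AA"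
proof -
  obtain k where k: "of_nat (p * N) ^ k * x \<in> Zz" using assms by (auto simp: AA_def)
  have "sig (of_nat (p * N) ^ k * x) = of_nat (p * N) ^ k * sig x"
    using AA_FF[OF assms] by (subst sig_mult) (auto simp: sig_power FF.power FF_mult sig_mult)
  then show ?thesis using sig_Zz[OF k] by (intro AAI[of k]) simp
qed

lemma AA_sigk: "x \<in> AA \<Longrightarrow> (sig ^^ k) x \<in> AA" by (induction k) (auto intro: AA_sig)

lemma AA_inverse_p: "inverse (of_nat p) \<in> AA" by (rule AAI[of 1]) (simp add: field_simps)
lemma AA_inverse_N: "inverse (of_nat N) \<in> AA" by (rule AAI[of 1]) (simp add: field_simps)

lemma UU_FF: "x \<in> UU \<Longrightarrow> x \<in> FF" and UU_nz: "x \<in> UU \<Longrightarrow> x \<noteq> 0" and UU_AA: "x \<in> UU \<Longrightarrow> x \<in> AA"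
  by (auto simp: UU_def AA_FF)
lemma UU_mult: "x \<in> UU \<Longrightarrow> y \<in> UU \<Longrightarrow> x * y \<in> UU" by (auto simp: UU_def AA_mult)
lemma UU_inverse: "x \<in> UU \<Longrightarrow> inverse x \<in> UU" by (auto simp: UU_def)
lemma UU_power: "x \<in> UU \<Longrightarrow> x ^ k \<in> UU" by (auto simp: UU_def AA.power simp flip: power_inverse)
lemma UU_powi: "x \<in> UU \<Longrightarrow> x powi e \<in> UU" by (simp add: power_int_def UU_power UU_inverse)
lemma UU_N: "of_nat N \<in> UU" using AA_inverse_N by (auto simp: UU_def Zz_AA)



lemma UU_one_minus_z: "1 - z \<in> UU"
proof -
  have 1: "1 - z \<in> Zz" by (intro Zz_diff) auto
  obtain y where y: "y \<in> Zz" "of_nat p = (1 - z) * y"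
    using Nm_cofactor[OF 1] by (auto simp: Nm_one_minus_z)
  then have "1 - z \<noteq> 0" using p_nz by (metis mult_zero_left)
  then have "inverse (1 - z) = inverse (of_nat p) * y" using y(2) p_nz by (simp add: field_simps)
  also have "\<dots> \<in> AA" using y by (intro AA_mult AA_inverse_p Zz_AA)
  finally show ?thesis using 1 \<open>1 - z \<noteq> 0\<close> by (simp add: UU_def Zz_AA)
qed

lemma vv_sigk_one_minus_z: "vv ((sig ^^ i) (1 - z)) = 0"
proof -
  have 1: "1 - z \<in> Zz" by (intro Zz_diff) auto
  obtain y where y: "y \<in> Zz" "of_nat p = (1 - z) * y"
    using Nm_cofactor[OF 1] by (auto simp: Nm_one_minus_z)
  have "of_nat p = (sig ^^ i) (1 - z) * (sig ^^ i) y"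
    using arg_cong[OF y(2), of "sig ^^ i"] 1 y(1) by (simp add: sigk_mult Zz_FF)
  moreover from this have nz: "(sig ^^ i) (1 - z) \<noteq> 0" "(sig ^^ i) y \<noteq> 0" using p_nz by auto
  ultimately have "0 = vv ((sig ^^ i) (1 - z)) + vv ((sig ^^ i) y)"
    using 1 y vv_p by (metis vv_mult Zz_FF sigk_FF)
  moreover have "0 \<le> vv ((sig ^^ i) (1 - z))" "0 \<le> vv ((sig ^^ i) y)"
    using nz 1 y by (auto intro!: vv_Zz_nonneg sigk_Zz)
  ultimately show ?thesis by simp
qed


definition MM :: "complex \<Rightarrow> int" where "MM x = (\<Sum>i<n. vv ((sig ^^ i) x))"

lemma vv_Nm: "x \<in> FF \<Longrightarrow> x \<noteq> 0 \<Longrightarrow> vv (Nm x) = MM x"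
  unfolding Nm_def MM_def by (intro vv_prod) (auto simp: sigk_FF sigk_eq_0_iff)

lemma dvd_prime_product:
  fixes A :: int
  assumes "A dvd int (p * N) ^ k" shows "\<exists>a b. \<bar>A\<bar> = int p ^ a * int N ^ b"
proof -
  have "nat \<bar>A\<bar> dvd p ^ k * N ^ k"
    using assms by (metis nat_abs_dvd_iff nat_int of_nat_power power_mult_distrib int_dvd_int_iff int_nat_eq abs_ge_zero dvd_abs_iff abs_dvd_iff)
  then obtain b c where "nat \<bar>A\<bar> = b * c" "b dvd p ^ k" "c dvd N ^ k" using division_decomp by blast
  moreover obtain i where "b = p ^ i" using calculation divides_primepow_nat[OF p] by blast
  moreover obtain j where "c = N ^ j" using calculation divides_primepow_nat[OF N] by blast
  ultimately have "\<bar>A\<bar> = int p ^ i * int N ^ j" by (metis abs_ge_zero int_nat_eq of_nat_mult of_nat_power)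
  then show ?thesis by blast
qed

text \<open>The norms of \<open>x\<close> and of its inverse become integers after multiplication by
  powers of \<open>p * N\<close>, and the product of these integers is such a power too. This
  determines \<open>Nm x\<close> up to sign. The square removes the sign, and the factor 2 in the
  exponents is harmless later on, when \<open>p\<close> is odd.\<close>

lemma Nm_UU_square:
  assumes "x \<in> UU" obtains a where "Nm x ^ 2 = of_nat p powi a * of_nat N powi (2 * MM x)"
proof -
  have int: "\<exists>k A. of_nat (p * N) ^ k * Nm y = of_int A" if y: "y \<in> AA" for y
  proof -
    have "Nm y \<in> AA" unfolding Nm_def using y by (intro AA.prod AA_sigk)
    then obtain k where k: "of_nat (p * N) ^ k * Nm y \<in> Zz" by (auto simp: AA_def)
    have "sig (of_nat (p * N) ^ k * Nm y) = of_nat (p * N) ^ k * Nm y"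
      using AA_FF[OF y] by (subst sig_mult) (auto simp: sig_power FF.power FF_mult sig_mult Nm_FF sig_Nm)
    then have "of_nat (p * N) ^ k * Nm y \<in> \<int>" using k by (intro fixed_integral)
    then show ?thesis by (metis Ints_cases)
  qed
  have xF: "x \<in> FF" "x \<noteq> 0" using assms by (auto simp: UU_FF UU_nz)
  obtain k A where A: "of_nat (p * N) ^ k * Nm x = of_int A" using int UU_AA assms by blast
  obtain l B where B: "of_nat (p * N) ^ l * Nm (inverse x) = of_int B" using int UU_AA UU_inverse assms by blast
  have nz: "Nm x \<noteq> 0" using xF by (simp add: Nm_eq_0_iff)
  have "of_int (A * B) = (of_nat (p * N) ^ k * Nm x) * (of_nat (p * N) ^ l * Nm (inverse x))"
    by (simp only: A B of_int_mult)
  also have "\<dots> = of_nat (p * N) ^ (k + l)"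
    using nz xF by (simp add: Nm_inverse power_add)
  finally have "complex_of_int (A * B) = of_int (int (p * N) ^ (k + l))" by simp
  then have "A * B = int (p * N) ^ (k + l)" by (simp only: of_int_eq_iff)
  then have "A dvd int (p * N) ^ (k + l)" by (metis dvd_triv_left)
  then obtain a b where ab: "\<bar>A\<bar> = int p ^ a * int N ^ b" using dvd_prime_product by blast
  have "(of_int A)\<^sup>2 = complex_of_int (\<bar>A\<bar>\<^sup>2)" by simp
  then have A2: "(of_int A)\<^sup>2 = (complex_of_nat p ^ a * of_nat N ^ b)\<^sup>2" unfolding ab by simp
  have eq: "Nm x ^ 2 = of_nat p powi (2 * int a - 2 * int k) * of_nat N powi (2 * int b - 2 * int k)"
  proof -
    have "Nm x = of_int A / of_nat (p * N) ^ k" using A N_gt_1 p_gt_1 by (simp add: field_simps)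
    then have "Nm x ^ 2 = (of_nat p ^ a * of_nat N ^ b)\<^sup>2 / (of_nat (p * N) ^ k)\<^sup>2"
      by (simp add: power_divide A2)
    also have "\<dots> = (of_nat p ^ (2 * a) / of_nat p ^ (2 * k)) * (of_nat N ^ (2 * b) / of_nat N ^ (2 * k))"
      by (simp add: power_mult_distrib power_even_eq)
    also have "\<dots> = of_nat p powi (2 * int a - 2 * int k) * of_nat N powi (2 * int b - 2 * int k)"
    proof -
      have "(y::complex) ^ (2 * i) / y ^ (2 * j) = y powi (2 * int i - 2 * int j)" if "y \<noteq> 0" for y i j
        using that power_int_diff[of y "int (2 * i)" "int (2 * j)"] by (simp del: of_nat_mult) (simp add: algebra_simps)
      note this[OF p_nz] this[OF N_nz(1)]
      then show ?thesis by (simp only:)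
    qed
    finally show ?thesis .
  qed
  have "2 * vv (Nm x) = vv (Nm x ^ 2)" using nz xF by (simp add: vv_power Nm_FF)
  also have "\<dots> = 2 * int b - 2 * int k" unfolding eq
    by (subst vv_mult) (auto simp: FF_powi vv_powi vv_p vv_N)
  finally have "2 * int b - 2 * int k = 2 * MM x" using xF by (simp add: vv_Nm)
  then show ?thesis using that eq by metis
qed

text \<open>Genus theory: an ambiguous principal divisor is principal for a rational reason. The ideal
  generated by a primitive solution of Hilbert 90 is Galois stable, hence contains all the traces
  \<open>Tr (x * z ^ (- j))\<close>; these generate an integer dividing \<open>q\<close>.\<close>

lemma genus:
  assumes c: "c \<in> UU" "Nm c = 1"
  obtains e where "e \<in> UU" "sig e = c * e"
proof -
  obtain e0 where e0: "e0 \<in> FF" "e0 \<noteq> 0" "sig e0 = c * e0" using hilbert90 c UU_FF by metis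
  obtain d0 f0 where d0: "d0 \<noteq> 0" "of_int d0 * e0 = ipoly f0 z" using e0 by (auto elim: FFE)
  obtain f where f: "\<forall>i\<ge>n. coeff f i = 0" "of_int d0 * e0 = ipoly f z"
    using ZzE_reduced[OF ZzI[of f0]] d0 by metis
  have "f \<noteq> 0" using f(2) d0 e0 by auto
  \<comment> \<open>Primitivity is arranged so that contents can be compared at the end.\<close>
  define h where "h = primitive_part f"
  define x where "x = ipoly h z"
  have cf: "content f \<noteq> 0" using \<open>f \<noteq> 0\<close> by simp
  have fh: "f = smult (content f) h" by (simp add: h_def)
  have h_red: "\<forall>i\<ge>n. coeff h i = 0"
  proof (intro allI impI)
    fix i assume "n \<le> i"
    then have "content f * coeff h i = 0" using f(1) fh by (metis coeff_smult)
    then show "coeff h i = 0" using cf by simp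
  qed
  have ch: "content h = 1" using \<open>f \<noteq> 0\<close> by (simp add: h_def)
  have "ipoly f z = of_int (content f) * x" unfolding x_def by (subst fh) simp
  then have x_e0: "x = (of_int d0 / of_int (content f)) * e0" using f(2) cf by (simp add: field_simps)
  have xZ: "x \<in> Zz" by (simp add: x_def ZzI)
  have xF: "x \<in> FF" using xZ by (rule Zz_FF)
  have x0: "x \<noteq> 0" unfolding x_e0 using d0(1) e0(2) cf by simp
  have sx: "sig x = c * x"
  proof -
    have eq: "of_int (content f) * x = of_int d0 * e0" using x_e0 cf by simp
    have "of_int (content f) * sig x = sig (of_int (content f) * x)" using xF by (simp add: sig_mult)
    also have "\<dots> = of_int d0 * (c * e0)" unfolding eq using e0 by (simp add: sig_mult)
    also have "\<dots> = of_int (content f) * (c * x)" using eq by (metis mult.left_commute)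
    finally show ?thesis using cf by simp
  qed
  have sigx: "\<exists>a\<in>AA. (sig ^^ i) x = a * x" for i
  proof (induction i)
    case 0 show ?case by (intro bexI[of _ 1]) (auto intro: Zz_AA)
  next
    case (Suc i)
    then obtain a where a: "a \<in> AA" "(sig ^^ i) x = a * x" by blast
    then have "(sig ^^ Suc i) x = (sig a * c) * x" using xF by (simp add: sig_mult AA_FF sx)
    then show ?case using a c by (intro bexI[of _ "sig a * c"]) (auto intro: AA_mult AA_sig UU_AA)
  qed
  \<comment> \<open>The integers divisible by \<open>x\<close> in \<open>AA\<close>. All conjugates
    of \<open>x\<close> are multiples of \<open>x\<close> there, which puts the traces into
    \<open>I\<close>.\<close>
  define I where "I = {k :: int. of_int k / x \<in> AA}"
  have TI: "\<exists>t\<in>I. of_int t = Tr (x * inverse z ^ j)" for j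
  proof -
    have wZ: "x * inverse z ^ j \<in> Zz" using xZ by (intro Zz_mult Zz.power) auto
    obtain t where t: "of_int t = Tr (x * inverse z ^ j)" using Tr_Ints[OF wZ] by (metis Ints_cases)
    have "of_int t / x = (\<Sum>i<n. (sig ^^ i) x / x * (sig ^^ i) (inverse z ^ j))"
      unfolding t Tr_def sum_divide_distrib using xF
      by (intro sum.cong refl) (simp add: sigk_mult FF.power)
    also have "\<dots> \<in> AA"
    proof (intro AA.sum AA_mult)
      fix i show "(sig ^^ i) x / x \<in> AA" using sigx[of i] x0 by auto
      show "(sig ^^ i) (inverse z ^ j) \<in> AA" by (intro Zz_AA sigk_Zz Zz.power) simp
    qed
    finally have "t \<in> I" by (simp add: I_def)
    then show ?thesis using t by blast
  qed
  have I_diff: "a - b * k \<in> I" if "a \<in> I" "b \<in> I" for a b k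
  proof -
    have "of_int (a - b * k) / x = of_int a / x + of_int (- k) * (of_int b / x)"
      using x0 by (simp add: field_simps)
    also have "\<dots> \<in> AA"
      using that unfolding I_def by (intro AA_add AA_mult[OF Zz_AA[OF Zz.of_int]]) auto
    finally show ?thesis by (simp add: I_def)
  qed
  obtain y D where y: "y \<in> Zz" "D \<noteq> 0" "x * y = of_int D" using Zz_cofactor xZ x0 by blast
  have "of_int D / x = y" "of_int (- D) / x = - y" using y x0 by (simp_all add: field_simps flip: y(3))
  then have DI: "\<bar>D\<bar> \<in> I" using y unfolding I_def by (auto simp: abs_if intro: Zz_AA Zz.minus)
  define m where "m = (LEAST m. 0 < m \<and> int m \<in> I)"
  have "0 < nat \<bar>D\<bar> \<and> int (nat \<bar>D\<bar>) \<in> I" using DI y by simp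
  then have m: "0 < m \<and> int m \<in> I" unfolding m_def by (rule LeastI)
  have m_least: "m \<le> k" if "0 < k" "int k \<in> I" for k unfolding m_def using that by (intro Least_le) simp
  have m_dvd: "int m dvd t" if "t \<in> I" for t
  proof -
    have "t mod int m = t - int m * (t div int m)" by (simp add: minus_mult_div_eq_mod)
    then have 1: "t mod int m \<in> I" using I_diff that m by simp
    have 2: "0 \<le> t mod int m" "t mod int m < int m" using m by auto
    have "t mod int m = 0"
    proof (rule ccontr)
      assume "t mod int m \<noteq> 0"
      then have "m \<le> nat (t mod int m)" using 1 2 by (intro m_least) auto
      then show False using 2 by linarith
    qed
    then show ?thesis by auto
  qed
  have "\<exists>s. of_int (int m * s) = Tr (x * inverse z ^ j)" for j
    using TI[of j] m_dvd by (metis dvdE)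
  then obtain s where s: "\<And>j. of_int (int m * s j) = Tr (x * inverse z ^ j)" by metis
  have "of_nat m * (\<Sum>j<q. of_int (s j) * z ^ j) = of_nat q * x"
    unfolding trace_inversion[OF xF, symmetric] s[symmetric] by (simp add: sum_distrib_left mult_ac)
  moreover have "(\<Sum>j<q. of_int (s j) * z ^ j) \<in> Zz" by (intro Zz.sum Zz_mult Zz.power) auto
  then obtain k where k: "\<forall>i\<ge>n. coeff k i = 0" "(\<Sum>j<q. of_int (s j) * z ^ j) = ipoly k z"
    by (rule ZzE_reduced)
  ultimately have "ipoly (smult (int m) k - smult (int q) h) z = 0" by (simp add: x_def)
  then have "smult (int m) k - smult (int q) h = 0" using k h_red by (intro ipoly_inj) auto
  then have "content (smult (int q) h) = content (smult (int m) k)" by simp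
  \<comment> \<open>By \<open>trace_inversion\<close>, \<open>q * h\<close> equals
    \<open>m * k\<close>; as \<open>h\<close> has content 1, \<open>m\<close> divides
    \<open>q\<close>. Hence \<open>x\<close> divides \<open>q\<close> in \<open>AA\<close>, where
    \<open>q\<close> is a unit.\<close>
  then have "int q = int m * content k" using ch by simp
  then have "complex_of_int (int q) = of_int (int m * content k)" by (simp only:)
  then have "of_nat q / x = of_int (content k) * (of_int (int m) / x)" by simp
  also have "\<dots> \<in> AA" using m unfolding I_def by (intro AA_mult[OF Zz_AA[OF Zz.of_int]]) blast
  finally have "inverse (of_nat p) ^ r * (of_nat q / x) \<in> AA" by (intro AA_mult AA.power AA_inverse_p)
  then have "inverse x \<in> AA" by (simp add: field_simps)
  then have "x \<in> UU" using xZ x0 by (auto simp: UU_def Zz_AA)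
  then show ?thesis using sx by (rule that)
qed

end

section \<open>A split prime is a norm from the subfield of prime degree\<close>

context cyclotomic_prime
begin

lemma norm_z_power: "norm (z ^ k) = 1"
proof -
  have "norm z ^ q = 1" by (metis norm_one norm_power z_pow_q)
  then have "norm z = 1" using power_eq_imp_eq_base[of "norm z" q 1] q_gt_1 by simp
  then show ?thesis by (simp add: norm_power)
qed

text \<open>Dirichlet's box principle: the \<open>(N ^ l + 1) ^ n\<close> integer combinations with coefficients in
  \<open>{0..N ^ l}\<close> fall into \<open>N ^ (n * l)\<close> residue classes.\<close>

lemma ex_small_element:
  obtains f c where "\<forall>i\<ge>n. coeff f i = 0" "c \<noteq> 0" "\<bar>c\<bar> \<le> int n ^ n"
    "Nm (ipoly f z) = of_int (int N ^ (n * l) * c)" "int (n * l) \<le> vv (ipoly f z)"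
proof -
  define Box where "Box = PiE {..<n} (\<lambda>_. {0..int N ^ l})"
  define P where "P a = (\<Sum>i<n. monom (a i) i)" for a :: "nat \<Rightarrow> int"
  have cP: "coeff (P a) i = (if i < n then a i else 0)" for a i
    by (simp add: P_def coeff_sum)
  have finX: "finite Box" unfolding Box_def by (intro finite_PiE) auto
  have "card Box = nat (int N ^ l + 1) ^ n" by (simp add: Box_def card_PiE)
  also have "nat (int N ^ l + 1) = N ^ l + 1" by (simp add: nat_add_distrib nat_power_eq)
  also have "(N ^ l + 1) ^ n > (N ^ l) ^ n" using n_pos by (intro power_strict_mono) auto
  finally have cardX: "N ^ (n * l) < card Box" by (simp add: power_mult[symmetric] mult.commute)
  have "\<exists>t. t < N ^ (n * l) \<and> (ipoly (P a) z - of_nat t) / of_nat N ^ (n * l) \<in> Ov" for a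
    by (rule Ov_residue_power) (intro Zz_Ov ZzI)
  then obtain t where t: "\<And>a. t a < N ^ (n * l)" "\<And>a. (ipoly (P a) z - of_nat (t a)) / of_nat N ^ (n * l) \<in> Ov"
    by metis
  have "\<not> inj_on t Box"
  proof
    assume "inj_on t Box"
    then have "card Box \<le> card {..<N ^ (n * l)}" using t(1) by (intro card_inj_on_le) auto
    then show False using cardX by simp
  qed
  then obtain a b where ab: "a \<in> Box" "b \<in> Box" "a \<noteq> b" "t a = t b" by (auto simp: inj_on_def)
  define f where "f = P a - P b"
  define x where "x = ipoly f z"
  have cf: "coeff f i = (if i < n then a i - b i else 0)" for i by (simp add: f_def cP)
  have f_red: "\<forall>i\<ge>n. coeff f i = 0" by (simp add: cf)
  obtain i where "i < n" "a i \<noteq> b i"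
    using ab PiE_ext[of a "{..<n}" "\<lambda>_. {0..int N ^ l}" b]
    unfolding Box_def by blast
  then have "f \<noteq> 0" using cf[of i] by auto
  then have x0: "x \<noteq> 0" using ipoly_inj[of f] f_red by (auto simp: x_def)
  have xZ: "x \<in> Zz" by (simp add: x_def ZzI)
  have xF: "x \<in> FF" using xZ by (rule Zz_FF)
  have "x / of_nat N ^ (n * l) = (ipoly (P a) z - of_nat (t a)) / of_nat N ^ (n * l)
      - (ipoly (P b) z - of_nat (t b)) / of_nat N ^ (n * l)"
    using ab(4) by (simp add: x_def f_def diff_divide_distrib)
  also have "\<dots> \<in> Ov" using t(2) by (intro Ov_diff) auto
  finally have vx: "int (n * l) \<le> vv x" using vv_ge_iff[OF xF x0] by blast
  \<comment> \<open>The norm is therefore at most \<open>n ^ n * N ^ (n * l)\<close> in absolute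
    value. As it is divisible by \<open>N ^ (n * l)\<close>, the cofactor is bounded independently
    of \<open>l\<close>.\<close>
  have bound: "norm ((sig ^^ k) x) \<le> real n * real N ^ l" for k
  proof -
    have "(sig ^^ k) x = (\<Sum>i<n. of_int (coeff f i) * (z ^ (g ^ k)) ^ i)"
      unfolding x_def sigk_ipoly using f_red by (intro ipoly_altdef) auto
    also have "norm \<dots> \<le> (\<Sum>i<n. real N ^ l)"
    proof (rule sum_norm_le)
      fix i assume "i \<in> {..<n}"
      then have "0 \<le> a i" "a i \<le> int N ^ l" "0 \<le> b i" "b i \<le> int N ^ l"
        using ab by (auto simp: Box_def PiE_def Pi_def)
      then have "\<bar>a i - b i\<bar> \<le> int N ^ l" by linarith
      then have "\<bar>coeff f i\<bar> \<le> int N ^ l" by (simp add: cf)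
      then have "real_of_int \<bar>coeff f i\<bar> \<le> of_int (int N ^ l)" by (simp only: of_int_le_iff)
      then show "norm (of_int (coeff f i) * (z ^ (g ^ k)) ^ i) \<le> real N ^ l"
        by (simp add: norm_mult norm_z_power flip: power_mult)
    qed
    finally show ?thesis by simp
  qed
  obtain K where K: "Nm x = of_int K" using Nm_Ints[OF xZ] by (metis Ints_cases)
  have K0: "K \<noteq> 0" using K x0 xF Nm_eq_0_iff[of x] by auto
  have "\<bar>real_of_int K\<bar> = norm (Nm x)" unfolding K by simp
  also have "\<dots> = (\<Prod>k<n. norm ((sig ^^ k) x))" by (simp add: Nm_def prod_norm)
  also have "\<dots> \<le> (\<Prod>k<n. real n * real N ^ l)" using bound by (intro prod_mono) auto
  also have "\<dots> = of_int (int n ^ n * int N ^ (n * l))"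
    by (simp add: power_mult_distrib power_mult[symmetric] mult.commute)
  finally have "real_of_int \<bar>K\<bar> \<le> of_int (int n ^ n * int N ^ (n * l))" by simp
  then have Kb: "\<bar>K\<bar> \<le> int n ^ n * int N ^ (n * l)" by (simp only: of_int_le_iff)
  \<comment> \<open>The conjugates of \<open>x\<close> have nonnegative valuation, so the valuation
    of the norm is at least that of \<open>x\<close>.\<close>
  have "vv x \<le> (\<Sum>i<n. vv ((sig ^^ i) x))"
  proof -
    have "vv ((sig ^^ 0) x) \<le> (\<Sum>i<n. vv ((sig ^^ i) x))"
      using n_pos xZ xF x0 by (intro member_le_sum) (auto intro!: vv_Zz_nonneg sigk_Zz simp: sigk_eq_0_iff)
    then show ?thesis by simp
  qed
  also have "\<dots> = vv (of_int K)" using vv_Nm[OF xF x0] by (simp add: MM_def K)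
  also have "\<dots> = int (multiplicity (int N) K)" using K0 by (rule vv_of_int_eq)
  finally have "n * l \<le> multiplicity (int N) K" using vx by linarith
  then have "int N ^ (n * l) dvd K" by (rule multiplicity_dvd')
  then obtain c where c: "K = int N ^ (n * l) * c" by (auto simp: dvd_def)
  have pos: "0 < int N ^ (n * l)" using N_gt_1 by simp
  have "\<bar>c\<bar> \<le> int n ^ n"
    using Kb pos unfolding c abs_mult by (simp add: mult.commute)
  then show ?thesis using that[of f c] f_red K0 c K vx by (auto simp: x_def)
qed

end

locale cyclotomic_square = cyclotomic_prime p 2 g z N w for p g z N w +
  assumes odd_p: "odd p"
begin

lemma n_square: "n = p * (p - 1)" by (simp add: n_eq)

text \<open>\<open>ff x i\<close> is the valuation at the \<open>i\<close>-th conjugate of \<open>PP\<close> of the norm of \<open>x\<close> to the subfield of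
  degree \<open>p\<close>: the powers of \<open>sig\<^sup>p\<close> form the subgroup of order \<open>p - 1\<close>.\<close>

definition ff :: "complex \<Rightarrow> nat \<Rightarrow> int" where
  "ff x i = (\<Sum>j<p - 1. vv ((sig ^^ (p * j + i)) x))"

lemma ff_periodic: assumes "x \<in> FF" shows "ff x (i + p) = ff x i"
proof -
  let ?h = "\<lambda>j. vv ((sig ^^ (p * j + i)) x)"
  have "ff x (i + p) = (\<Sum>j<p - 1. ?h (Suc j))" by (simp add: ff_def add_ac)
  also have "\<dots> = (\<Sum>j<Suc (p - 1). ?h j) - ?h 0" by (subst sum.lessThan_Suc_shift) simp
  also have "\<dots> = (\<Sum>j<p - 1. ?h j) + ?h (p - 1) - ?h 0" by (simp only: sum.lessThan_Suc)
  also have "?h (p - 1) = ?h 0"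
    using sigk_mod[OF assms, of "p * (p - 1) + i"] sigk_mod[OF assms, of i] by (simp add: n_square)
  finally show ?thesis by (simp add: ff_def)
qed

lemma sum_ff: "(\<Sum>i<p. ff x i) = MM x"
proof -
  have "(\<Sum>i<p. ff x i) = (\<Sum>j<p - 1. \<Sum>i<p. vv ((sig ^^ (p * j + i)) x))"
    unfolding ff_def by (rule sum.swap)
  also have "\<dots> = (\<Sum>j<p - 1. sum (\<lambda>k. vv ((sig ^^ k) x)) {j * p..<j * p + p})"
  proof (rule sum.cong[OF refl])
    fix j
    show "(\<Sum>i<p. vv ((sig ^^ (p * j + i)) x)) = sum (\<lambda>k. vv ((sig ^^ k) x)) {j * p..<j * p + p}"
      by (rule sum.reindex_bij_witness[of _ "\<lambda>k. k - j * p" "\<lambda>i. j * p + i"]) (auto simp: mult.commute)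
  qed
  also have "\<dots> = MM x"
    unfolding MM_def n_square by (subst sum.nat_group) (simp add: mult.commute)
  finally show ?thesis .
qed

lemma ff_mult: "x \<in> FF \<Longrightarrow> x \<noteq> 0 \<Longrightarrow> y \<in> FF \<Longrightarrow> y \<noteq> 0 \<Longrightarrow> ff (x * y) i = ff x i + ff y i"
  by (simp add: ff_def sigk_mult vv_mult sigk_FF sigk_eq_0_iff sum.distrib)

lemma ff_inverse: "x \<in> FF \<Longrightarrow> x \<noteq> 0 \<Longrightarrow> ff (inverse x) i = - ff x i"
  by (simp add: ff_def sigk_inverse vv_inverse sigk_FF sigk_eq_0_iff sum_negf)

lemma ff_powi: "x \<in> FF \<Longrightarrow> x \<noteq> 0 \<Longrightarrow> ff (x powi e) i = e * ff x i"
  by (simp add: ff_def sigk_powi vv_powi sigk_FF sigk_eq_0_iff sum_distrib_left)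

lemma ff_sig: "x \<in> FF \<Longrightarrow> ff (sig x) i = ff x (Suc i)"
  by (simp add: ff_def funpow_swap1)

lemma ff_N: "ff (of_nat N) i = int (p - 1)" by (simp add: ff_def vv_N)

lemma ff_one_minus_z: "ff (1 - z) i = 0" by (simp add: ff_def vv_sigk_one_minus_z)

lemma one_minus_z: "1 - z \<in> FF" "1 - z \<noteq> 0" using UU_one_minus_z UU_FF UU_nz by blast+

text \<open>The power \<open>x ^ (2 * (p - 1))\<close>, divided by suitable powers of
  \<open>N\<close> and \<open>1 - z\<close>, has norm 1, so \<open>genus\<close> writes it as
  \<open>sig y / y\<close>, and its valuations are differences. The exponent contains
  \<open>p - 1\<close> because \<open>Nm (of_nat N)\<close> is \<open>N ^ (p * (p - 1))\<close>
  while only \<open>p\<close> is known to divide \<open>MM x\<close>.\<close>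

lemma descent_step:
  assumes x: "x \<in> UU" and M: "int p dvd MM x"
  obtains y c where "y \<in> UU" "\<And>i. int (2 * (p - 1)) * ff x i = c + fdiff (ff y) i"
proof -
  have xF: "x \<in> FF" "x \<noteq> 0" using x by (auto simp: UU_FF UU_nz)
  obtain s where s: "MM x = int p * s" using M by (auto simp: dvd_def)
  obtain a where a: "Nm x ^ 2 = of_nat p powi a * of_nat N powi (2 * MM x)" using Nm_UU_square x by blast
  define e where "e = int (p - 1)"
  define t where "t = x ^ 2"
  have tF: "t \<in> FF" "t \<noteq> 0" "t \<in> UU" using xF x by (auto simp: t_def FF.power UU_power)
  define u where "u = t powi e * (of_nat N powi (- (2 * s)) * (1 - z) powi (- (a * e)))"
  have uU: "u \<in> UU" unfolding u_def by (intro UU_mult UU_powi tF UU_N UU_one_minus_z)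
  have "Nm u = (of_nat p powi a * of_nat N powi (2 * MM x)) powi e
      * (Nm (of_nat N) powi (- (2 * s)) * of_nat p powi (- (a * e)))"
    using tF one_minus_z xF
    by (simp add: u_def Nm_mult Nm_powi FF_powi FF_mult Nm_one_minus_z t_def Nm_power flip: a)
  also have "Nm (of_nat N) = of_nat N powi (int p * e)"
    using Nm_of_int[of "int N"] by (simp add: n_square e_def flip: of_nat_mult)
  also have "(of_nat p powi a * of_nat N powi (2 * MM x)) powi e
      * ((of_nat N powi (int p * e)) powi (- (2 * s)) * of_nat p powi (- (a * e)))
    = (of_nat p powi (a * e) * of_nat p powi (- (a * e)))
      * (of_nat N powi (2 * MM x * e) * complex_of_nat N powi (int p * e * (- (2 * s))))"
    by (simp only: power_int_mult_distrib power_int_mult[symmetric] mult_ac)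
  also have "\<dots> = 1" by (simp only: power_int_add[symmetric, OF disjI1[OF p_nz]]
        N_powi_add) (simp add: s)
  finally have "Nm u = 1" .
  then obtain y where y: "y \<in> UU" "sig y = u * y" using genus uU by blast
  have uF: "u \<in> FF" "u \<noteq> 0" and yF: "y \<in> FF" "y \<noteq> 0" using uU y by (auto simp: UU_FF UU_nz)
  have "ff y (Suc i) = ff u i + ff y i" for i
    using ff_sig[OF yF(1), of i] uF yF by (simp add: y(2) ff_mult)
  moreover have "ff u i = e * (2 * ff x i) - 2 * s * e" for i
  proof -
    have "ff t i = 2 * ff x i" using xF by (simp add: t_def power2_eq_square ff_mult)
    moreover have "ff (of_nat N) i = e" by (simp add: ff_N e_def)
    ultimately show ?thesis unfolding u_def using tF one_minus_z
      by (subst ff_mult) (auto simp: FF_powi FF_mult ff_mult ff_powi ff_one_minus_z)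
  qed
  moreover have "int (2 * (p - 1)) = 2 * e" by (simp only: e_def of_nat_mult of_nat_numeral)
  ultimately have "int (2 * (p - 1)) * ff x i = 2 * s * e + fdiff (ff y) i" for i
    by (simp only:) (simp add: fdiff_def algebra_simps)
  then show ?thesis using y(1) that by blast
qed

text \<open>Constants do not accumulate: differencing the relation for the next unit removes its
  constant.\<close>

lemma descent_iterate:
  assumes all: "\<And>x. x \<in> UU \<Longrightarrow> int p dvd MM x" and x: "x \<in> UU"
  shows "\<exists>y\<in>UU. \<exists>c. \<forall>i. int (2 * (p - 1)) ^ k * ff x i = c + (fdiff ^^ k) (ff y) i"
  using x
proof (induction k arbitrary: x)
  case 0
  then show ?case by (intro bexI[of _ x] exI[of _ 0]) auto
next
  case (Suc k)
  let ?W = "int (2 * (p - 1))"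
  obtain y c where y: "y \<in> UU" "\<And>i. ?W * ff x i = c + fdiff (ff y) i"
    using descent_step[OF Suc.prems all[OF Suc.prems]] by blast
  obtain y' c' where y': "y' \<in> UU" "\<And>i. ?W ^ k * ff y i = c' + (fdiff ^^ k) (ff y') i"
    using Suc.IH[OF y(1)] by blast
  have "?W ^ Suc k * ff x i = ?W ^ k * c + (fdiff ^^ Suc k) (ff y') i" for i
  proof -
    have "?W ^ Suc k * ff x i = ?W ^ k * (?W * ff x i)" by simp
    also have "\<dots> = ?W ^ k * c + (?W ^ k * ff y (Suc i) - ?W ^ k * ff y i)"
      unfolding y(2) by (simp add: fdiff_def algebra_simps)
    also have "\<dots> = ?W ^ k * c + (fdiff ^^ Suc k) (ff y') i"
      unfolding y'(2) by (simp add: fdiff_def)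
    finally show ?thesis .
  qed
  then show ?case using y'(1) by blast
qed

text \<open>Modulo \<open>p\<close>, the \<open>p\<close>-th power of the difference operator \<open>\<sigma> - 1\<close> is \<open>\<sigma>\<^sup>p - 1 = 0\<close>, so iterating
  the descent shows that \<open>ff x\<close> is constant modulo all powers of \<open>p\<close>.\<close>

lemma ff_constant:
  assumes all: "\<And>x. x \<in> UU \<Longrightarrow> int p dvd MM x" and x: "x \<in> UU"
  shows "ff x i = ff x 0"
proof (rule ccontr)
  let ?W = "int (2 * (p - 1))" and ?d = "ff x i - ff x 0"
  assume "ff x i \<noteq> ff x 0"
  then have d: "?d \<noteq> 0" by simp
  have "coprime (int p) ?W"
  proof -
    have "coprime p 2" using odd_p by simp
    moreover have "coprime p (p - 1)" using p_gt_1 by (metis coprime_diff_one_right_nat coprime_commute p_pos(1))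
    ultimately show ?thesis by (simp only: coprime_int_iff coprime_mult_right_iff)
  qed
  then have cop: "coprime (int p ^ e) (?W ^ (p * e))" for e by simp
  have dvd: "int p ^ e dvd ?d" for e
  proof -
    obtain y c where y: "y \<in> UU" "\<And>i. ?W ^ (p * e) * ff x i = c + (fdiff ^^ (p * e)) (ff y) i"
      using descent_iterate[OF all x] by blast
    have "int p ^ e dvd (fdiff ^^ (p * e)) (ff y) j" for j
      using y(1) by (intro fdiff_prime_power_dvd p odd_p ff_periodic UU_FF)
    then have "int p ^ e dvd (fdiff ^^ (p * e)) (ff y) i - (fdiff ^^ (p * e)) (ff y) 0" by (intro dvd_diff)
    also have "\<dots> = ?W ^ (p * e) * ?d" using y(2)[of i] y(2)[of 0] by (simp add: right_diff_distrib)
    finally show ?thesis using cop by (simp add: coprime_dvd_mult_right_iff)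
  qed
  have "int p ^ nat \<bar>?d\<bar> \<le> \<bar>?d\<bar>" using dvd[of "nat \<bar>?d\<bar>"] d by (intro zdvd_imp_le) auto
  moreover have "\<bar>?d\<bar> < int p ^ nat \<bar>?d\<bar>"
  proof -
    have "nat \<bar>?d\<bar> < 2 ^ nat \<bar>?d\<bar>" by (rule less_exp)
    also have "\<dots> \<le> p ^ nat \<bar>?d\<bar>" using p_gt_1 by (intro power_mono) auto
    finally have "int (nat \<bar>?d\<bar>) < int (p ^ nat \<bar>?d\<bar>)" by (simp only: of_nat_less_iff)
    then show ?thesis by simp
  qed
  ultimately show False by simp
qed

text \<open>Two of the small elements, for levels \<open>k < l\<close>, generate the same ideal of
  \<open>AA\<close>, so their quotient is in \<open>UU\<close>. The element for \<open>l\<close> has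
  a far larger valuation at \<open>PP\<close>, while the total valuation of each norm exceeds the
  prescribed one by at most \<open>C\<close>; the other conjugates cannot catch up.\<close>

lemma ex_nonconstant:
  obtains x where "x \<in> UU" "ff x 1 \<noteq> ff x 0"
proof -
  define C where "C = int n ^ n"
  \<comment> \<open>The spacing \<open>2 * C + 1\<close> beats the error \<open>C\<close> made at
    each of the two elements.\<close>
  define L where "L k = k * nat (2 * C + 1)" for k
  have "\<exists>f c. (\<forall>i\<ge>n. coeff f i = 0) \<and> c \<noteq> 0 \<and> \<bar>c\<bar> \<le> C \<and>
    Nm (ipoly f z) = of_int (int N ^ (n * L k) * c) \<and> int (n * L k) \<le> vv (ipoly f z)" for k
    unfolding C_def using ex_small_element[of "L k"] by metis
  then obtain f c where fc: "\<And>k. \<forall>i\<ge>n. coeff (f k) i = 0" "\<And>k. c k \<noteq> 0" "\<And>k. \<bar>c k\<bar> \<le> C"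
    "\<And>k. Nm (ipoly (f k) z) = of_int (int N ^ (n * L k) * c k)"
    "\<And>k. int (n * L k) \<le> vv (ipoly (f k) z)"
    by metis
  \<comment> \<open>There are infinitely many levels but finitely many keys. Equal keys mean the
    same cofactor \<open>c\<close> and coefficients congruent modulo \<open>c\<close>.\<close>
  define key where "key k = (c k, restrict (\<lambda>i. coeff (f k) i mod c k) {..<n})" for k
  have "range key \<subseteq> {- C..C} \<times> PiE {..<n} (\<lambda>_. {- C..C})"
  proof -
    have "\<bar>coeff (f k) i mod c k\<bar> \<le> C" for k i
      using abs_mod_less[OF fc(2)[of k], of "coeff (f k) i"] fc(3)[of k] by linarith
    then have "\<bar>coeff (f k) i mod c k\<bar> \<le> C \<and> \<bar>c k\<bar> \<le> C" for k i using fc(3) by blast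
    then have "- C \<le> coeff (f k) i mod c k \<and> coeff (f k) i mod c k \<le> C \<and> - C \<le> c k \<and> c k \<le> C" for k i
      by (metis abs_le_D1 abs_le_D2 minus_le_iff)
    then have "key k \<in> {- C..C} \<times> PiE {..<n} (\<lambda>_. {- C..C})" for k
      by (simp add: key_def restrict_PiE_iff)
    then show ?thesis by blast
  qed
  then have "finite (range key)" by (rule finite_subset) (intro finite_cartesian_product finite_PiE, auto)
  then have "\<not> inj key" using finite_imageD by blast
  then obtain k1 k2 where "key k1 = key k2" "k1 \<noteq> k2" by (auto simp: inj_def)
  then obtain k l where kl: "key k = key l" "k < l" by (metis linorder_neqE_nat)
  define x where "x = ipoly (f k) z"
  define y where "y = ipoly (f l) z"
  have cc: "c l = c k" using kl by (simp add: key_def)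
  have mod: "coeff (f l) i mod c k = coeff (f k) i mod c k" if "i < n" for i
    using fun_cong[OF arg_cong[OF kl(1), of snd], of i] that cc by (simp add: key_def)
  have Nx: "Nm x = of_int (int N ^ (n * L k) * c k)" and Ny: "Nm y = of_int (int N ^ (n * L l) * c k)"
    using fc(4)[of k] fc(4)[of l] by (simp_all add: x_def y_def cc)
  have xZ: "x \<in> Zz" "y \<in> Zz" by (simp_all add: x_def y_def ZzI)
  then have xF: "x \<in> FF" "y \<in> FF" by (simp_all add: Zz_FF)
  have x0: "x \<noteq> 0" "y \<noteq> 0" using Nx Ny fc(2)[of k] Nm_eq_0_iff[OF xF(1)] Nm_eq_0_iff[OF xF(2)] by auto
  have "[:c k:] dvd f l - f k"
    using mod fc(1) unfolding const_poly_dvd_iff coeff_diff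
    by (metis dvd_0_right diff_self leI mod_eq_dvd_iff)
  then obtain h where h: "f l - f k = [:c k:] * h" by (auto simp: dvd_def)
  have "ipoly (f l - f k) z = ipoly ([:c k:] * h) z" unfolding h ..
  then have yx: "y - x = of_int (c k) * ipoly h z" by (simp add: x_def y_def)
  \<comment> \<open>Up to a power of \<open>N\<close>, the cofactor \<open>c\<close> is the norm of
    \<open>u\<close> and hence a multiple of \<open>u\<close>. As \<open>y - x\<close> is a multiple
    of \<open>c\<close>, each of \<open>x\<close> and \<open>y\<close> divides the other in
    \<open>AA\<close>.\<close>
  have div: "of_int (c k) / u \<in> AA" if u: "u \<in> Zz" "u \<noteq> 0" "Nm u = of_int (int N ^ j * c k)" for u j
  proof -
    obtain u' where u': "u' \<in> Zz" "Nm u = u * u'" using Nm_cofactor u by blast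
    then have "of_int (c k) / u = inverse (of_nat N) ^ j * u'"
      using u by (simp add: field_simps)
    also have "\<dots> \<in> AA" using u' by (intro AA_mult AA.power AA_inverse_N Zz_AA)
    finally show ?thesis .
  qed
  have 1: "y / x \<in> AA"
  proof -
    have "y / x = 1 + of_int (c k) / x * ipoly h z" using yx x0 by (simp add: field_simps)
    also have "\<dots> \<in> AA" by (intro AA_add AA_mult div[OF xZ(1) x0(1) Nx]) (auto intro: Zz_AA ZzI)
    finally show ?thesis .
  qed
  have 2: "x / y \<in> AA"
  proof -
    have "x / y = 1 + of_int (c k) / y * ipoly (- h) z" using yx x0 by (simp add: field_simps)
    also have "\<dots> \<in> AA" by (intro AA_add AA_mult div[OF xZ(2) x0(2) Ny]) (auto intro: Zz_AA ZzI simp del: ipoly_simps)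
    finally show ?thesis .
  qed
  define u where "u = y * inverse x"
  have uU: "u \<in> UU" using 1 2 x0 by (simp add: UU_def u_def field_simps)
  have ff_u: "ff u i = ff y i - ff x i" for i
    using xF x0 by (simp add: u_def ff_mult FF_inverse ff_inverse)
  have nonneg: "0 \<le> vv ((sig ^^ i) v)" if "v \<in> Zz" "v \<noteq> 0" for i v
    using that by (intro vv_Zz_nonneg sigk_Zz) (auto simp: sigk_eq_0_iff Zz_FF)
  then have ff_nonneg: "0 \<le> ff v i" if "v \<in> Zz" "v \<noteq> 0" for i v
    using that unfolding ff_def by (intro sum_nonneg) auto
  have ff_total: "ff v 0 + ff v 1 \<le> MM v" if "v \<in> Zz" "v \<noteq> 0" for v
  proof -
    have "sum (ff v) {0, 1} \<le> sum (ff v) {..<p}"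
      using p_gt_1 ff_nonneg that by (intro sum_mono2) auto
    then show ?thesis by (simp add: sum_ff)
  qed
  have MM_bound: "MM v \<le> int (n * j) + C" if v: "v \<in> FF" "v \<noteq> 0" "Nm v = of_int (int N ^ (n * j) * c k)" for v j
  proof -
    have "MM v = vv (of_nat N ^ (n * j) * of_int (c k))" using vv_Nm[OF v(1,2)] v(3) by simp
    also have "\<dots> = int (n * j) + vv (of_int (c k))"
      using fc(2) by (subst vv_mult) (auto simp: FF.power vv_power vv_N)
    also have "vv (of_int (c k)) \<le> C" using vv_le_of_int[OF fc(2)[of k]] fc(3)[of k] by linarith
    finally show ?thesis by simp
  qed
  have ff0: "int (n * L l) \<le> ff y 0"
  proof -
    have "vv ((sig ^^ (p * 0 + 0)) y) \<le> ff y 0"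
      unfolding ff_def using p_gt_1 nonneg xZ x0 by (intro member_le_sum) auto
    then show ?thesis using fc(5)[of l] by (simp add: y_def)
  qed
  have "ff y 1 \<le> C" using ff_total[OF xZ(2) x0(2)] ff0 MM_bound[OF xF(2) x0(2) Ny] by linarith
  moreover have "ff x 0 \<le> int (n * L k) + C"
    using ff_total[OF xZ(1) x0(1)] ff_nonneg[OF xZ(1) x0(1), of 1] MM_bound[OF xF(1) x0(1) Nx] by linarith
  moreover have "0 \<le> ff x 1" using ff_nonneg xZ x0 by blast
  moreover have "int (n * L k) + 2 * C < int (n * L l)"
  proof -
    have C0: "0 \<le> C" by (simp add: C_def)
    have "Suc k * nat (2 * C + 1) \<le> L l" unfolding L_def using kl(2) by (intro mult_right_mono) auto
    then have "L k + nat (2 * C + 1) \<le> L l" by (simp add: L_def)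
    then have "int (L k) + (2 * C + 1) \<le> int (L l)" using C0 by linarith
    then have "int n * (int (L k) + (2 * C + 1)) \<le> int n * int (L l)" by (intro mult_left_mono) auto
    moreover have "2 * C + 1 \<le> int n * (2 * C + 1)" using n_pos C0 by (simp add: mult_le_cancel_right1)
    ultimately show ?thesis by (simp add: distrib_left)
  qed
  ultimately have "ff u 1 < ff u 0" using ff0 unfolding ff_u by linarith
  then show ?thesis using uU that by (metis less_irrefl)
qed

text \<open>Chinese remainder theorem: the cyclic group of order \<open>p * (p - 1)\<close> is the
  product of its subgroups generated by \<open>sig ^^ p\<close> and
  \<open>sig ^^ (p - 1)\<close>.\<close>

lemma prod_subgroups:
  assumes x: "x \<in> FF"
  shows "(\<Prod>i<p. (sig ^^ ((p - 1) * i)) (\<Prod>j<p - 1. (sig ^^ (p * j)) x)) = Nm x"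
proof -
  have cop: "coprime p (p - 1)" by (metis coprime_diff_one_right_nat coprime_commute p_pos(1))
  let ?A = "{..<p} \<times> {..<p - 1}" and ?\<phi> = "\<lambda>(i, j). ((p - 1) * i + p * j) mod n"
  have inj: "inj_on ?\<phi> ?A"
  proof (rule inj_onI, clarify)
    fix i j i' j' assume b: "i < p" "j < p - 1" "i' < p" "j' < p - 1"
      and eq: "((p - 1) * i + p * j) mod n = ((p - 1) * i' + p * j') mod n"
    have c: "[(p - 1) * i + p * j = (p - 1) * i' + p * j'] (mod p * (p - 1))"
      using eq by (simp add: cong_def n_square)
    have "[(p - 1) * i + p * j = (p - 1) * i' + p * j'] (mod p)" using c by (rule cong_modulus_mult_nat)
    then have "[(p - 1) * i = (p - 1) * i'] (mod p)" by (simp add: cong_def)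
    then have "[i = i'] (mod p)" using cop by (metis cong_mult_lcancel_nat coprime_commute)
    then have i: "i = i'" using b by (simp add: cong_def)
    have "[(p - 1) * i + p * j = (p - 1) * i' + p * j'] (mod p - 1)"
      using c by (metis cong_modulus_mult_nat mult.commute)
    then have "[p * j = p * j'] (mod p - 1)" by (simp add: cong_def)
    then have "[j = j'] (mod p - 1)" using cop by (metis cong_mult_lcancel_nat coprime_commute)
    then have "j = j'" using b by (simp add: cong_def)
    then show "i = i' \<and> j = j'" using i by simp
  qed
  have "?\<phi> ` ?A = {..<n}"
  proof (rule card_subset_eq)
    show "?\<phi> ` ?A \<subseteq> {..<n}" using n_pos by auto
    show "card (?\<phi> ` ?A) = card {..<n}" using card_image[OF inj] by (simp add: n_square)
  qed simp
  then have bij: "bij_betw ?\<phi> ?A {..<n}" using inj by (rule bij_betw_imageI[rotated])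
  have "(\<Prod>i<p. (sig ^^ ((p - 1) * i)) (\<Prod>j<p - 1. (sig ^^ (p * j)) x))
      = (\<Prod>i<p. \<Prod>j<p - 1. (sig ^^ ((p - 1) * i + p * j)) x)"
    using x by (simp add: sigk_prod sigk_FF funpow_add)
  also have "\<dots> = (\<Prod>(i, j)\<in>?A. (sig ^^ ((p - 1) * i + p * j)) x)" by (rule prod.cartesian_product)
  also have "\<dots> = (\<Prod>a\<in>?A. (sig ^^ (?\<phi> a)) x)"
    by (intro prod.cong refl) (auto simp: sigk_mod[OF x])
  also have "\<dots> = Nm x" unfolding Nm_def by (rule prod.reindex_bij_betw[OF bij])
  finally show ?thesis .
qed

text \<open>The product is the norm to the fixed field of \<open>sig ^^ (p - 1)\<close>, that is, to
  \<open>K\<close>. Were all \<open>MM x\<close> divisible by \<open>p\<close>, then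
  \<open>ff_constant\<close> would contradict \<open>ex_nonconstant\<close>.\<close>

theorem N_is_norm:
  obtains y where "y \<in> FF" "y \<noteq> 0" "(\<Prod>i<p. (sig ^^ ((p - 1) * i)) y) = of_nat N"
proof -
  have "\<exists>x\<in>UU. \<not> int p dvd MM x"
    using ff_constant ex_nonconstant by metis
  then obtain x where x: "x \<in> UU" "\<not> int p dvd MM x" by blast
  have xF: "x \<in> FF" "x \<noteq> 0" using x by (auto simp: UU_FF UU_nz)
  obtain a where a: "Nm x ^ 2 = of_nat p powi a * of_nat N powi (2 * MM x)" using Nm_UU_square x by blast
  \<comment> \<open>The factor \<open>1 - z\<close> has norm \<open>p\<close> and cancels the power
    of \<open>p\<close>.\<close>
  define t where "t = x ^ 2 * (1 - z) powi (- a)"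
  have tF: "t \<in> FF" "t \<noteq> 0" using xF one_minus_z by (auto simp: t_def FF_mult FF.power FF_powi)
  have "Nm t = (of_nat p powi a * of_nat N powi (2 * MM x)) * of_nat p powi (- a)"
    using xF one_minus_z by (simp add: t_def Nm_mult FF.power FF_powi Nm_powi Nm_power Nm_one_minus_z flip: a)
  also have "\<dots> = of_nat N powi (2 * MM x)" by (simp add: power_int_minus)
  finally have Nt: "Nm t = of_nat N powi (2 * MM x)" .
  \<comment> \<open>The norm of \<open>t\<close> to the subfield of degree \<open>p\<close>; its
    norm from \<open>F\<close> to \<open>K\<close> is the full norm of \<open>t\<close>.\<close>
  define y0 where "y0 = (\<Prod>j<p - 1. (sig ^^ (p * j)) t)"
  have y0: "y0 \<in> FF" "y0 \<noteq> 0" using tF by (auto simp: y0_def FF.prod sigk_FF sigk_eq_0_iff)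
  have Ny0: "(\<Prod>i<p. (sig ^^ ((p - 1) * i)) y0) = of_nat N powi (2 * MM x)"
    unfolding y0_def Nt[symmetric] by (rule prod_subgroups[OF tF(1)])
  have "coprime (2 * MM x) (int p)"
  proof -
    have "coprime (int p) (2 * MM x)"
    proof (rule prime_imp_coprime)
      show "prime (int p)" using p by simp
      show "\<not> int p dvd 2 * MM x"
        using x(2) odd_p p by (metis coprime_dvd_mult_right_iff coprime_int_iff coprime_right_2_iff_odd of_nat_numeral)
    qed
    then show ?thesis by (simp add: coprime_commute)
  qed
  \<comment> \<open>\<open>N ^ (2 * MM x)\<close> and \<open>N ^ p\<close> are both norms, the
    second because \<open>N\<close> is rational, and their exponents are coprime.\<close>
  then obtain u v where uv: "u * (2 * MM x) + v * int p = 1" using bezout_int[of "2 * MM x" "int p"] by auto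
  define y where "y = y0 powi u * of_nat N powi v"
  have "(\<Prod>i<p. (sig ^^ ((p - 1) * i)) y)
      = (\<Prod>i<p. ((sig ^^ ((p - 1) * i)) y0) powi u * of_nat N powi v)"
    using y0 by (simp add: y_def sigk_mult FF_powi sigk_powi)
  also have "\<dots> = (\<Prod>i<p. (sig ^^ ((p - 1) * i)) y0) powi u * (of_nat N powi v) ^ p"
    by (simp add: prod.distrib power_int_def prod_power_distrib prod_inversef[unfolded comp_def, symmetric])
  also have "\<dots> = of_nat N powi (2 * MM x * u) * of_nat N powi (v * int p)"
    unfolding Ny0 by (simp add: power_int_mult)
  also have "\<dots> = of_nat N"
    unfolding N_powi_add using uv by (simp add: mult.commute)
  finally have "(\<Prod>i<p. (sig ^^ ((p - 1) * i)) y) = of_nat N" .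
  moreover have "y \<in> FF" "y \<noteq> 0" using y0 by (auto simp: y_def FF_mult FF_powi)
  ultimately show ?thesis using that by blast
qed

end

section \<open>Norms in pure extensions of prime degree\<close>

lemma prod_rotate:
  fixes F :: "nat \<Rightarrow> 'a::comm_monoid_mult"
  assumes "F m = F 0" shows "(\<Prod>i<m. F (Suc i)) = (\<Prod>i<m. F i)"
proof (cases m)
  case (Suc k)
  have "(\<Prod>i<m. F i) = F 0 * (\<Prod>i<k. F (Suc i))" unfolding Suc by (rule prod.lessThan_Suc_shift)
  then show ?thesis using assms by (simp add: Suc mult.commute)
qed simp

text \<open>\<open>no_root\<close> carries the irreducibility of \<open>X ^ p - N\<close> over
  \<open>K\<close>, in a form that a valuation can verify.\<close>

locale kummer = number_ring K for K :: "complex set" +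
  fixes p N :: nat and \<zeta> :: complex
  assumes inverse: "x \<in> K \<Longrightarrow> inverse x \<in> K"
    and prime_p: "prime p" and odd_p: "odd p" and N_pos: "0 < N"
    and root: "primitive_root_of_unity p \<zeta>" and \<zeta>_K: "\<zeta> \<in> K"
    and no_root: "\<And>c d. c \<in> K \<Longrightarrow> 0 < d \<Longrightarrow> d < p \<Longrightarrow> c ^ p \<noteq> of_nat N ^ d"
begin

lemma p_gt_1: "1 < p" by (rule prime_gt_1_nat[OF prime_p])
lemma \<zeta>_pow: "\<zeta> ^ p = 1" using root by (simp add: primitive_root_of_unity_def)
lemma \<zeta>_nz: "\<zeta> \<noteq> 0" using \<zeta>_pow p_gt_1 by (auto simp: power_0_left)

definition XN :: "complex poly" where "XN = monom 1 p - [:of_nat N:]"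

lemma poly_XN: "poly XN x = x ^ p - of_nat N" by (simp add: XN_def poly_monom)

lemma cin_XN: "cin XN" unfolding XN_def by (intro cin_diff cin_monom cin_pCons one of_nat cin_0)

lemma degree_XN: "degree XN = p" "lead_coeff XN = 1"
proof -
  have "degree [:complex_of_nat N:] < degree (monom (1::complex) p)" using p_gt_1 by (simp add: degree_monom_eq)
  then show d: "degree XN = p" unfolding XN_def diff_conv_add_uminus
    by (subst degree_add_eq_left) (auto simp: degree_monom_eq)
  show "lead_coeff XN = 1" using p_gt_1 unfolding d by (simp add: XN_def coeff_pCons split: nat.split)
qed

text \<open>The minimal polynomial of \<open>b\<close> divides \<open>X\<^sup>p - N\<close>, so its constant term is, up to sign, a product
  of \<open>d\<close> roots of \<open>X\<^sup>p - N\<close>, and its \<open>p\<close>-th power is \<open>\<plusminus>N\<^sup>d\<close>.\<close>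

lemma no_small_relation:
  assumes b: "b ^ p = of_nat N" and f: "cin f" "f \<noteq> 0" "degree f < p"
  shows "poly f b \<noteq> 0"
proof
  assume "poly f b = 0"
  let ?Q = "\<lambda>h. cin h \<and> h \<noteq> 0 \<and> poly h b = 0"
  obtain h0 where h0: "?Q h0" and min: "\<And>h. ?Q h \<Longrightarrow> degree h0 \<le> degree h"
    using ex_has_least_nat[of ?Q f degree] f \<open>poly f b = 0\<close> by blast
  define h where "h = smult (inverse (lead_coeff h0)) h0"
  have h: "cin h" "lead_coeff h = 1" "poly h b = 0" "degree h = degree h0"
    using h0 by (auto simp: h_def intro!: cin_smult inverse) (simp add: cin_def)
  obtain a c where ac: "cin a" "cin c" "XN = h * a + c" "c = 0 \<or> degree c < degree h"
    using division[OF h(1,2) cin_XN] by blast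
  have "poly c b = poly XN b - poly h b * poly a b" unfolding ac(3) by simp
  then have "poly c b = 0" using h(3) b by (simp add: poly_XN)
  then have "c = 0" using ac min[of c] h(4) by force
  then have XN: "XN = h * a" using ac by simp
  obtain A where A: "size A = degree h" "h = smult (lead_coeff h) (\<Prod>x\<in>#A. [:-x, 1:])"
    using alg_closed_imp_factorization[of h] h(2) by force
  have "x ^ p = of_nat N" if "x \<in># A" for x
  proof -
    have "[:-x, 1:] dvd (\<Prod>x\<in>#A. [:-x, 1:])" using that by (intro dvd_prod_mset) auto
    then have "[:-x, 1:] dvd h" using A(2) h(2) by simp
    then have "poly h x = 0" by (simp add: poly_eq_0_iff_dvd)
    then have "poly XN x = 0" unfolding XN by simp
    then show ?thesis by (simp add: poly_XN)
  qed
  then have "(\<Prod>x\<in>#A. - x) ^ p = (- 1) ^ (size A) * of_nat N ^ size A"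
    using odd_p by (induction A) (auto simp: power_mult_distrib)
  moreover have "coeff h 0 = (\<Prod>x\<in>#A. - x)"
  proof -
    have "coeff h 0 = poly h 0" by (simp add: poly_0_coeff_0)
    also have "\<dots> = (\<Prod>x\<in>#A. - x)"
      by (subst A(2)) (simp add: h(2) poly_prod_mset image_mset.compositionality comp_def)
    finally show ?thesis .
  qed
  ultimately have c0: "coeff h 0 ^ p = (- 1) ^ degree h * of_nat N ^ degree h" using A(1) by simp
  \<comment> \<open>As \<open>p\<close> is odd, the sign can be moved into the element of
    \<open>K\<close>.\<close>
  have "((- 1) ^ degree h * coeff h 0) ^ p = of_nat N ^ degree h"
    using odd_p by (simp add: power_mult_distrib c0 flip: power_mult)
      (simp add: power_mult mult.commute[of _ p] flip: mult.assoc power_mult_distrib)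
  moreover have "(- 1) ^ degree h * coeff h 0 \<in> K"
    using h(1) by (intro mult power minus one) (simp add: cin_def)
  moreover have "degree h < p" using min[of f] f \<open>poly f b = 0\<close> h(4) by simp
  moreover have "0 < degree h"
  proof (rule ccontr)
    assume "\<not> 0 < degree h"
    then have "degree h = 0" by simp
    then have "h = [:1:]" using h(2) by (metis degree_eq_zeroE lead_coeff_pCons(2))
    then show False using h(3) by simp
  qed
  ultimately show False using no_root by blast
qed

lemma reduction:
  assumes "cin h"
  obtains a b where "cin a" "cin b" "h = XN * a + b" "b = 0 \<or> degree b < p"
  using division[OF cin_XN degree_XN(2) assms] degree_XN(1) by auto

lemma relation_dvd:
  assumes b: "b ^ p = of_nat N" and h: "cin h" "poly h b = 0"
  obtains a where "cin a" "h = XN * a"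
proof -
  obtain a c where ac: "cin a" "cin c" "h = XN * a + c" "c = 0 \<or> degree c < p" using reduction h(1) by blast
  have "poly c b = 0" using h(2) b unfolding ac(3) by (simp add: poly_XN)
  then have "c = 0" using no_small_relation[OF b ac(2)] ac(4) by blast
  then show ?thesis using that ac by simp
qed

lemma relation_conj:
  assumes "b ^ p = of_nat N" "cin h" "poly h b = 0" "b' ^ p = of_nat N"
  shows "poly h b' = 0"
proof -
  obtain a where "h = XN * a" using relation_dvd assms by blast
  then show ?thesis using assms(4) by (simp add: poly_XN)
qed

text \<open>Attached to the polynomial rather than to its value at \<open>b\<close>, so that no
  choice is involved; by \<open>relation_conj\<close> only the value matters when the coefficients
  are in \<open>K\<close>.\<close>

definition nrm :: "complex \<Rightarrow> complex poly \<Rightarrow> complex" where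
  "nrm b f = (\<Prod>i<p. poly f (\<zeta> ^ i * b))"

lemma conj_root: "b ^ p = of_nat N \<Longrightarrow> (\<zeta> ^ i * b) ^ p = of_nat N"
  by (simp add: power_mult_distrib \<zeta>_pow flip: power_mult) (simp add: power_mult mult.commute[of i] \<zeta>_pow)

lemma prod_conj_root: assumes "b ^ p = of_nat N" shows "(\<Prod>i<p. \<zeta> ^ i * b) = of_nat N"
proof -
  have "even (p - 1)" using odd_p by simp
  then obtain k where k: "p - 1 = 2 * k" by (rule evenE)
  have "(\<Prod>i<p. \<zeta> ^ i) = \<zeta> ^ (\<Sum>i<p. i)" by (simp add: power_sum)
  also have "(\<Sum>i<p. i) = p * k" unfolding lessThan_atLeast0 Sum_Ico_nat k by simp
  finally have "(\<Prod>i<p. \<zeta> ^ i) = 1" by (simp add: power_mult \<zeta>_pow)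
  then show ?thesis using assms by (simp add: prod.distrib)
qed

text \<open>The product \<open>G\<close> of the twisted polynomials is invariant under
  \<open>X \<mapsto> \<zeta> * X\<close>, so only powers of \<open>X ^ p\<close> occur in it, and
  these become powers of \<open>N\<close> at \<open>b\<close>. The ring \<open>S\<close> is left
  open: \<open>K\<close> gives rationality of the norm, \<open>Ov\<close> its residue modulo
  \<open>N\<close>.\<close>

lemma nrm_expand:
  assumes S: "number_ring S" "\<zeta> \<in> S" and b: "b ^ p = of_nat N" and f: "\<And>i. coeff f i \<in> S"
  obtains v where "v \<in> S" "nrm b f = coeff f 0 ^ p + of_nat N * v"
proof -
  interpret S: number_ring S by fact
  define G where "G = (\<Prod>i<p. f \<circ>\<^sub>p [:0, \<zeta> ^ i:])"
  have "S.cin G" unfolding G_def using f S by (intro S.cin_prod S.cin_scale S.power) (auto simp: S.cin_def)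
  then have G_S: "coeff G i \<in> S" for i by (simp add: S.cin_def)
  have G_b: "poly G x = (\<Prod>i<p. poly f (\<zeta> ^ i * x))" for x
    by (simp add: G_def poly_prod poly_pcompose mult.commute)
  have "G \<circ>\<^sub>p [:0, \<zeta>:] = G"
  proof (rule poly_ext)
    fix x
    have "poly (G \<circ>\<^sub>p [:0, \<zeta>:]) x = (\<Prod>i<p. poly f (\<zeta> ^ Suc i * x))"
      by (simp add: poly_pcompose G_b mult_ac)
    also have "\<dots> = (\<Prod>i<p. poly f (\<zeta> ^ i * x))"
      by (rule prod_rotate) (simp add: \<zeta>_pow)
    finally show "poly (G \<circ>\<^sub>p [:0, \<zeta>:]) x = poly G x" by (simp add: G_b)
  qed
  then have "\<zeta> ^ k * coeff G k = coeff G k" for k by (metis coeff_pcompose_linear)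
  then have G0: "coeff G k = 0" if "\<not> p dvd k" for k
    using that primitive_root_power_iff[OF root, of k] by (metis mult_cancel_right2)
  define v where "v = (\<Sum>k\<in>{1..degree G}. if p dvd k then coeff G k * of_nat N ^ (k div p - 1) else 0)"
  have "poly G b = (\<Sum>k\<le>degree G. coeff G k * b ^ k)" by (rule poly_altdef)
  also have "{..degree G} = insert 0 {1..degree G}" by auto
  also have "(\<Sum>k\<in>insert 0 {1..degree G}. coeff G k * b ^ k)
      = coeff G 0 + (\<Sum>k\<in>{1..degree G}. coeff G k * b ^ k)" by simp
  also have "(\<Sum>k\<in>{1..degree G}. coeff G k * b ^ k) = of_nat N * v"
    unfolding v_def sum_distrib_left
  proof (rule sum.cong[OF refl])
    fix k assume k: "k \<in> {1..degree G}"
    show "coeff G k * b ^ k = of_nat N * (if p dvd k then coeff G k * of_nat N ^ (k div p - 1) else 0)"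
    proof (cases "p dvd k")
      case True
      then obtain j where j: "k = p * j" by (auto simp: dvd_def)
      then have "b ^ k = of_nat N ^ j" using b by (simp add: power_mult)
      moreover have "j = Suc (j - 1)" using j k p_gt_1 by (cases j) auto
      then have "complex_of_nat N ^ j = of_nat N * of_nat N ^ (j - 1)" by (metis power_Suc)
      ultimately show ?thesis using j p_gt_1 by simp
    qed (simp add: G0)
  qed
  finally have "poly G b = coeff G 0 + of_nat N * v" .
  moreover have "coeff G 0 = coeff f 0 ^ p"
    using G_b[of 0] by (simp add: poly_0_coeff_0)
  moreover have "poly G b = nrm b f" by (simp add: G_b nrm_def)
  moreover have "v \<in> S" unfolding v_def
    using G_S by (intro S.sum) (auto intro!: S.mult S.power S.of_nat simp: S.zero)
  ultimately show ?thesis using that by simp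
qed

lemma nrm_K: assumes "b ^ p = of_nat N" "cin f" shows "nrm b f \<in> K"
proof -
  obtain v where "v \<in> K" "nrm b f = coeff f 0 ^ p + of_nat N * v"
    using nrm_expand[OF number_ring_axioms \<zeta>_K assms(1), of f] assms(2) by (auto simp: cin_def)
  then show ?thesis using assms(2) by (auto simp: cin_def intro!: add mult power of_nat)
qed

definition LL :: "complex \<Rightarrow> complex set" where "LL b = {poly f b | f. cin f}"

text \<open>The product of the other conjugates is a polynomial in \<open>b\<close> over
  \<open>K\<close>, as \<open>\<zeta>\<close> lies in \<open>K\<close>; multiplied by
  \<open>x\<close> it gives the norm, which is nonzero by \<open>relation_conj\<close>.\<close>

lemma LL_inverse:
  assumes b: "b ^ p = of_nat N" and x: "x \<in> LL b" shows "inverse x \<in> LL b"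
proof (cases "x = 0")
  case False
  obtain f where f: "cin f" "x = poly f b" using x by (auto simp: LL_def)
  define h where "h = (\<Prod>i\<in>{..<p} - {0}. f \<circ>\<^sub>p [:0, \<zeta> ^ i:])"
  have h: "cin h" unfolding h_def using f by (intro cin_prod cin_scale power \<zeta>_K) auto
  have "nrm b f = poly f (\<zeta> ^ 0 * b) * (\<Prod>i\<in>{..<p} - {0}. poly f (\<zeta> ^ i * b))"
    unfolding nrm_def using p_gt_1 by (intro prod.remove) auto
  also have "\<dots> = x * poly h b" by (simp add: f h_def poly_prod poly_pcompose mult.commute)
  finally have eq: "nrm b f = x * poly h b" .
  have "poly f (\<zeta> ^ i * b) \<noteq> 0" for i
    using relation_conj[OF conj_root[OF b] f(1) _ b] False f(2) by blast
  then have "nrm b f \<noteq> 0" by (simp add: nrm_def)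
  then have "inverse x = poly (smult (inverse (nrm b f)) h) b" using eq by (simp add: field_simps)
  moreover have "cin (smult (inverse (nrm b f)) h)" using h by (intro cin_smult inverse nrm_K b f)
  ultimately show ?thesis unfolding LL_def by blast
qed (auto simp: LL_def intro!: exI[of _ 0] cin_0)

lemma LL_ring: "number_ring (LL b)"
proof
  show "1 \<in> LL b" unfolding LL_def using cin_1 by force
  show "x - y \<in> LL b" if "x \<in> LL b" "y \<in> LL b" for x y
    using that unfolding LL_def by clarify (metis (mono_tags, lifting) cin_diff poly_diff)
  show "x * y \<in> LL b" if "x \<in> LL b" "y \<in> LL b" for x y
    using that unfolding LL_def by clarify (metis (mono_tags, lifting) cin_mult poly_mult)
qed

lemma K_LL: "K \<subseteq> LL b"
proof
  fix x assume "x \<in> K"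
  then have "cin [:x:]" "poly [:x:] b = x" by (auto intro: cin_pCons cin_0)
  then show "x \<in> LL b" unfolding LL_def by (metis (mono_tags, lifting) mem_Collect_eq)
qed

lemma b_LL: "b \<in> LL b"
proof -
  have "cin [:0, 1:]" "poly [:0, 1:] b = b" by (auto intro!: cin_pCons cin_0 zero one)
  then show "b \<in> LL b" unfolding LL_def by (metis (mono_tags, lifting) mem_Collect_eq)
qed

lemma LLE_reduced:
  assumes b: "b ^ p = of_nat N" and x: "x \<in> LL b"
  obtains f where "cin f" "x = poly f b" "\<forall>i\<ge>p. coeff f i = 0"
proof -
  obtain h where h: "cin h" "x = poly h b" using x by (auto simp: LL_def)
  obtain a c where ac: "cin a" "cin c" "h = XN * a + c" "c = 0 \<or> degree c < p" using reduction h(1) by blast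
  have "x = poly c b" using b unfolding h(2) ac(3) by (simp add: poly_XN)
  moreover have "\<forall>i\<ge>p. coeff c i = 0" using ac(4) by (metis coeff_0 coeff_eq_0 order_less_le_trans)
  ultimately show ?thesis using that ac by blast
qed


end

section \<open>Generated fields, power bases and the norm as a determinant\<close>

lemma gen_field_incl: "S \<subseteq> gen_field S" by (auto simp: gen_field_def intro: generate_field.incl)

lemma type_algebra_inv:
  fixes x :: "'a::field"
  assumes "x \<noteq> 0" shows "inv\<^bsub>ring_of_type_algebra\<^esub> x = inverse x"
proof -
  interpret F: Ring.field "ring_of_type_algebra :: 'a ring" by (rule field_from_type_algebra)
  show ?thesis
    using assms by (intro F.comm_inv_char) (auto simp: ring_of_type_algebra_sel)
qed

lemma type_algebra_minus:
  fixes x :: "'a::field" shows "\<ominus>\<^bsub>ring_of_type_algebra\<^esub> x = - x"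
proof -
  interpret F: ring "ring_of_type_algebra :: 'a ring" by (rule ring_from_type_algebra)
  show ?thesis by (rule F.minus_equality) (simp_all add: ring_of_type_algebra_sel)
qed

lemma subfield_gen_field: "subfield (gen_field S) (ring_of_type_algebra :: 'a::field ring)"
proof -
  interpret F: Ring.field "ring_of_type_algebra :: 'a ring" by (rule field_from_type_algebra)
  show ?thesis unfolding gen_field_def
    by (rule F.generate_field_is_subfield) (simp add: ring_of_type_algebra_sel)
qed

lemma gen_field_inverse: assumes "x \<in> gen_field S" shows "inverse x \<in> gen_field S"
proof (cases "x = 0")
  case False
  then show ?thesis
    using generate_field.m_inv[of x ring_of_type_algebra S] assms
    by (simp add: gen_field_def ring_of_type_algebra_sel type_algebra_inv)
qed (use assms in simp)

lemma gen_field_ring: "number_ring (gen_field S)"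
  using subfield_props[OF subfield_gen_field[of S]]
  by unfold_locales (auto simp: diff_conv_add_uminus simp del: add_uminus_conv_diff)

lemma gen_field_min:
  assumes "number_ring E" "\<And>x. x \<in> E \<Longrightarrow> inverse x \<in> E" "S \<subseteq> E" shows "gen_field S \<subseteq> E"
proof
  interpret E: number_ring E by fact
  fix x assume "x \<in> gen_field S"
  then have "x \<in> generate_field ring_of_type_algebra S" by (simp add: gen_field_def)
  then show "x \<in> E"
    by (induction rule: generate_field.induct)
       (use assms in \<open>auto simp: ring_of_type_algebra_sel type_algebra_inv type_algebra_minus
          E.one E.add E.mult E.minus subset_iff\<close>)
qed

context kummer
begin

lemma gen_field_LL:
  assumes "b ^ p = of_nat N" shows "gen_field (K \<union> {b}) = LL b"
proof
  show "gen_field (K \<union> {b}) \<subseteq> LL b"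
    using LL_ring LL_inverse[OF assms] K_LL b_LL by (intro gen_field_min) auto
  show "LL b \<subseteq> gen_field (K \<union> {b})"
  proof
    interpret E: number_ring "gen_field (K \<union> {b})" by (rule gen_field_ring)
    fix x assume "x \<in> LL b"
    then obtain f where f: "cin f" "x = poly f b" by (auto simp: LL_def)
    then show "x \<in> gen_field (K \<union> {b})"
      using gen_field_incl[of "K \<union> {b}"]
      unfolding f(2) poly_altdef by (intro E.sum E.mult E.power) (auto simp: cin_def)
  qed
qed

lemma poly_of_coeffs: "coeff (\<Sum>i<m. monom (c i) i) j = (if j < m then c j else 0)"
  by (simp add: coeff_sum)

lemma basis:
  assumes sK: "subfield K ring_of_type_algebra" and b: "b ^ p = of_nat N"
  shows "is_basis K (LL b) (map (\<lambda>i. b ^ i) [0..<p])"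
proof -
  interpret F: ring "ring_of_type_algebra :: complex ring" by (rule ring_from_type_algebra)
  let ?bs = "map (\<lambda>i. b ^ i) [0..<p]"
  have car: "set ?bs \<subseteq> carrier ring_of_type_algebra" by (simp add: ring_of_type_algebra_sel)
  have comb: "F.combine Ks ?bs = poly (\<Sum>i<p. monom (Ks ! i) i) b" if "length Ks = p" for Ks
    using that by (subst sum_basis_unfold) (auto simp: poly_sum poly_monom)
  have cin: "cin (\<Sum>i<p. monom (Ks ! i) i)" if "length Ks = p" "set Ks \<subseteq> K" for Ks
    using that by (intro cin_sum cin_monom) auto
  have "F.independent K ?bs"
  proof (rule F.trivial_combine_imp_independent[OF sK car])
    fix Ks assume Ks: "set Ks \<subseteq> K" "F.combine Ks ?bs = \<zero>\<^bsub>ring_of_type_algebra\<^esub>"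
    \<comment> \<open>The coefficient list may have any length; it is first brought to length
      \<open>p\<close>.\<close>
    obtain Ks' where Ks': "set (take (length ?bs) Ks) \<subseteq> set Ks'" "set Ks' \<subseteq> set (take (length ?bs) Ks) \<union> {\<zero>\<^bsub>ring_of_type_algebra\<^esub>}"
      "length Ks' = length ?bs" "F.combine Ks' ?bs = \<zero>\<^bsub>ring_of_type_algebra\<^esub>"
      using F.combine_normalize[OF _ car Ks(2)] by (auto simp: ring_of_type_algebra_sel)
    have len: "length Ks' = p" using Ks'(3) by simp
    have sub: "set Ks' \<subseteq> K" using Ks'(2) Ks(1) set_take_subset[of p Ks] by (fastforce simp: ring_of_type_algebra_sel)
    define f where "f = (\<Sum>i<p. monom (Ks' ! i) i)"
    have cf: "coeff f i = (if i < p then Ks' ! i else 0)" for i unfolding f_def by (rule poly_of_coeffs)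
    have "poly f b = 0" using comb[OF len] Ks'(4) by (simp add: f_def ring_of_type_algebra_sel)
    moreover have "cin f" unfolding f_def by (rule cin[OF len sub])
    moreover have "degree f < p" if "f \<noteq> 0"
      using that cf[of "degree f"] by (metis leading_coeff_0_iff)
    ultimately have "f = 0" using no_small_relation[OF b] by blast
    then have "Ks' ! i = 0" if "i < p" for i using cf[of i] that by simp
    then have "set Ks' \<subseteq> {0}" using len by (auto simp: in_set_conv_nth)
    then show "set (take (length ?bs) Ks) \<subseteq> {\<zero>\<^bsub>ring_of_type_algebra\<^esub>}"
      using Ks'(1) by (simp add: ring_of_type_algebra_sel)
  qed
  moreover have "F.Span K ?bs = LL b"
  proof -
    have "F.Span K ?bs = {F.combine Ks ?bs | Ks. length Ks = length ?bs \<and> set Ks \<subseteq> K}"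
      by (rule F.Span_eq_combine_set_length_version[OF sK car])
    also have "\<dots> = LL b"
    proof safe
      fix Ks assume "length Ks = length ?bs" "set Ks \<subseteq> K"
      then show "F.combine Ks ?bs \<in> LL b" using comb[of Ks] cin[of Ks] by (auto simp: LL_def)
    next
      fix x assume "x \<in> LL b"
      then obtain f where f: "cin f" "x = poly f b" "\<forall>i\<ge>p. coeff f i = 0" using LLE_reduced[OF b] by blast
      let ?Ks = "map (coeff f) [0..<p]"
      have "x = F.combine ?Ks ?bs"
        using f(3) by (subst sum_basis_unfold) (auto simp: f(2) poly_altdef_bound)
      then show "\<exists>Ks. x = F.combine Ks ?bs \<and> length Ks = length ?bs \<and> set Ks \<subseteq> K"
        using f(1) by (intro exI[of _ ?Ks]) (auto simp: cin_def)
    qed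
    finally show ?thesis .
  qed
  ultimately show ?thesis by (simp add: is_basis_def)
qed

text \<open>The matrix of multiplication by \<open>poly f b\<close> is diagonalised by the embeddings
  \<open>b \<mapsto> \<zeta> ^ i * b\<close>, which form the Vandermonde matrix \<open>W\<close>.\<close>

lemma field_norm_eq_nrm:
  assumes sK: "subfield K ring_of_type_algebra" and b: "b ^ p = of_nat N" and f: "cin f"
    and sL: "subfield (LL b) ring_of_type_algebra"
  shows "field_norm K (LL b) (poly f b) = nrm b f"
proof -
  let ?bs = "map (\<lambda>i. b ^ i) [0..<p]"
  note bas = basis[OF sK b]
  have "poly f b \<in> LL b" using f by (auto simp: LL_def)
  then obtain A where A: "is_mult_matrix K ?bs (poly f b) A" using ex_mult_matrix[OF sK sL bas] by blast
  have Ac: "A \<in> carrier_mat p p" and AK: "\<And>i j. i < p \<Longrightarrow> j < p \<Longrightarrow> A $$ (i, j) \<in> K"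
    and Ae: "\<And>j. j < p \<Longrightarrow> poly f b * b ^ j = (\<Sum>i<p. A $$ (i, j) * b ^ i)"
    using A by (auto simp: is_mult_matrix_def elements_mat_subset_iff)
  have conj: "poly f (\<zeta> ^ s * b) * (\<zeta> ^ s * b) ^ j = (\<Sum>i<p. A $$ (i, j) * (\<zeta> ^ s * b) ^ i)" if "j < p" for s j
  proof -
    let ?h = "f * monom 1 j - (\<Sum>i<p. monom (A $$ (i, j)) i)"
    have "cin ?h" using f AK that by (intro cin_diff cin_mult cin_monom cin_sum one) auto
    moreover have ph: "poly ?h x = poly f x * x ^ j - (\<Sum>i<p. A $$ (i, j) * x ^ i)" for x
      by (simp add: poly_sum poly_monom)
    ultimately have "poly ?h (\<zeta> ^ s * b) = 0"
      using Ae[OF that] by (intro relation_conj[OF b _ _ conj_root[OF b]]) auto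
    then show ?thesis unfolding ph by simp
  qed
  have b0: "b \<noteq> 0" using b N_pos p_gt_1 by (auto simp: power_0_left)
  define W where "W = mat p p (\<lambda>(i, j). (\<zeta> ^ i * b) ^ j)"
  \<comment> \<open>The inverse of \<open>W\<close>, by orthogonality of the \<open>p\<close>-th
    roots of unity; it serves to show that \<open>det W\<close> does not vanish.\<close>
  define W' where "W' = mat p p (\<lambda>(j, i). inverse ((\<zeta> ^ i * b) ^ j) / of_nat p)"
  define D where "D = mat p p (\<lambda>(i, j). if i = j then poly f (\<zeta> ^ i * b) else 0)"
  have carr: "W \<in> carrier_mat p p" "W' \<in> carrier_mat p p" "D \<in> carrier_mat p p"
    by (auto simp: W_def W'_def D_def)
  have "W * A = D * W"
  proof (rule eq_matI)
    fix i j assume "i < dim_row (D * W)" "j < dim_col (D * W)"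
    then have ij: "i < p" "j < p" using carr by auto
    have "(W * A) $$ (i, j) = (\<Sum>k<p. A $$ (k, j) * (\<zeta> ^ i * b) ^ k)"
      using ij Ac by (simp add: W_def scalar_prod_def lessThan_atLeast0 mult.commute)
    also have "\<dots> = poly f (\<zeta> ^ i * b) * (\<zeta> ^ i * b) ^ j" using conj ij by simp
    also have "\<dots> = (\<Sum>k<p. (if i = k then poly f (\<zeta> ^ i * b) else 0) * (\<zeta> ^ k * b) ^ j)"
      using ij by (simp add: if_distrib[of "\<lambda>x. x * _"] cong: if_cong)
    also have "\<dots> = (D * W) $$ (i, j)"
      using ij by (simp add: D_def W_def scalar_prod_def lessThan_atLeast0)
    finally show "(W * A) $$ (i, j) = (D * W) $$ (i, j)" .
  qed (use carr Ac in auto)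
  then have "det W * det A = det D * det W" using det_mult carr Ac by metis
  moreover have "det W \<noteq> 0"
  proof -
    have "W * W' = 1\<^sub>m p"
    proof (rule eq_matI)
      fix i j assume "i < dim_row (1\<^sub>m p :: complex mat)" "j < dim_col (1\<^sub>m p :: complex mat)"
      then have ij: "i < p" "j < p" by auto
      let ?w = "\<zeta> ^ i / \<zeta> ^ j"
      have w1: "?w = 1 \<longleftrightarrow> i = j"
      proof
        assume "?w = 1"
        then have eq: "\<zeta> ^ i = \<zeta> ^ j" using \<zeta>_nz by simp
        have *: "k = l" if "k \<le> l" "l < p" "\<zeta> ^ k = \<zeta> ^ l" for k l
        proof -
          have "\<zeta> ^ l = \<zeta> ^ k * \<zeta> ^ (l - k)" using that by (metis power_add le_add_diff_inverse)
          then have "\<zeta> ^ (l - k) = 1" using that \<zeta>_nz by simp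
          then have "p dvd l - k" using primitive_root_power_iff[OF root] by blast
          then show ?thesis using that by (auto dest: dvd_imp_le)
        qed
        show "i = j" using *[of i j] *[of j i] eq ij by (cases "i \<le> j") auto
      qed (simp add: \<zeta>_nz)
      have "(\<zeta> ^ k) ^ p = 1" for k by (metis \<zeta>_pow mult.commute power_mult power_one)
      then have "?w ^ p = 1" by (simp add: power_divide)
      then have s: "(\<Sum>k<p. ?w ^ k) = (if i = j then of_nat p else 0)" using sum_powers_root_of_unity w1 by metis
      have "(W * W') $$ (i, j) = (\<Sum>k<p. (\<zeta> ^ i * b) ^ k * (inverse ((\<zeta> ^ j * b) ^ k) / of_nat p))"
        using ij by (simp add: W_def W'_def scalar_prod_def lessThan_atLeast0)
      also have "\<dots> = (\<Sum>k<p. ?w ^ k) / of_nat p"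
        unfolding sum_divide_distrib using b0 \<zeta>_nz
        by (intro sum.cong refl) (simp add: power_mult_distrib power_divide field_simps)
      finally show "(W * W') $$ (i, j) = 1\<^sub>m p $$ (i, j)" using ij s p_gt_1 by simp
    qed (use carr in auto)
    then have "det W * det W' = 1" using det_mult[OF carr(1,2)] by simp
    then show ?thesis by auto
  qed
  ultimately have "det A = det D" by simp
  also have "\<dots> = prod_list (diag_mat D)" by (intro det_upper_triangular[OF _ carr(3)]) (auto simp: D_def upper_triangular_def)
  also have "\<dots> = nrm b f" unfolding prod_list_diag_prod nrm_def by (simp add: D_def lessThan_atLeast0)
  finally show ?thesis using field_norm_eq_det[OF sK bas A] by simp
qed

end

section \<open>Reciprocity of norms\<close>

lemma span_dimension_le:
  fixes K :: "'a::field set"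
  assumes K: "subfield K ring_of_type_algebra"
  shows "\<exists>m\<le>length us. ring.dimension ring_of_type_algebra m K (ring.Span ring_of_type_algebra K us)"
proof -
  interpret F: ring "ring_of_type_algebra :: 'a ring" by (rule ring_from_type_algebra)
  have car: "set vs \<subseteq> carrier ring_of_type_algebra" for vs :: "'a list" by (simp add: ring_of_type_algebra_sel)
  show ?thesis
  proof (induction us)
    case Nil
    then show ?case by (auto simp: F.dimension.zero_dim)
  next
    case (Cons u us)
    then obtain m where m: "m \<le> length us" "F.dimension m K (F.Span K us)" by blast
    show ?case
    proof (cases "u \<in> F.Span K us")
      case True
      then have "F.Span K (u # us) = F.Span K us"
        using F.Span_base_incl[OF K car] F.mono_Span_subset[OF K _ car]
        by (metis insert_subset list.simps(15) subset_antisym)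
      then show ?thesis using m by (intro exI[of _ m]) (simp only: list.size, simp)
    next
      case False
      then have "F.dimension (Suc m) K (F.Span K (u # us))"
        using m by (auto intro: F.dimension.Suc_dim simp: ring_of_type_algebra_sel)
      then show ?thesis using m(1) by (intro exI[of _ "Suc m"]) simp
    qed
  qed
qed

lemma dependent_if_long:
  fixes K :: "'a::field set" and m :: nat
  assumes K: "subfield K ring_of_type_algebra"
    and vs: "\<And>j. j \<le> m \<Longrightarrow> \<exists>c. (\<forall>i<m. c i \<in> K) \<and> v j = (\<Sum>i<m. c i * u i)"
  obtains a where "\<And>j. j \<le> m \<Longrightarrow> a j \<in> K" "\<exists>j\<le>m. a j \<noteq> 0" "(\<Sum>j\<le>m. a j * v j) = 0"
proof -
  interpret F: ring "ring_of_type_algebra :: 'a ring" by (rule ring_from_type_algebra)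
  have car: "set ws \<subseteq> carrier ring_of_type_algebra" for ws :: "'a list" by (simp add: ring_of_type_algebra_sel)
  let ?us = "map u [0..<m]" and ?vs = "map v [0..<Suc m]"
  have "set ?vs \<subseteq> F.Span K ?us"
  proof
    fix x assume "x \<in> set ?vs"
    then obtain j where "j \<in> {0..<Suc m}" "x = v j" by (auto simp only: set_map set_upt)
    then have j: "j \<le> m" "x = v j" by auto
    then obtain c where c: "\<forall>i<m. c i \<in> K" "x = (\<Sum>i<m. c i * u i)" using vs by blast
    have "x = F.combine (map c [0..<m]) ?us" by (subst sum_basis_unfold) (auto simp: c(2))
    then show "x \<in> F.Span K ?us"
      using c(1) unfolding F.Span_eq_combine_set_length_version[OF K car]
      by (intro CollectI exI[of _ "map c [0..<m]"]) auto
  qed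
  moreover obtain k where "k \<le> length ?us" "F.dimension k K (F.Span K ?us)" using span_dimension_le[OF K] by blast
  ultimately have "\<not> F.independent K ?vs"
    using F.independent_length_le_dimension[OF K, of k "F.Span K ?us" ?vs] by auto
  then obtain Ks where Ks: "set Ks \<subseteq> K" "F.combine Ks ?vs = \<zero>\<^bsub>ring_of_type_algebra\<^esub>"
    "\<not> set (take (length ?vs) Ks) \<subseteq> {\<zero>\<^bsub>ring_of_type_algebra\<^esub>}"
    using F.trivial_combine_imp_independent[OF K car] by blast
  obtain Ks' where Ks': "set (take (length ?vs) Ks) \<subseteq> set Ks'"
    "set Ks' \<subseteq> set (take (length ?vs) Ks) \<union> {\<zero>\<^bsub>ring_of_type_algebra\<^esub>}"
    "length Ks' = length ?vs" "F.combine Ks' ?vs = \<zero>\<^bsub>ring_of_type_algebra\<^esub>"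
    using F.combine_normalize[OF car car Ks(2)] by blast
  have len: "length Ks' = Suc m" using Ks'(3) by simp
  have sub: "set Ks' \<subseteq> K"
    using Ks'(2) Ks(1) subfield_props(1)[OF K] set_take_subset[of "length ?vs" Ks] by (auto simp: ring_of_type_algebra_sel)
  show ?thesis
  proof
    show "Ks' ! j \<in> K" if "j \<le> m" for j using that len sub by (metis le_imp_less_Suc nth_mem subsetD)
    have "\<not> set Ks' \<subseteq> {0}" using Ks(3) Ks'(1) by (auto simp: ring_of_type_algebra_sel)
    then show "\<exists>j\<le>m. Ks' ! j \<noteq> 0" using len by (auto simp: subset_iff in_set_conv_nth less_Suc_eq_le)
    have "F.combine Ks' ?vs = (\<Sum>i<Suc m. Ks' ! i * ?vs ! i)" by (subst sum_basis_unfold) (use len in auto)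
    also have "\<dots> = (\<Sum>j\<le>m. Ks' ! j * v j)" unfolding lessThan_Suc_atMost
      by (intro sum.cong refl) (simp add: nth_append less_Suc_eq_le[symmetric] del: upt_Suc)
    finally show "(\<Sum>j\<le>m. Ks' ! j * v j) = 0" using Ks'(4) by (simp add: ring_of_type_algebra_sel)
  qed
qed

text \<open>Reciprocity between \<open>K(\<xi>)\<close> with \<open>\<xi>\<^sup>p = \<zeta>\<close> and \<open>K(b)\<close> with \<open>b\<^sup>p = N\<close>: if \<open>N\<close> is the norm of \<open>y\<close>
  from \<open>K(\<xi>)\<close>, the semilinear map \<open>V x = y * tau x\<close> satisfies \<open>V\<^sup>p = N\<close> and makes \<open>K(\<xi>)\<close> a
  one-dimensional vector space over \<open>K[V] \<cong> K(b)\<close>. Writing \<open>\<xi> = f(V) 1\<close>, multiplication by \<open>\<xi>\<close> twists \<open>V\<close>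
  by a root of unity, so that \<open>\<zeta> = \<xi>\<^sup>p\<close> is the norm of \<open>f(b)\<close>.\<close>

lemma (in kummer) norm_reciprocity:
  fixes E :: "complex set" and tau :: "complex \<Rightarrow> complex" and \<xi> y b :: complex
  assumes sK: "subfield K ring_of_type_algebra" and b: "b ^ p = of_nat N"
    and E: "number_ring E" and KE: "K \<subseteq> E"
    and tau_E: "\<And>x. x \<in> E \<Longrightarrow> tau x \<in> E"
    and tau_add: "\<And>x x'. x \<in> E \<Longrightarrow> x' \<in> E \<Longrightarrow> tau (x + x') = tau x + tau x'"
    and tau_mult: "\<And>x x'. x \<in> E \<Longrightarrow> x' \<in> E \<Longrightarrow> tau (x * x') = tau x * tau x'"
    and tau_K: "\<And>x. x \<in> K \<Longrightarrow> tau x = x"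
    and xi: "\<xi> \<in> E" "\<xi> ^ p = \<zeta>" "tau \<xi> = \<zeta> ^ t * \<xi>" and t: "\<not> p dvd t"
    and span: "\<And>x. x \<in> E \<Longrightarrow> \<exists>c. (\<forall>i<p. c i \<in> K) \<and> x = (\<Sum>i<p. c i * \<xi> ^ i)"
    and y: "y \<in> E" "(\<Prod>i<p. (tau ^^ i) y) = of_nat N" and tau_p: "(tau ^^ p) y = y"
  obtains f where "cin f" "nrm b f = \<zeta>"
proof -
  interpret E: number_ring E by fact
  have tauk_E: "(tau ^^ k) x \<in> E" if "x \<in> E" for k x using that by (induction k) (auto simp: tau_E)
  have tau_0: "tau 0 = 0" using tau_K zero by blast
  have tau_sum: "tau (sum h I) = (\<Sum>i\<in>I. tau (h i))" if "\<And>i. h i \<in> E" for h :: "nat \<Rightarrow> complex" and I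
    by (induction I rule: infinite_finite_induct) (auto simp: tau_0 tau_add that E.sum)
  \<comment> \<open>\<open>Y m\<close> is \<open>V\<^sup>m\<close> applied to 1; thus
    \<open>Y p = N\<close> is the relation \<open>V\<^sup>p = N\<close>.\<close>
  define Y where "Y m = (\<Prod>i<m. (tau ^^ i) y)" for m
  have Y_E: "Y m \<in> E" for m unfolding Y_def using y by (intro E.prod tauk_E)
  have Y0: "Y 0 = 1" and Yp: "Y p = of_nat N" using y by (simp_all add: Y_def)
  have tau_prod: "tau (prod h {..<m}) = (\<Prod>i<m. tau (h i))" if "\<And>i. h i \<in> E" for h :: "nat \<Rightarrow> complex" and m :: nat
    using that by (induction m) (auto simp: tau_K one tau_mult E.prod)
  have Y_Suc: "y * tau (Y m) = Y (Suc m)" for m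
    unfolding Y_def using y(1) by (subst tau_prod) (auto simp: tauk_E prod.lessThan_Suc_shift simp del: prod.lessThan_Suc)
  have Y_per: "Y (m + p) = of_nat N * Y m" for m
  proof (induction m)
    case (Suc m)
    have "Y (Suc m + p) = y * tau (of_nat N * Y m)" using Y_Suc[of "m + p"] by (simp add: Suc)
    also have "\<dots> = of_nat N * (y * tau (Y m))" using Y_E[of m] of_nat[of N] KE by (subst tau_mult) (auto simp: tau_K)
    finally show ?case by (simp add: Y_Suc)
  qed (simp add: Yp Y0)
  \<comment> \<open>\<open>Th h\<close> is \<open>h(V)\<close> applied to 1.\<close>
  define Th where "Th h = (\<Sum>i\<le>degree h. coeff h i * Y i)" for h
  have Th_bound: "Th h = (\<Sum>i<m. coeff h i * Y i)" if "\<forall>i\<ge>m. coeff h i = 0" for h m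
    unfolding Th_def by (rule sum_coeff_bound[OF that])
  have Th_add: "Th (h + h') = Th h + Th h'" for h h'
  proof -
    let ?m = "Suc (max (degree h) (degree h'))"
    have "\<forall>i\<ge>?m. coeff h i = 0" "\<forall>i\<ge>?m. coeff h' i = 0" by (auto simp: coeff_eq_0)
    moreover from this have "\<forall>i\<ge>?m. coeff (h + h') i = 0" by simp
    ultimately show ?thesis using Th_bound[of ?m] by (simp only:) (simp add: sum.distrib distrib_right del: sum.lessThan_Suc)
  qed
  have Th_smult: "Th (smult c h) = c * Th h" for c h
    using Th_bound[of "Suc (degree h)" "smult c h"] Th_bound[of "Suc (degree h)" h]
    by (simp add: coeff_eq_0 sum_distrib_left mult.assoc del: sum.lessThan_Suc)
  have Th_pCons: "Th (pCons c h) = c + (\<Sum>i<Suc (degree h). coeff h i * Y (Suc i))" for c h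
  proof -
    have "Th (pCons c h) = (\<Sum>i<Suc (Suc (degree h)). coeff (pCons c h) i * Y i)"
      by (rule Th_bound) (auto simp: coeff_pCons coeff_eq_0 split: nat.split)
    then show ?thesis by (subst (asm) sum.lessThan_Suc_shift) (simp add: Y0 del: sum.lessThan_Suc)
  qed
  have V: "y * tau (Th h) = Th (pCons 0 h)" if "cin h" for h
  proof -
    have cK: "coeff h i \<in> K" for i using that by (simp add: cin_def)
    then have "tau (Th h) = (\<Sum>i<Suc (degree h). coeff h i * tau (Y i))"
      using Th_bound[of "Suc (degree h)" h] KE Y_E
      by (subst Th_bound[of "Suc (degree h)" h]) (auto simp: coeff_eq_0 tau_sum tau_mult tau_K E.mult subset_iff simp del: sum.lessThan_Suc)
    then show ?thesis unfolding Th_pCons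
      by (simp add: sum_distrib_left Y_Suc[symmetric] mult_ac del: sum.lessThan_Suc)
  qed
  have Th_0: "Th 0 = 0" by (simp add: Th_def)
  have Th_kill: "Th (h' * h) = 0" if "cin h" "Th h = 0" "cin h'" for h h'
    using that(3)
  proof (induction h')
    case (pCons c h')
    have h': "cin h'" using pCons.prems unfolding cin_def by (metis coeff_pCons_Suc)
    have "Th (pCons 0 (h' * h)) = y * tau (Th (h' * h))" using V that h' by (simp add: cin_mult)
    then show ?case using pCons.IH[OF h'] that by (simp add: Th_add Th_smult tau_0)
  qed (simp add: Th_0)
  have Th_XN: "Th (XN * h) = 0" if "cin h" for h
  proof -
    have "Th XN = 0"
    proof -
      have "Th XN = (\<Sum>i<Suc p. coeff XN i * Y i)" by (rule Th_bound) (auto simp: coeff_eq_0 degree_XN)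
      also have "{..<Suc p} = insert p (insert 0 {0<..<p})" using p_gt_1 by auto
      also have "(\<Sum>i\<in>insert p (insert 0 {0<..<p}). coeff XN i * Y i)
          = of_nat N - of_nat N + (\<Sum>i\<in>{0<..<p}. coeff XN i * Y i)"
        using p_gt_1 by (simp add: XN_def Yp Y0 coeff_pCons split: nat.splits)
      also have "(\<Sum>i\<in>{0<..<p}. coeff XN i * Y i) = 0"
        by (intro sum.neutral) (auto simp: XN_def coeff_pCons split: nat.splits)
      finally show ?thesis by simp
    qed
    then show ?thesis using Th_kill[OF cin_XN _ that] by (simp add: mult.commute)
  qed
  \<comment> \<open>If \<open>h\<close> did not vanish at \<open>b\<close>, it would be invertible
    modulo \<open>XN\<close>. The polynomials killed by \<open>Th\<close> absorb multiplication and
    include the multiples of \<open>XN\<close>, so \<open>Th 1 = 1\<close> would be 0.\<close>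
  have Th_inj: "poly h b = 0" if h: "cin h" "Th h = 0" for h
  proof (rule ccontr)
    assume nz: "poly h b \<noteq> 0"
    have "inverse (poly h b) \<in> LL b" using h by (intro LL_inverse b) (auto simp: LL_def)
    then obtain k where k: "cin k" "inverse (poly h b) = poly k b" by (auto simp: LL_def)
    have "cin (k * h - 1)" using k h by (intro cin_diff cin_mult cin_1)
    moreover have "poly (k * h - 1) b = 0" using nz by (simp flip: k(2))
    ultimately obtain a where a: "cin a" "k * h - 1 = XN * a" using relation_dvd[OF b] by blast
    have "Th (k * h) = Th (1 + XN * a)" using a(2) by (simp add: algebra_simps)
    also have "\<dots> = Th 1 + Th (XN * a)" by (rule Th_add)
    also have "Th 1 = 1" by (simp add: Th_def Y0)
    finally show False using Th_kill[OF h k(1)] Th_XN[OF a(1)] by simp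
  qed
  \<comment> \<open>These are \<open>p + 1\<close> elements in the span of \<open>p\<close>. By
    \<open>Th_inj\<close> the elements \<open>Y j\<close> with \<open>j < p\<close> are independent,
    so the relation involves \<open>\<xi>\<close>.\<close>
  define v where "v j = (if j = p then \<xi> else Y j)" for j
  have "\<exists>c. (\<forall>i<p. c i \<in> K) \<and> v j = (\<Sum>i<p. c i * \<xi> ^ i)" for j
    using span xi(1) Y_E by (simp add: v_def)
  then obtain a where a: "\<And>j. j \<le> p \<Longrightarrow> a j \<in> K" "\<exists>j\<le>p. a j \<noteq> 0" "(\<Sum>j\<le>p. a j * v j) = 0"
    using dependent_if_long[OF sK, of p v "\<lambda>i. \<xi> ^ i"] by blast
  define f0 where "f0 = (\<Sum>i<p. monom (a i) i)"
  have cf0: "coeff f0 i = (if i < p then a i else 0)" for i unfolding f0_def by (rule poly_of_coeffs)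
  have f0: "cin f0" unfolding f0_def using a(1) by (intro cin_sum cin_monom) auto
  have "Th f0 = (\<Sum>i<p. a i * Y i)" using Th_bound[of p f0] cf0 by simp
  then have rel: "a p * \<xi> + Th f0 = 0" using a(3) by (simp add: v_def add.commute flip: lessThan_Suc_atMost)
  have "a p \<noteq> 0"
  proof
    assume ap: "a p = 0"
    then have "poly f0 b = 0" using rel by (intro Th_inj f0) simp
    moreover have "degree f0 < p" if "f0 \<noteq> 0" using that cf0[of "degree f0"] by (metis leading_coeff_0_iff)
    ultimately have "f0 = 0" using no_small_relation[OF b f0] by blast
    then have "a j = 0" if "j \<le> p" for j using cf0[of j] ap that by (cases "j = p") auto
    then show False using a(2) by blast
  qed
  define f where "f = smult (- inverse (a p)) f0"
  have f: "cin f" unfolding f_def using a(1) f0 by (intro cin_smult minus inverse) auto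
  have "Th f0 = - (a p * \<xi>)" using rel by (simp add: eq_neg_iff_add_eq_0 add.commute)
  then have Th_f: "Th f = \<xi>" unfolding f_def Th_smult using \<open>a p \<noteq> 0\<close> by simp
  \<comment> \<open>Chosen to undo the twist
    \<open>V (\<xi> * x) = \<zeta> ^ t * \<xi> * V x\<close>, so that \<open>h(c * V)\<close>
    applied to \<open>\<xi>\<close> is \<open>\<xi>\<close> times \<open>h(V)\<close> applied to
    1.\<close>
  define c where "c = inverse \<zeta> ^ t"
  have c: "c \<in> K" unfolding c_def by (intro power inverse \<zeta>_K)
  have cz: "c * \<zeta> ^ t = 1" using \<zeta>_nz by (simp add: c_def flip: power_mult_distrib)
  have twist: "Th (h \<circ>\<^sub>p [:0, c:] * f) = \<xi> * Th h" if "cin h" for h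
    using that
  proof (induction h)
    case (pCons d h)
    have h: "cin h" using pCons.prems unfolding cin_def by (metis coeff_pCons_Suc)
    let ?g = "h \<circ>\<^sub>p [:0, c:] * f"
    have g: "cin ?g" using h f c by (intro cin_mult cin_scale)
    have "pCons d h \<circ>\<^sub>p [:0, c:] * f = smult d f + smult c (pCons 0 ?g)"
      by (simp add: pcompose_pCons algebra_simps)
    then have "Th (pCons d h \<circ>\<^sub>p [:0, c:] * f) = d * \<xi> + c * (y * tau (Th ?g))"
      using V[OF g] by (simp only: Th_add Th_smult Th_f)
    also have "Th ?g = \<xi> * Th h" by (rule pCons.IH[OF h])
    also have "tau (\<xi> * Th h) = \<zeta> ^ t * \<xi> * tau (Th h)"
      using xi h KE Y_E unfolding Th_def by (subst tau_mult) (auto simp: cin_def intro!: E.sum E.mult)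
    also have "d * \<xi> + c * (y * (\<zeta> ^ t * \<xi> * tau (Th h))) = \<xi> * (d + (c * \<zeta> ^ t) * (y * tau (Th h)))"
      by (simp add: algebra_simps)
    also have "\<dots> = \<xi> * Th (pCons d h)"
    proof -
      have "Th (pCons d h) = Th (smult d 1 + pCons 0 h)" by (simp add: one_pCons)
      also have "\<dots> = d + Th (pCons 0 h)" unfolding Th_add Th_smult by (simp add: Th_def[of 1] Y0)
      finally show ?thesis using V[OF h] cz by simp
    qed
    finally show ?case .
  qed (simp add: Th_0)
  \<comment> \<open>Each further twisted factor of \<open>f\<close> contributes one more
    \<open>\<xi>\<close>; for \<open>m = p\<close> the value is
    \<open>\<xi>\<^sup>p = \<zeta>\<close>.\<close>
  have pow: "cin (\<Prod>i<m. f \<circ>\<^sub>p [:0, c ^ i:]) \<and> Th (\<Prod>i<m. f \<circ>\<^sub>p [:0, c ^ i:]) = \<xi> ^ m" for m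
  proof (induction m)
    case 0
    then show ?case by (simp add: cin_1 Th_def Y0)
  next
    case (Suc m)
    let ?h = "\<Prod>i<m. f \<circ>\<^sub>p [:0, c ^ i:]"
    have eq: "(\<Prod>i<Suc m. f \<circ>\<^sub>p [:0, c ^ i:]) = ?h \<circ>\<^sub>p [:0, c:] * f"
    proof -
      have "(\<Prod>i<Suc m. f \<circ>\<^sub>p [:0, c ^ i:]) = f \<circ>\<^sub>p [:0, c ^ 0:] * (\<Prod>i<m. f \<circ>\<^sub>p [:0, c ^ Suc i:])"
        by (rule prod.lessThan_Suc_shift)
      also have "(\<Prod>i<m. f \<circ>\<^sub>p [:0, c ^ Suc i:]) = ?h \<circ>\<^sub>p [:0, c:]"
        by (intro poly_ext) (simp add: poly_pcompose poly_prod mult_ac)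
      also have "f \<circ>\<^sub>p [:0, c ^ 0:] = f" by (intro poly_ext) (simp add: poly_pcompose)
      finally show ?thesis by (simp only: mult.commute)
    qed
    show ?case unfolding eq using Suc twist[of ?h] c f by (simp add: cin_mult cin_scale)
  qed
  let ?G = "\<Prod>i<p. f \<circ>\<^sub>p [:0, c ^ i:]"
  have "?G - [:\<zeta>:] = ?G + smult (- \<zeta>) 1" by (simp add: one_pCons)
  then have "Th (?G - [:\<zeta>:]) = Th (?G + smult (- \<zeta>) 1)" by (rule arg_cong)
  also have "\<dots> = 0" unfolding Th_add Th_smult using pow[of p] xi(2) by (simp add: Th_def[of 1] Y0)
  finally have "poly (?G - [:\<zeta>:]) b = 0" using pow[of p] \<zeta>_K by (intro Th_inj cin_diff cin_pCons cin_0) auto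
  then have "(\<Prod>i<p. poly f (c ^ i * b)) = \<zeta>" by (simp add: poly_prod poly_pcompose mult.commute)
  moreover have "(\<Prod>i<p. poly f (c ^ i * b)) = nrm b f"
  proof -
    have cp: "c ^ i = \<zeta> ^ ((p - 1) * t * i mod p)" for i
    proof -
      have "\<zeta> ^ (p - 1) * \<zeta> = 1" using p_gt_1 power_minus_mult[of p \<zeta>] \<zeta>_pow by simp
      then have "inverse \<zeta> = \<zeta> ^ (p - 1)" using \<zeta>_nz by (simp add: field_simps)
      then show ?thesis unfolding power_mod_root_of_unity[OF \<zeta>_pow] c_def by (simp only: power_mult)
    qed
    \<comment> \<open>As \<open>p\<close> divides neither \<open>t\<close> nor \<open>p - 1\<close>,
      the powers of \<open>c\<close> run through all \<open>p\<close>-th roots of unity.\<close>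
    have "bij_betw (\<lambda>i. (p - 1) * t * i mod p) {..<p} {..<p}"
    proof (rule bij_betw_imageI)
      have "coprime p (p - 1)" using p_gt_1 by (metis coprime_diff_one_right_nat coprime_commute gr0I not_less_zero)
      moreover have "coprime p t" using t prime_p by (simp add: prime_imp_coprime)
      ultimately have "coprime ((p - 1) * t) p" by (simp add: coprime_commute)
      then show inj: "inj_on (\<lambda>i. (p - 1) * t * i mod p) {..<p}"
        by (intro inj_onI) (metis cong_def cong_less_modulus_unique_nat cong_mult_lcancel_nat lessThan_iff)
      then show "(\<lambda>i. (p - 1) * t * i mod p) ` {..<p} = {..<p}"
        using p_gt_1 by (intro endo_inj_surj) auto
    qed
    then show ?thesis unfolding nrm_def cp by (rule prod.reindex_bij_betw)
  qed
  ultimately show ?thesis using that f by simp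
qed

section \<open>The equivalence\<close>

context cyclotomic
begin

lemma gen_field_FF: "gen_field {z} = FF"
proof
  show "gen_field {z} \<subseteq> FF" using FF.number_ring_axioms FF_inverse by (intro gen_field_min) auto
  interpret E: number_ring "gen_field {z}" by (rule gen_field_ring)
  have z: "z \<in> gen_field {z}" using gen_field_incl[of "{z}"] by simp
  have ip: "ipoly f z \<in> gen_field {z}" for f
    by (induction f) (auto intro!: E.add E.mult E.of_int z simp: E.zero)
  show "FF \<subseteq> gen_field {z}"
  proof
    fix x assume "x \<in> FF"
    then obtain d f where d: "d \<noteq> 0" "of_int d * x = ipoly f z" by (rule FFE)
    then have "x = ipoly f z * inverse (of_int d)" by (simp add: field_simps flip: d(2))
    then show "x \<in> gen_field {z}" using ip E.of_int by (auto intro!: E.mult gen_field_inverse)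
  qed
qed

end

context cyclotomic_prime
begin

text \<open>The valuation of \<open>c ^ m\<close> is a multiple of \<open>m\<close>, that of
  \<open>N ^ d\<close> is \<open>d\<close>.\<close>

lemma no_power_root:
  assumes "c \<in> FF" "0 < d" "d < m" shows "c ^ m \<noteq> of_nat N ^ d"
proof
  assume eq: "c ^ m = of_nat N ^ d"
  have c0: "c \<noteq> 0" using eq assms by (auto simp: power_0_left)
  have "int m * vv c = vv (c ^ m)" using assms c0 by (simp add: vv_power)
  also have "\<dots> = int d" unfolding eq by (simp add: vv_power vv_N)
  finally have "int m dvd int d" by (metis dvd_triv_left)
  then show False using assms by (auto dest: dvd_imp_le)
qed

lemma PP_divide_N: assumes "x \<in> PP" shows "x / of_nat N \<in> Ov"
proof -
  obtain s where s: "s \<in> Zz" "s \<notin> PP" "\<And>x. x \<in> PP \<Longrightarrow> \<exists>y\<in>Zz. x * s = of_nat N * y"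
    using PP_local_generator by blast
  obtain y where y: "y \<in> Zz" "x * s = of_nat N * y" using s(3) assms by blast
  then have "x / of_nat N = y / s" using nz_not_PP[OF s(2)] by (simp add: field_simps)
  then show ?thesis using y(1) s(1,2) by (auto simp: Ov_def)
qed

lemma int_divide_N_iff: "of_int k / of_nat N \<in> Ov \<Longrightarrow> int N dvd k"
  using Ou_not_N Ou_of_int_iff by blast

end

lemma kummer_cyclotomic:
  assumes "cyclotomic_prime p 1 g z N w" "odd p" shows "kummer (cyclotomic.FF z) p N z"
proof -
  interpret cyclotomic_prime p 1 g z N w by fact
  show ?thesis
    using FF_inverse p assms(2) N_gt_1 z no_power_root by unfold_locales auto
qed

text \<open>The ramified direction: the terms \<open>a\<^sub>j b\<^sup>j\<close> have distinct \<open>N\<close>-adic valuations, so a norm with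
  valuation \<open>0\<close> is congruent to a \<open>p\<close>-th power modulo \<open>N\<close>.\<close>

lemma norm_imp_power_residue:
  assumes loc: "cyclotomic_prime p 1 g z N w" and odd: "odd p" and b: "b ^ p = of_nat N"
    and x: "x \<in> kummer.LL (cyclotomic.FF z) b"
    and nrm: "\<And>f. number_ring.cin (cyclotomic.FF z) f \<Longrightarrow> x = poly f b \<Longrightarrow> kummer.nrm p z b f = z"
  obtains t :: int where "int N dvd w - t ^ p"
proof -
  interpret cyclotomic_prime p 1 g z N w by fact
  interpret KM: kummer FF p N z by (rule kummer_cyclotomic[OF loc odd])
  obtain f where f: "FF.cin f" "x = poly f b" "\<forall>i\<ge>p. coeff f i = 0" using KM.LLE_reduced[OF b x] by blast
  have nf: "KM.nrm b f = z" using nrm f by blast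
  let ?a = "coeff f"
  have aF: "?a i \<in> FF" for i using f(1) by (simp add: FF.cin_def)
  have "f \<noteq> 0"
  proof
    assume "f = 0"
    then have "KM.nrm b f = 0" using KM.p_gt_1 by (auto simp: KM.nrm_def)
    then show False using nf by simp
  qed
  define J where "J = {j. ?a j \<noteq> 0}"
  have J: "finite J" "J \<noteq> {}" "J \<subseteq> {..<p}"
  proof -
    show sub: "J \<subseteq> {..<p}" using f(3) by (auto simp: J_def not_less[symmetric])
    then show "finite J" by (rule finite_subset) simp
    show "J \<noteq> {}" using \<open>f \<noteq> 0\<close> by (auto simp: J_def poly_eq_iff)
  qed
  \<comment> \<open>\<open>p\<close> times the valuation of the \<open>j\<close>-th term, where
    \<open>b\<close> has valuation \<open>1 / p\<close>. These values differ modulo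
    \<open>p\<close>.\<close>
  define k where "k j = int p * vv (?a j) + int j" for j
  obtain j0 where j0: "j0 \<in> J" "\<And>j. j \<in> J \<Longrightarrow> k j0 \<le> k j"
  proof -
    have "Min (k ` J) \<in> k ` J" using J by (intro Min_in) auto
    then obtain j0 where "j0 \<in> J" "Min (k ` J) = k j0" by auto
    then show ?thesis using that[of j0] J Min_le[of "k ` J"] by auto
  qed
  define c where "c = ?a j0"
  have c: "c \<in> FF" "c \<noteq> 0" using j0 aF by (auto simp: c_def J_def)
  have j0p: "j0 < p" using j0 J by auto
  have aJ: "?a j / c \<in> FF" "?a j / c \<noteq> 0" "int p * vv (?a j / c) \<ge> int j0 - int j" if "j \<in> J" for j
  proof -
    have aj: "?a j \<noteq> 0" using that by (simp add: J_def)
    then show "?a j / c \<in> FF" "?a j / c \<noteq> 0" using aF c by (simp_all add: FF_divide)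
    have eq: "vv (?a j) = vv c + vv (?a j / c)"
      using aF c aj by (simp add: divide_inverse vv_mult FF_inverse vv_inverse)
    show "int p * vv (?a j / c) \<ge> int j0 - int j"
      using j0(2)[OF that] unfolding k_def c_def[symmetric] eq by (simp add: distrib_left)
  qed
  have high: "?a j / c \<in> Ov" if "j0 \<le> j" for j
  proof (cases "j \<in> J")
    case True
    then have "int p * vv (?a j / c) > int p * (- 1)" using aJ(3)[OF True] J by auto
    then have "vv (?a j / c) > - 1" by (rule mult_left_less_imp_less) simp
    then show ?thesis using vv_nonneg_iff[OF aJ(1,2)[OF True]] by simp
  qed (simp add: J_def)
  have low: "?a j / c / of_nat N \<in> Ov" if "j < j0" for j
  proof (cases "j \<in> J")
    case True
    then have "int p * vv (?a j / c) > int p * 0" using aJ(3)[OF True] that by simp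
    then have "vv (?a j / c) > 0" by (rule mult_left_less_imp_less) simp
    then show ?thesis using vv_ge_iff[OF aJ(1,2)[OF True], of 1] by simp
  qed (simp add: J_def)
  \<comment> \<open>The result of dividing \<open>f\<close> by its dominant term
    \<open>c * X ^ j0\<close>. Exponents below \<open>j0\<close> would become negative, so there
    \<open>X ^ p\<close> is brought in at the price of a division by \<open>N\<close>, which
    \<open>low\<close> allows.\<close>
  define h where "h = (\<Sum>j\<in>{j0..<p}. monom (?a j / c) (j - j0)) + (\<Sum>j<j0. monom (?a j / c / of_nat N) (p + j - j0))"
  have hO: "coeff h i \<in> Ov" for i
  proof -
    have "Ov.cin h" unfolding h_def using high low by (intro Ov.cin_add Ov.cin_sum Ov.cin_monom) auto
    then show ?thesis by (simp add: Ov.cin_def)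
  qed
  have "coeff h 0 = (\<Sum>j\<in>{j0..<p}. if j = j0 then ?a j / c else 0) + (\<Sum>j<j0. 0)"
    unfolding h_def coeff_add coeff_sum using j0p by (intro arg_cong2[of _ _ _ _ "(+)"] sum.cong) auto
  then have h0: "coeff h 0 = 1" using j0p c by (simp add: c_def)
  have fh: "poly f y = c * y ^ j0 * poly h y" if y: "y ^ p = of_nat N" for y
  proof -
    have "poly f y = (\<Sum>j<p. ?a j * y ^ j)" by (rule poly_altdef_bound[OF f(3)])
    also have "{..<p} = {j0..<p} \<union> {..<j0}" using j0p by auto
    also have "(\<Sum>j\<in>{j0..<p} \<union> {..<j0}. ?a j * y ^ j) = (\<Sum>j\<in>{j0..<p}. ?a j * y ^ j) + (\<Sum>j<j0. ?a j * y ^ j)"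
      by (rule sum.union_disjoint) auto
    also have "(\<Sum>j\<in>{j0..<p}. ?a j * y ^ j) = (\<Sum>j\<in>{j0..<p}. c * y ^ j0 * (?a j / c * y ^ (j - j0)))"
      using c by (intro sum.cong refl) (simp flip: power_add)
    also have "(\<Sum>j<j0. ?a j * y ^ j) = (\<Sum>j<j0. c * y ^ j0 * (?a j / c / of_nat N * y ^ (p + j - j0)))"
    proof (intro sum.cong refl)
      fix j assume "j \<in> {..<j0}"
      then have "y ^ j0 * y ^ (p + j - j0) = y ^ (p + j)" using j0p by (simp flip: power_add)
      then have "y ^ j0 * y ^ (p + j - j0) = of_nat N * y ^ j" by (simp add: power_add y)
      then show "?a j * y ^ j = c * y ^ j0 * (?a j / c / of_nat N * y ^ (p + j - j0))"
        using c by (simp add: field_simps)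
    qed
    finally show ?thesis
      by (simp add: h_def poly_sum poly_monom sum_distrib_left distrib_left)
  qed
  have "KM.nrm b f = (\<Prod>i<p. c * (z ^ i * b) ^ j0 * poly h (z ^ i * b))"
    unfolding KM.nrm_def using fh[OF KM.conj_root[OF b]] by (intro prod.cong refl) simp
  also have "\<dots> = c ^ p * (\<Prod>i<p. z ^ i * b) ^ j0 * KM.nrm b h"
    by (simp add: prod.distrib KM.nrm_def flip: prod_power_distrib)
  also have "(\<Prod>i<p. z ^ i * b) = of_nat N" by (rule KM.prod_conj_root[OF b])
  finally have zc: "z = c ^ p * of_nat N ^ j0 * KM.nrm b h" using nf by simp
  obtain v where v: "v \<in> Ov" "KM.nrm b h = coeff h 0 ^ p + of_nat N * v"
    using KM.nrm_expand[OF Ov.number_ring_axioms _ b hO] Zz_Ov[OF Zz_z] by blast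
  have nh: "KM.nrm b h = 1 + of_nat N * v" using v(2) h0 by simp
  have nhU: "KM.nrm b h \<in> Ou"
  proof (rule ccontr)
    assume "KM.nrm b h \<notin> Ou"
    moreover have "KM.nrm b h \<in> Ov" unfolding nh using v(1) by (intro Ov_add Ov_mult) auto
    ultimately have "KM.nrm b h / of_nat N \<in> Ov" using Ov_cases by blast
    then have "KM.nrm b h / of_nat N - v \<in> Ov" using v(1) by (rule Ov_diff)
    also have "KM.nrm b h / of_nat N - v = of_int 1 / of_nat N" unfolding nh by (simp add: add_divide_distrib)
    finally have "int N dvd 1" by (rule int_divide_N_iff)
    then show False using N_gt_1 by simp
  qed
  have zP: "z \<notin> PP"
  proof
    assume "z \<in> PP"
    then have "z * z ^ (p - 1) \<in> PP" by (subst PP_mult_iff) (auto intro: Zz.power)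
    moreover have "z * z ^ (p - 1) = z ^ Suc (p - 1)" by (simp only: power_Suc)
    then have "z * z ^ (p - 1) = 1" using KM.\<zeta>_pow by simp
    ultimately show False using one_not_PP by simp
  qed
  \<comment> \<open>Comparing valuations gives \<open>p * vv c + j0 = 0\<close>, and
    \<open>j0 < p\<close> forces both terms to vanish.\<close>
  have "0 = vv z" using zP by (simp add: vv_Ou Zz_Ou)
  also have "\<dots> = int p * vv c + int j0"
  proof -
    have "KM.nrm b h \<in> FF" "KM.nrm b h \<noteq> 0" using nhU Ou_nz Ou_Ov Ov_FF by auto
    then show ?thesis by (subst zc) (use c in \<open>simp add: vv_mult FF_mult FF.power vv_power vv_N vv_Ou[OF nhU]\<close>)
  qed
  finally have eq: "int p * vv c + int j0 = 0" by simp
  then have "int p dvd int j0" by (metis add_eq_0_iff dvd_minus_iff dvd_triv_left)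
  then have j00: "j0 = 0" using j0p by (auto dest: dvd_imp_le)
  then have "vv c = 0" using eq by simp
  then have cO: "c \<in> Ov" using vv_nonneg_iff[OF c] by simp
  obtain t where t: "(c - of_int t) / of_nat N \<in> Ov" using Ov_residue[OF cO] by blast

  \<comment> \<open>One link of the chain \<open>w \<equiv> z \<equiv> c ^ p \<equiv> t ^ p\<close>
    modulo \<open>N\<close> in \<open>Ov\<close>.\<close>
  have "(c ^ p - of_int t ^ p) / of_nat N \<in> Ov"
  proof -
    have "c ^ p - of_int t ^ p = (c - of_int t) * (\<Sum>i<p. of_int t ^ (p - Suc i) * c ^ i)"
      by (simp add: power_diff_sumr2)
    then have "(c ^ p - of_int t ^ p) / of_nat N = (c - of_int t) / of_nat N * (\<Sum>i<p. of_int t ^ (p - Suc i) * c ^ i)"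
      by simp
    also have "\<dots> \<in> Ov" using t cO by (intro Ov_mult Ov.sum Ov.power Ov.of_int)
    finally show ?thesis .
  qed
  moreover have "(z - of_int w) / of_nat N \<in> Ov" by (rule PP_divide_N[OF z_residue])
  moreover have "(z - c ^ p) / of_nat N = c ^ p * v" using zc by (simp add: j00 nh field_simps)
  then have "(z - c ^ p) / of_nat N \<in> Ov" using cO v(1) by (simp add: Ov_mult Ov.power)
  ultimately have "(z - c ^ p) / of_nat N + (c ^ p - of_int t ^ p) / of_nat N - (z - of_int w) / of_nat N \<in> Ov"
    by (intro Ov_add Ov_diff)
  also have "(z - c ^ p) / of_nat N + (c ^ p - of_int t ^ p) / of_nat N - (z - of_int w) / of_nat N
      = of_int (w - t ^ p) / of_nat N" by (simp add: diff_divide_distrib add_divide_distrib)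
  finally have "int N dvd w - t ^ p" by (rule int_divide_N_iff)
  then show ?thesis by (rule that)
qed

text \<open>As \<open>w\<close> has order \<open>p\<close> modulo \<open>N\<close>, a
  \<open>p\<close>-th root of it has order \<open>p ^ 2\<close>, which divides
  \<open>N - 1\<close>.\<close>

lemma power_residue_imp_cong:
  fixes w t :: int
  assumes p: "prime p" and N: "prime N"
    and w: "int N dvd w ^ p - 1" "\<not> int N dvd w - 1" and t: "int N dvd w - t ^ p"
  shows "[N = 1] (mod p\<^sup>2)"
proof -
  have N0: "0 < N" and N1: "1 < N" using N by (simp_all add: prime_gt_0_nat prime_gt_1_nat del: One_nat_def)
  define u where "u = nat (t mod int N)"
  have u: "[int u = t] (mod int N)" using N0 by (simp add: u_def cong_def)
  have wt: "[int (u ^ p) = w] (mod int N)"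
    using cong_trans[OF cong_pow[OF u, of p]] t by (simp add: cong_iff_dvd_diff dvd_diff_commute)
  have iff: "[u ^ (p * k) = 1] (mod N) \<longleftrightarrow> [w ^ k = 1] (mod int N)" for k
  proof -
    have "[u ^ (p * k) = 1] (mod N) \<longleftrightarrow> [int (u ^ (p * k)) = int 1] (mod int N)" by (simp only: cong_int_iff)
    also have "int (u ^ (p * k)) = int (u ^ p) ^ k" by (simp add: power_mult)
    also have "[int (u ^ p) ^ k = int 1] (mod int N) \<longleftrightarrow> [w ^ k = 1] (mod int N)"
      using cong_pow[OF wt, of k] by (metis cong_sym cong_trans of_nat_1)
    finally show ?thesis .
  qed
  have "ord N u dvd p ^ 2" using iff[of p] w(1) ord_divides[of u "p * p" N]
    by (simp add: cong_iff_dvd_diff power2_eq_square)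
  then obtain i where i: "i \<le> 2" "ord N u = p ^ i" using divides_primepow_nat[OF p] by blast
  have "\<not> ord N u dvd p" using iff[of 1] w(2) ord_divides[of u p N] by (simp add: cong_iff_dvd_diff)
  then have "i \<noteq> 0" "i \<noteq> 1" using i by (metis power_0 one_dvd, metis power_one_right dvd_refl)
  then have "ord N u = p\<^sup>2" using i by (cases "i = 2") auto
  moreover have "ord N u dvd totient N"
  proof (rule order_divides_totient)
    show "coprime N u" using \<open>ord N u = p\<^sup>2\<close> p by (metis ord_eq_0 power_eq_0_iff prime_gt_0_nat less_numeral_extra(3))
  qed
  ultimately have "p\<^sup>2 dvd N - 1" using N by (simp add: totient_prime)
  then show ?thesis using N1 by (subst cong_altdef_nat) auto
qed

theorem theorem2p4:
  fixes p N :: nat and \<zeta> \<alpha> :: complex and K L :: "complex set"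
  assumes "Factorial_Ring.prime p" and "odd p" and "Factorial_Ring.prime N" and "[N = 1] (mod p)"
    and "primitive_root_of_unity p \<zeta>" and "\<alpha> ^ p = of_nat N"
    and "K = gen_field {\<zeta>}" and "L = gen_field (K \<union> {\<alpha>})"
  shows "[N = 1] (mod p\<^sup>2) \<longleftrightarrow> \<zeta> \<in> field_norm K L ` (L - {0})"
proof -
  note p = assms(1) and odd = assms(2) and N = assms(3)
  have p1: "1 < p" by (rule prime_gt_1_nat[OF p])
  \<comment> \<open>One \<open>g\<close> serves modulo \<open>p\<close> and modulo
    \<open>p ^ 2\<close>, hence for both cyclotomic fields.\<close>
  obtain g where g: "\<forall>k>0. residue_primroot (p ^ k) g"
    using residue_primroot_odd_prime_power_exists[OF p odd] by blast
  obtain w where w: "int N dvd w ^ (p ^ 1) - 1" "\<not> int N dvd w ^ (p ^ (1 - 1)) - 1" "N \<noteq> p"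
    by (rule ex_root_of_unity_mod_prime[OF p _ N, of 1]) (use assms(4) in auto)
  have loc: "cyclotomic_prime p 1 g \<zeta> N w"
    using p N g[rule_format, of 1] assms(5) w by unfold_locales auto
  interpret C1: cyclotomic_prime p 1 g \<zeta> N w by (rule loc)
  interpret KM: kummer C1.FF p N \<zeta> by (rule kummer_cyclotomic[OF loc odd])
  have K: "K = C1.FF" unfolding assms(7) by (rule C1.gen_field_FF)
  have L: "L = KM.LL \<alpha>" unfolding assms(8) K by (rule KM.gen_field_LL[OF assms(6)])
  have sK: "subfield C1.FF ring_of_type_algebra" unfolding K[symmetric] assms(7) by (rule subfield_gen_field)
  have sL: "subfield (KM.LL \<alpha>) ring_of_type_algebra" unfolding L[symmetric] assms(8) by (rule subfield_gen_field)
  have fn: "field_norm K L (poly f \<alpha>) = KM.nrm \<alpha> f" if "C1.FF.cin f" for f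
    unfolding K L by (rule KM.field_norm_eq_nrm[OF sK assms(6) that sL])
  show ?thesis
  proof
    assume "\<zeta> \<in> field_norm K L ` (L - {0})"
    then obtain x where x: "x \<in> L" "field_norm K L x = \<zeta>" by auto
    obtain t where "int N dvd w - t ^ p"
    proof (rule norm_imp_power_residue[OF loc odd assms(6)])
      show "x \<in> KM.LL \<alpha>" using x L by simp
      show "KM.nrm \<alpha> f = \<zeta>" if "C1.FF.cin f" "x = poly f \<alpha>" for f using fn[OF that(1)] x(2) that(2) by simp
    qed
    then show "[N = 1] (mod p\<^sup>2)" using w by (intro power_residue_imp_cong[OF p N]) auto
  next
    assume N2: "[N = 1] (mod p\<^sup>2)"
    obtain \<xi> where xi: "\<xi> ^ p = \<zeta>" using nth_root_exists[of p \<zeta>] p1 by auto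
    have prim: "primitive_root_of_unity (p\<^sup>2) \<xi>"
      unfolding primitive_root_of_unity_def
    proof (intro conjI allI impI)
      show "0 < p\<^sup>2" using p1 by simp
      show "\<xi> ^ p\<^sup>2 = 1" using xi KM.\<zeta>_pow by (simp add: power2_eq_square power_mult)
      fix k assume k: "0 < k \<and> k < p\<^sup>2"
      show "\<xi> ^ k \<noteq> 1"
      proof
        assume 1: "\<xi> ^ k = 1"
        have "\<zeta> ^ k = (\<xi> ^ k) ^ p" by (metis xi mult.commute power_mult)
        then have "p dvd k" using 1 primitive_root_power_iff[OF assms(5)] by simp
        then obtain j where j: "k = p * j" by (auto simp: dvd_def)
        then have "\<zeta> ^ j = 1" using 1 xi by (simp add: power_mult)
        then have "p dvd j" using primitive_root_power_iff[OF assms(5)] by simp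
        then have "p * p dvd k" using j by simp
        then show False using k by (auto dest!: dvd_imp_le simp: power2_eq_square)
      qed
    qed
    obtain w' where w': "int N dvd w' ^ (p\<^sup>2) - 1" "\<not> int N dvd w' ^ (p ^ (2 - 1)) - 1"
      using ex_root_of_unity_mod_prime[OF p _ N N2] by auto
    interpret C2: cyclotomic_square p g \<xi> N w'
      using p N g prim w' w(3) odd by unfold_locales auto
    obtain y where y: "y \<in> C2.FF" "(\<Prod>i<p. (C2.sig ^^ ((p - 1) * i)) y) = of_nat N"
      using C2.N_is_norm by blast
    \<comment> \<open>A generator of the Galois group of \<open>K(\<xi>)\<close> over
      \<open>K\<close>, of order \<open>p\<close>.\<close>
    define tau where "tau = C2.sig ^^ (p - 1)"
    have tau_pow: "(tau ^^ i) = C2.sig ^^ ((p - 1) * i)" for i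
      by (simp add: tau_def funpow_mult)
    have KE: "C1.FF \<subseteq> C2.FF"
    proof -
      have "\<zeta> \<in> C2.FF" using C2.FF.power[OF C2.FF_z, of p] xi by simp
      then have "gen_field {\<zeta>} \<subseteq> C2.FF" using C2.FF.number_ring_axioms C2.FF_inverse by (intro gen_field_min) auto
      then show ?thesis by (simp add: C1.gen_field_FF)
    qed
    have gp: "[g ^ (p - 1) = 1] (mod p)"
    proof -
      have "coprime g p" using C1.coprime_g by (simp add: coprime_commute)
      then have "[g ^ totient p = 1] (mod p)" by (rule euler_theorem)
      then show ?thesis using p by (simp add: totient_prime)
    qed
    have "1 \<le> g ^ (p - 1)" using C1.coprime_g p1 by (cases "g = 0") auto
    moreover have "p dvd g ^ (p - 1) - 1" using gp by (rule cong_to_1_nat)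
    \<comment> \<open>Hence \<open>tau\<close> multiplies \<open>\<xi>\<close> by
      \<open>\<xi> ^ (p * t) = \<zeta> ^ t\<close>; that \<open>p\<close> does not divide
      \<open>t\<close> will follow from \<open>g\<close> being primitive modulo
      \<open>p ^ 2\<close>.\<close>
    ultimately obtain t where t: "g ^ (p - 1) = 1 + p * t" by (metis dvdE le_add_diff_inverse)
    have tau_xi: "tau \<xi> = \<zeta> ^ t * \<xi>"
      unfolding tau_def C2.sigk_z t by (simp add: power_add power_mult xi)
    have "\<not> p dvd t"
    proof
      assume "p dvd t"
      then have "\<zeta> ^ t = 1" using primitive_root_power_iff[OF assms(5)] by simp
      then have "\<xi> ^ (g ^ (p - 1)) = \<xi>" using tau_xi by (simp add: tau_def C2.sigk_z)
      moreover have "p - 1 < C2.n" using p1 by (simp add: C2.n_square)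
      ultimately show False using C2.z_pow_g_neq[of "p - 1"] p1 by simp
    qed
    have tau_K: "tau x = x" if "x \<in> C1.FF" for x
    proof -
      let ?E = "{x \<in> C2.FF. tau x = x}"
      have "number_ring ?E"
      proof
        show "1 \<in> ?E" by (simp add: tau_def)
        show "x - y \<in> ?E" if "x \<in> ?E" "y \<in> ?E" for x y
        proof -
          have "tau (x - y + y) = tau (x - y) + tau y" unfolding tau_def using that by (intro C2.sigk_add C2.FF_diff) auto
          then have "x = tau (x - y) + y" using that by simp
          then have "tau (x - y) = x - y" by (metis add_diff_cancel_right')
          then show ?thesis using that by (simp add: C2.FF_diff)
        qed
        show "x * y \<in> ?E" if "x \<in> ?E" "y \<in> ?E" for x y
          using that by (simp add: tau_def C2.sigk_mult C2.FF_mult)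
      qed
      moreover have "tau \<zeta> = \<zeta>"
      proof -
        have "tau \<zeta> = tau \<xi> ^ p" unfolding tau_def xi[symmetric] by (rule C2.sigk_power) simp
        also have "\<dots> = \<zeta>" unfolding tau_xi by (simp add: power_mult_distrib xi) (metis KM.\<zeta>_pow mult.commute power_mult power_one)
        finally show ?thesis .
      qed
      moreover have "\<zeta> \<in> C2.FF" using C2.FF.power[OF C2.FF_z, of p] xi by simp
      ultimately have "gen_field {\<zeta>} \<subseteq> ?E"
        by (intro gen_field_min) (auto simp: C2.FF_inverse tau_def C2.sigk_inverse)
      then show ?thesis using that by (auto simp: C1.gen_field_FF)
    qed
    have span: "\<exists>c. (\<forall>i<p. c i \<in> C1.FF) \<and> x = (\<Sum>i<p. c i * \<xi> ^ i)" if x: "x \<in> C2.FF" for x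
    proof -
      let ?Q = "\<lambda>x. \<exists>c. (\<forall>i<p. c i \<in> C1.FF) \<and> x = (\<Sum>i<p. c i * \<xi> ^ i)"
      obtain m where m: "p = Suc m" using p1 by (cases p) auto
      have "?Q (poly (of_int_poly f) \<xi>)" for f :: "int poly"
      proof (induction f)
        case 0
        show ?case by (intro exI[of _ "\<lambda>_. 0"]) simp
      next
        case (pCons a f)
        then obtain c where c: "\<forall>i<p. c i \<in> C1.FF" "poly (of_int_poly f) \<xi> = (\<Sum>i<p. c i * \<xi> ^ i)" by blast
        \<comment> \<open>Multiplication by \<open>\<xi>\<close> shifts the coefficients, and the
          top one returns to position 0 with a factor
          \<open>\<xi>\<^sup>p = \<zeta>\<close>.\<close>
        define d where "d i = (if i = 0 then of_int a + c m * \<zeta> else c (i - 1))" for i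
        have "(\<Sum>i<p. d i * \<xi> ^ i) = d 0 * \<xi> ^ 0 + (\<Sum>i<m. d (Suc i) * \<xi> ^ Suc i)"
          unfolding m by (rule sum.lessThan_Suc_shift)
        also have "\<dots> = of_int a + \<xi> * (\<Sum>i<p. c i * \<xi> ^ i)"
          unfolding m by (simp add: d_def sum_distrib_left distrib_left mult_ac xi[symmetric, unfolded m])
        also have "\<dots> = poly (of_int_poly (pCons a f)) \<xi>" using c(2) by simp
        finally have "poly (of_int_poly (pCons a f)) \<xi> = (\<Sum>i<p. d i * \<xi> ^ i)" ..
        moreover have "\<forall>i<p. d i \<in> C1.FF"
          using c(1) m by (auto simp: d_def intro!: C1.FF.add C1.FF.mult C1.FF.of_int KM.\<zeta>_K)
        ultimately show ?case by blast
      qed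
      moreover obtain e f where e: "e \<noteq> 0" "of_int e * x = poly (of_int_poly f) \<xi>" using x by (rule C2.FFE)
      ultimately obtain c where c: "\<forall>i<p. c i \<in> C1.FF" "of_int e * x = (\<Sum>i<p. c i * \<xi> ^ i)" by metis
      have "x = inverse (of_int e) * (of_int e * x)" using e(1) by simp
      then have "x = (\<Sum>i<p. inverse (of_int e) * c i * \<xi> ^ i)"
        unfolding c(2) by (simp add: sum_distrib_left mult.assoc)
      moreover have "\<forall>i<p. inverse (of_int e) * c i \<in> C1.FF"
        using c(1) by (auto intro!: C1.FF.mult KM.inverse C1.FF.of_int)
      ultimately show ?thesis by (intro exI[of _ "\<lambda>i. inverse (of_int e) * c i"] conjI)
    qed
    obtain f where f: "C1.FF.cin f" "KM.nrm \<alpha> f = \<zeta>"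
    proof (rule KM.norm_reciprocity[OF sK assms(6) C2.FF.number_ring_axioms KE])
      show "(\<Prod>i<p. (tau ^^ i) y) = of_nat N" unfolding tau_pow by (rule y(2))
      show "(tau ^^ p) y = y" unfolding tau_pow
        using C2.sig_n[OF y(1)] by (simp add: C2.n_square mult.commute)
    qed (use y(1) C2.FF_z xi tau_xi \<open>\<not> p dvd t\<close> span tau_K in
        \<open>auto simp: tau_def C2.sigk_FF C2.sigk_add C2.sigk_mult\<close>)
    have "poly f \<alpha> \<noteq> 0"
    proof
      assume "poly f \<alpha> = 0"
      then have "poly f (\<zeta> ^ 0 * \<alpha>) = 0" by simp
      then have "KM.nrm \<alpha> f = 0" unfolding KM.nrm_def using p1 by (intro prod_zero bexI[of _ 0]) auto
      then show False using f(2) KM.\<zeta>_nz by simp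
    qed
    moreover have "poly f \<alpha> \<in> L" unfolding L KM.LL_def using f(1) by blast
    ultimately show "\<zeta> \<in> field_norm K L ` (L - {0})" using fn[OF f(1)] f(2) by force
  qed
qed

end
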